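(* Let $\pi$ be a fixed meta-prior on $\mathcal{A}$, $\mathfrak{P}(A)$ a fixed data-independent family as below, $\delta>0$, and $\lambda>0$, $\lambda_M>0$ fixed. Then with probability at least $1-\delta$ over the sampling of the training tasks and datasets, simultaneously for all meta-posteriors $\rho$ and hyper-posteriors $\mathcal{Q}(A)$, $$\mathcal{R}^S_M(\rho)\;\le\;\Phi^{-1}_n\!\left(\frac{M}{n\,m_{\max}}\,\Phi^{-1}_M\Big(\widehat{\mathcal{R}}^S(\rho)\,\Big|\,C(\rho),\lambda\Big)\,\Big|\,\mathrm{KL}(\rho\|\pi)+\log\frac2\delta,\ \lambda_M\right),$$ where $M=\sum_i m_i$ and $C(\rho)=\mathrm{KL}(\rho\|\pi)+\mathbb{E}_{A\sim\rho}[\mathrm{KL}(\mathfrak{Q}(A)\|\mathfrak{P}(A))]+\log\frac2\delta$.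
   Context: Meta-learning setting: $\tau$ is an unknown environment distribution over triples $(D,m,S)$, $D$ a distribution on $\mathcal{Z}$, $m\in\{1,\dots,m_{\max}\}$, $S$ consisting of $m$ i.i.d. samples from $D$. Training tasks $(D_i,m_i,S_i)$, $i=1,\dots,n$, are i.i.d. from $\tau$. A loss $\ell:\mathcal{F}\times\mathcal{Z}\to[0,1]$ is fixed; $\ell(z,Q)=\mathbb{E}_{f\sim Q}\ell(f,z)$. Each algorithm $A\in\mathcal{A}$ maps a dataset $S$ to a posterior $A(S)$ (distribution on $\mathcal{F}$). Meta-prior $\pi$ (data-independent) and meta-posterior $\rho$ are distributions on $\mathcal{A}$. For each $A$, $\mathcal{P}(A)$ is a data-independent hyper-prior and $\mathcal{Q}(A)$ a data-dependent hyper-posterior; $\mathfrak{Q}(A)=\mathcal{Q}(A)\times A(S_1)\times\cdots\times A(S_n)$, and $\mathfrak{P}(A)$ is generated by $P\sim\mathcal{P}(A)$, then $f_1,\dots,f_n$ i.i.d. $\sim P$. $\widehat{\mathcal{R}}^S(\rho)=\mathbb{E}_{A\sim\rho}\frac1M\sum_{i=1}^n\sum_{z\in S_i}\ell(z,A(S_i))$; $\mathcal{R}^S_M(\rho)=\mathbb{E}_{A\sim\rho}\mathbb{E}_{(D,m,S)\sim\tau}\mathbb{E}_{z\sim D}\frac{m}{m_{\max}}\ell(z,A(S))$. For an integer $N$, $\Phi^{-1}_N(q|b,\lambda)=\sup\{p\in[0,1]:-N\log(1-p+pe^{-\lambda/N})\le\lambda q+b\}$. $\mathrm{KL}$ is the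 Kullback–Leibler divergence. *)

theory Defs
  imports "HOL-Probability.Probability"
begin

text \<open>KL mu nu is KL(mu || nu).  The library's KL_divergence b M N is the integral over N of
  log_b (dN/dM), i.e. KL(N||M).  When mu is not absolutely continuous w.r.t. nu, or the
  log-density is not mu-integrable (for probability measures this means the divergence is
  +infinity), the value is infinity.\<close>

definition KL :: "'a measure \<Rightarrow> 'a measure \<Rightarrow> ennreal" where
  "KL mu nu =
     (if absolutely_continuous nu mu \<and> integrable mu (entropy_density (exp 1) nu mu)
      then ennreal (KL_divergence (exp 1) nu mu) else \<infinity>)"

definition Phi_inv :: "nat \<Rightarrow> real \<Rightarrow> ereal \<Rightarrow> real \<Rightarrow> real" where
  "Phi_inv N q b lam =
     Sup {p \<in> {0..1}.
       ereal (- real N * ln (1 - p + p * exp (- lam / real N))) \<le> ereal (lam * q) + b}"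

text \<open>A task is a triple (D, m, s) where s is an infinite i.i.d. D-sequence; the dataset S of
  the task consists of its first m entries.  The environment tau is obtained from a
  distribution tau0 of (D, m) by drawing the samples i.i.d. from D.\<close>

type_synonym 'z task = "'z measure \<times> nat \<times> (nat \<Rightarrow> 'z)"

definition task_space :: "'z measure \<Rightarrow> 'z task measure" where
  "task_space MZ = prob_algebra MZ \<Otimes>\<^sub>M count_space UNIV \<Otimes>\<^sub>M (\<Pi>\<^sub>M j\<in>UNIV. MZ)"

definition env :: "'z measure \<Rightarrow> ('z measure \<times> nat) measure \<Rightarrow> 'z task measure" where
  "env MZ tau0 = tau0 \<bind> (\<lambda>(D, m). distr (\<Pi>\<^sub>M j\<in>UNIV. D) (task_space MZ) (\<lambda>s. (D, m, s)))"

definition dataset :: "'z task \<Rightarrow> 'z list" where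
  "dataset t = (case t of (D, m, s) \<Rightarrow> map s [0..<m])"

definition tsize :: "'z task \<Rightarrow> nat" where
  "tsize t = fst (snd t)"

definition train_space :: "nat \<Rightarrow> 'z task measure \<Rightarrow> (nat \<Rightarrow> 'z task) measure" where
  "train_space n tau = (\<Pi>\<^sub>M i\<in>{..<n}. tau)"

definition totalM :: "nat \<Rightarrow> (nat \<Rightarrow> 'z task) \<Rightarrow> nat" where
  "totalM n w = (\<Sum>i<n. tsize (w i))"

definition lossQ :: "('f \<Rightarrow> 'z \<Rightarrow> real) \<Rightarrow> 'z \<Rightarrow> 'f measure \<Rightarrow> real" where
  "lossQ l z Q = (\<integral>f. l f z \<partial>Q)"

definition emp_risk :: "('f \<Rightarrow> 'z \<Rightarrow> real) \<Rightarrow> ('a \<Rightarrow> 'z list \<Rightarrow> 'f measure) \<Rightarrow> nat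
    \<Rightarrow> (nat \<Rightarrow> 'z task) \<Rightarrow> 'a measure \<Rightarrow> real" where
  "emp_risk l alg n w rho =
     (\<integral>A. (1 / real (totalM n w)) *
        (\<Sum>i<n. \<Sum>z\<leftarrow>dataset (w i). lossQ l z (alg A (dataset (w i)))) \<partial>rho)"

definition risk_M :: "('f \<Rightarrow> 'z \<Rightarrow> real) \<Rightarrow> ('a \<Rightarrow> 'z list \<Rightarrow> 'f measure) \<Rightarrow> nat
    \<Rightarrow> 'z task measure \<Rightarrow> 'a measure \<Rightarrow> real" where
  "risk_M l alg mmax tau rho =
     (\<integral>A. (\<integral>t. (\<integral>z. (real (tsize t) / real mmax) * lossQ l z (alg A (dataset t)) \<partial>(fst t))
        \<partial>tau) \<partial>rho)"

definition hyp_space :: "nat \<Rightarrow> 'f measure \<Rightarrow> ('f measure \<times> (nat \<Rightarrow> 'f)) measure" where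
  "hyp_space n MF = prob_algebra MF \<Otimes>\<^sub>M (\<Pi>\<^sub>M i\<in>{..<n}. MF)"

definition frakQ :: "('a \<Rightarrow> 'z list \<Rightarrow> 'f measure) \<Rightarrow> nat \<Rightarrow> (nat \<Rightarrow> 'z task)
    \<Rightarrow> ('a \<Rightarrow> 'f measure measure) \<Rightarrow> 'a \<Rightarrow> ('f measure \<times> (nat \<Rightarrow> 'f)) measure" where
  "frakQ alg n w Q A = Q A \<Otimes>\<^sub>M (\<Pi>\<^sub>M i\<in>{..<n}. alg A (dataset (w i)))"

definition frakP :: "'f measure \<Rightarrow> nat \<Rightarrow> ('a \<Rightarrow> 'f measure measure) \<Rightarrow> 'a
    \<Rightarrow> ('f measure \<times> (nat \<Rightarrow> 'f)) measure" where
  "frakP MF n PP A = PP A \<bind> (\<lambda>P. distr (\<Pi>\<^sub>M i\<in>{..<n}. P) (hyp_space n MF) (\<lambda>fs. (P, fs)))"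

definition Cterm :: "'a measure \<Rightarrow> 'a measure \<Rightarrow> ('a \<Rightarrow> ('f measure \<times> (nat \<Rightarrow> 'f)) measure)
    \<Rightarrow> ('a \<Rightarrow> ('f measure \<times> (nat \<Rightarrow> 'f)) measure) \<Rightarrow> real \<Rightarrow> ereal" where
  "Cterm rho piM fQ fP delta =
     enn2ereal (KL rho piM) + enn2ereal (\<integral>\<^sup>+ A. KL (fQ A) (fP A) \<partial>rho) + ereal (ln (2 / delta))"

end

theory Submission
  imports Defs
begin

text \<open>
  For fixed hypotheses, the laws of the samples and of the tasks give two exponential moments
  bounded by one, both of Catoni type. Integrating them against the prior and applying Markov's
  inequality yields an event on which the Donsker--Varadhan inequality and the convexity of
  \<open>p \<mapsto> - N ln (1 - p + p exp (- \<lambda> / N))\<close> give the inner and the outer bound simultaneously for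
  all posteriors.

  The delicate point is that the hyper-priors are not assumed to depend measurably on the
  algorithm, so the prior on pairs (algorithm, hypotheses) is not available as a measure. The loss
  only sees countably many events, hence hypotheses may be coded as points of the unit interval.
  The distributions on the unit interval form a compact space, and this allows one to select a
  measurable family of distributions that satisfies, almost surely, every measurable inequality
  between continuous integrals satisfied by the given family. As the posteriors are measurable in
  the algorithm, the change-of-measure inequalities survive this replacement.
\<close>

section \<open>Measurable replacement of an arbitrary family of distributions\<close>

text \<open>The inner moment bound holds at each fixed real code, so on the data side any Markov
  kernel from algorithms to codes could act as the prior. What must be carried over from the given
  family is only a lower bound on its exponential integrals. Change of measure provides it as
  \<open>exp (- KL) * exp (posterior mean of phi) <= prior mean of exp phi\<close>, whose left side
  is measurable in the algorithm even though the right side need not be. The replacing kernel is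
  chosen before the data are seen. The null set where the transported inequality fails may depend on
  the data, the hyper-posterior and phi; this is harmless, because it is used for one outcome at a
  time and a posterior of finite divergence does not charge it. Compactness handles continuous phi
  only, whereas the coded gap between risk and training loss is merely Borel; an L^1 approximation
  closes this gap. The constant 2 / delta comes from two Markov inequalities that share the failure
  probability delta.\<close>

text \<open>\<open>H\<close> is a countable intersection of measurable supersets of \<open>B\<close>
  whose measures tend to the infimum \<open>m\<close>. For another measurable superset
  \<open>T\<close>, the set \<open>H \<inter> T\<close> still has measure at least \<open>m\<close>,
  so \<open>H - T\<close> is null. \<open>B\<close> itself may be non-measurable.\<close>

lemma (in finite_measure) measurable_hull_exists:
  assumes "B \<subseteq> space M"
  shows "\<exists>H\<in>sets M. B \<subseteq> H \<and> (\<forall>S\<in>sets M. B \<subseteq> S \<longrightarrow> (AE x in M. x \<in> H \<longrightarrow> x \<in> S))"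
proof -
  define \<S> where "\<S> = {S \<in> sets M. B \<subseteq> S}"
  define m where "m = Inf (measure M ` \<S>)"
  have bdd: "bdd_below (measure M ` \<S>)" by (auto intro!: bdd_belowI[of _ 0])
  have ne: "\<S> \<noteq> {}" using assms by (auto simp: \<S>_def)
  have "\<exists>S\<in>\<S>. measure M S < m + inverse (real (Suc k))" for k
    using cInf_lessD[of "measure M ` \<S>" "m + inverse (real (Suc k))"] ne
    by (auto simp: m_def)
  then obtain S where S: "\<And>k. S k \<in> \<S>" "\<And>k. measure M (S k) < m + inverse (real (Suc k))"
    by metis
  define H where "H = (\<Inter>k. S k)"
  have H: "H \<in> sets M" "B \<subseteq> H" using S(1) by (auto simp: H_def \<S>_def)
  have Hm: "measure M H \<le> m"
  proof (rule LIMSEQ_le_const)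
    show "(\<lambda>k. m + inverse (real (Suc k))) \<longlonglongrightarrow> m"
      using tendsto_add[OF tendsto_const LIMSEQ_inverse_real_of_nat] by simp
    have "measure M H \<le> measure M (S k)" for k
      using S(1) by (intro finite_measure_mono) (auto simp: H_def \<S>_def)
    then show "\<exists>N. \<forall>k\<ge>N. measure M H \<le> m + inverse (real (Suc k))"
      using S(2) by (meson less_imp_le order_trans)
  qed
  have "AE x in M. x \<in> H \<longrightarrow> x \<in> T" if T: "T \<in> sets M" "B \<subseteq> T" for T
  proof -
    have "m \<le> measure M (H \<inter> T)"
      unfolding m_def using T H bdd by (intro cInf_lower) (auto simp: \<S>_def)
    moreover have "measure M (H - T) = measure M H - measure M (H \<inter> T)"
      using T H by (intro finite_measure_Diff') auto
    ultimately have "measure M (H - T) = 0"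
      using Hm measure_nonneg[of M "H - T"] by linarith
    then have "H - T \<in> null_sets M" using T H by (auto simp: null_sets_def emeasure_eq_measure)
    then show ?thesis by (rule AE_I') auto
  qed
  then show ?thesis using H by blast
qed

text \<open>Greedy choice: the next bit of \<open>s\<close> is true at each point of the measurable hull of the
  cylinder that extends the bits chosen so far by a true bit.\<close>

lemma (in finite_measure) measurable_bit_selector:
  fixes c :: "'a \<Rightarrow> nat \<Rightarrow> bool"
  obtains s :: "nat \<Rightarrow> 'a \<Rightarrow> bool" where "\<And>k. Measurable.pred M (s k)"
    and "\<And>k T. (\<And>x. T x \<in> sets M) \<Longrightarrow>
       (\<And>A. A \<in> space M \<Longrightarrow> A \<in> T (map (c A) [0..<k])) \<Longrightarrow>
       AE A in M. A \<in> T (map (\<lambda>j. s j A) [0..<k])"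
proof -
  \<comment> \<open>\<open>B x\<close> is the cylinder of the points whose bits start with
    \<open>x\<close>. As \<open>c\<close> is arbitrary, it may be non-measurable, so only its hull
    \<open>H x\<close> can steer the selection. There are countably many strings, hence countably
    many null sets to discard.\<close>
  define B where "B x = {A \<in> space M. map (c A) [0..<length x] = x}" for x
  have "\<forall>x. \<exists>H. H \<in> sets M \<and> B x \<subseteq> H \<and> (\<forall>S\<in>sets M. B x \<subseteq> S \<longrightarrow> (AE y in M. y \<in> H \<longrightarrow> y \<in> S))"
  proof
    fix x
    have "B x \<subseteq> space M" by (auto simp: B_def)
    from measurable_hull_exists[OF this]
    show "\<exists>H. H \<in> sets M \<and> B x \<subseteq> H \<and> (\<forall>S\<in>sets M. B x \<subseteq> S \<longrightarrow> (AE y in M. y \<in> H \<longrightarrow> y \<in> S))"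
      by blast
  qed
  from choice[OF this] obtain H where H[measurable]: "\<And>x. H x \<in> sets M" and BH: "\<And>x. B x \<subseteq> H x"
    and hull: "\<And>x S. S \<in> sets M \<Longrightarrow> B x \<subseteq> S \<Longrightarrow> AE y in M. y \<in> H x \<longrightarrow> y \<in> S"
    by blast
  define str where "str = rec_nat (\<lambda>A. []) (\<lambda>k p A. p A @ [A \<in> H (p A @ [True])])"
  have str0: "str 0 A = []" and strS: "str (Suc k) A = str k A @ [A \<in> H (str k A @ [True])]" for k A
    by (simp_all add: str_def)
  define s where "s k A = (A \<in> H (str k A @ [True]))" for k A
  have str_map: "str k A = map (\<lambda>j. s j A) [0..<k]" for k A
    by (induction k) (auto simp: str0 strS s_def)
  have len: "length (str k A) = k" for k A by (simp add: str_map)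
  have str_meas[measurable]: "str k \<in> M \<rightarrow>\<^sub>M count_space UNIV" for k
  proof (induction k)
    case 0 show ?case by (simp add: str0[abs_def])
  next
    case (Suc k)
    have "(\<lambda>A. (\<lambda>x A. x @ [A \<in> H (x @ [True])]) (str k A) A) \<in> M \<rightarrow>\<^sub>M count_space UNIV"
    proof (rule measurable_compose_countable'[OF _ Suc countableI_type])
      fix x
      have "(\<lambda>b. x @ [b]) \<circ> (\<lambda>A. A \<in> H (x @ [True])) \<in> M \<rightarrow>\<^sub>M count_space UNIV"
        by (intro measurable_comp[where N="count_space UNIV"]) measurable
      then show "(\<lambda>A. x @ [A \<in> H (x @ [True])]) \<in> M \<rightarrow>\<^sub>M count_space UNIV"
        by (simp add: comp_def)
    qed
    then show ?case by (simp add: strS[abs_def])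
  qed
  have sm: "Measurable.pred M (s k)" for k
  proof -
    have "(\<lambda>A. (\<lambda>x A. A \<in> H (x @ [True])) (str k A) A) \<in> M \<rightarrow>\<^sub>M count_space UNIV"
      by (rule measurable_compose_countable'[OF _ str_meas countableI_type]) measurable
    then show ?thesis by (simp add: s_def[abs_def])
  qed
  \<comment> \<open>A cylinder is the union of its two children, so the hulls of the children cover
    its hull up to a null set.\<close>
  have step: "AE A in M. \<forall>x. A \<in> H x \<longrightarrow> A \<in> H (x @ [True]) \<union> H (x @ [False])"
  proof (rule AE_all_countable[THEN iffD2], rule allI)
    fix x show "AE A in M. A \<in> H x \<longrightarrow> A \<in> H (x @ [True]) \<union> H (x @ [False])"
    proof (rule hull)
      have "B x \<subseteq> B (x @ [True]) \<union> B (x @ [False])"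
        by (auto simp: B_def)
      then show "B x \<subseteq> H (x @ [True]) \<union> H (x @ [False])" using BH by blast
    qed measurable
  qed
  \<comment> \<open>Invariant of the greedy choice: almost every point stays in the hull of its
    selected string. If the bit true is refused, the covering above puts the point in the hull of
    the false child.\<close>
  have inH: "AE A in M. A \<in> H (str k A)" for k
  proof (induction k)
    case 0
    have "B [] = space M" by (auto simp: B_def)
    then show ?case using BH[of "[]"] by (auto simp: str0)
  next
    case (Suc k)
    from Suc step show ?case
      by eventually_elim (auto simp: strS, metis (full_types))
  qed
  \<comment> \<open>For a string \<open>x\<close> of length \<open>k\<close>, \<open>T x\<close> is
    a measurable superset of \<open>B x\<close> and so contains \<open>H x\<close> almost
    everywhere; the invariant then applies to the selected string.\<close>
  have "AE A in M. A \<in> T (map (\<lambda>j. s j A) [0..<k])"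
    if T: "\<And>x. T x \<in> sets M" and c: "\<And>A. A \<in> space M \<Longrightarrow> A \<in> T (map (c A) [0..<k])" for k T
  proof -
    have "AE A in M. \<forall>x. A \<in> H x \<longrightarrow> length x = k \<longrightarrow> A \<in> T x"
    proof (rule AE_all_countable[THEN iffD2], rule allI)
      fix x show "AE A in M. A \<in> H x \<longrightarrow> length x = k \<longrightarrow> A \<in> T x"
      proof (cases "length x = k")
        case True
        have "B x \<subseteq> T x"
        proof
          fix A assume "A \<in> B x"
          then have "A \<in> space M" "map (c A) [0..<k] = x" using True by (auto simp: B_def)
          with c[of A] show "A \<in> T x" by simp
        qed
        from hull[OF T this] show ?thesis by eventually_elim auto
      qed simp
    qed
    with inH[of k] show ?thesis
      by eventually_elim (use len in \<open>auto simp: str_map\<close>)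
  qed
  with sm show thesis by (rule that)
qed

text \<open>No measurability of \<open>A \<mapsto> \<mu> A\<close> is assumed. By compactness of the set of
  distributions on the unit interval, measurable selection of the bits of the distribution
  functions yields an honest Markov kernel.\<close>

lemma (in prob_space) measurable_kernel_envelope:
  fixes \<mu> :: "'a \<Rightarrow> real measure"
  assumes \<mu>: "\<And>A. A \<in> space M \<Longrightarrow> real_distribution (\<mu> A)"
    and supp: "\<And>A. A \<in> space M \<Longrightarrow> measure (\<mu> A) {0..1} = 1"
  obtains \<nu> where "\<nu> \<in> M \<rightarrow>\<^sub>M prob_algebra borel"
    and "\<And>(\<psi> :: real \<Rightarrow> real) v b. \<lbrakk>continuous_on UNIV \<psi>; \<And>x. \<bar>\<psi> x\<bar> \<le> b; v \<in> borel_measurable M;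
        \<And>A. A \<in> space M \<Longrightarrow> v A \<le> (\<integral>x. \<psi> x \<partial>\<mu> A)\<rbrakk> \<Longrightarrow> AE A in M. v A \<le> (\<integral>x. \<psi> x \<partial>\<nu> A)"
proof -
  \<comment> \<open>The \<open>i\<close>-th bit of a distribution tells whether its distribution
    function at the rational \<open>fst (e i)\<close> exceeds the rational \<open>snd (e i)\<close>;
    all bits together determine it.\<close>
  define e :: "nat \<Rightarrow> rat \<times> rat" where "e = from_nat_into UNIV"
  have e_surj: "\<exists>i. e i = p" for p
    using from_nat_into_surj[of "UNIV :: (rat \<times> rat) set" p] by (auto simp: e_def)
  define c where "c A i = (cdf (\<mu> A) (of_rat (fst (e i))) > of_rat (snd (e i)))" for A i
  obtain s where s[measurable]: "\<And>k. Measurable.pred M (s k)"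
    and sel: "\<And>k T. (\<And>x. T x \<in> sets M) \<Longrightarrow>
       (\<And>A. A \<in> space M \<Longrightarrow> A \<in> T (map (c A) [0..<k])) \<Longrightarrow>
       AE A in M. A \<in> T (map (\<lambda>j. s j A) [0..<k])"
    by (rule measurable_bit_selector[of c]) blast
  \<comment> \<open>\<open>G A q\<close> is the value at \<open>q\<close> encoded by the selected
    bits, and \<open>F A\<close> the right-continuous function recovered from such values. The
    clipping to the unit interval and the default 1 keep supremum and infimum bounded for every bit
    sequence, also for those that come from no distribution.\<close>
  define G where "G A q = (SUP i. if fst (e i) = q \<and> s i A \<and> snd (e i) \<le> 1 then max 0 (of_rat (snd (e i))) else 0 :: real)" for A q
  define F where "F A x = (INF q. if x < of_rat q then G A q else 1 :: real)" for A and x :: real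

  \<comment> \<open>If the points \<open>f k\<close> agree with the selected string at
    \<open>A\<close> on ever longer prefixes, each bit is eventually constant along
    \<open>f\<close>. Their distributions have a weak limit along a subsequence, and the bits force
    its distribution function to be \<open>F A\<close>, whichever \<open>f\<close> was
    taken.\<close>
  have lim: "\<exists>r N. strict_mono r \<and> real_distribution N \<and> weak_conv_m (\<lambda>k. \<mu> (f (r k))) N \<and> cdf N = F A"
    if f: "\<And>k. f k \<in> space M" and fc: "\<And>k j. j < k \<Longrightarrow> c (f k) j = s j A" for f :: "nat \<Rightarrow> 'a" and A
  proof -
    interpret f: real_distribution "\<mu> (f k)" for k using \<mu>[OF f] .
    have "tight (\<lambda>k. \<mu> (f k))"
      unfolding tight_def
    proof (intro conjI allI impI)
      fix \<epsilon> :: real assume "\<epsilon> > 0"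
      \<comment> \<open>\<open>tight\<close> asks for half-open intervals, so the left end moves
        below 0 to keep an atom at 0 inside.\<close>
      have "1 \<le> measure (\<mu> (f k)) {-1<..1}" for k
        using f.finite_measure_mono[of "{0..1}" "{-1<..1}" k] supp[OF f[of k]]
        by (simp add: greaterThanAtMost_def atLeastAtMost_def subset_eq)
      then show "\<exists>a b. a < b \<and> (\<forall>k. 1 - \<epsilon> < measure (\<mu> (f k)) {a<..b})"
        using \<open>\<epsilon> > 0\<close> by (intro exI[of _ "-1"] exI[of _ 1]) (auto intro: less_le_trans[of _ 1])
    qed unfold_locales
    from tight_imp_convergent_subsubsequence[OF this strict_mono_id]
    obtain r N where r: "strict_mono r" and N: "real_distribution N"
      and wc: "weak_conv_m (\<lambda>k. \<mu> (f (r k))) N"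
      by (auto simp: comp_def)
    interpret N: real_distribution N by fact
    have Glim: "(\<lambda>k. cdf (\<mu> (f k)) (of_rat q)) \<longlonglongrightarrow> G A q" for q
    proof -
      have bit: "\<forall>\<^sub>F k in sequentially. (cdf (\<mu> (f k)) (of_rat q) > of_rat (snd (e i))) = s i A"
        if "fst (e i) = q" for i
        using eventually_gt_at_top[of i] by eventually_elim (use fc that in \<open>auto simp: c_def\<close>)
      have bdd: "bdd_above (range (\<lambda>i. if fst (e i) = q \<and> s i A \<and> snd (e i) \<le> 1 then max 0 (of_rat (snd (e i))) else 0 :: real))"
        by (intro bdd_aboveI[of _ 1]) auto
      show ?thesis
      proof (rule order_tendstoI)
        fix a assume "a < G A q"
        then obtain i where i: "a < (if fst (e i) = q \<and> s i A \<and> snd (e i) \<le> 1 then max 0 (of_rat (snd (e i))) else 0 :: real)"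
          unfolding G_def using less_cSUP_iff[OF _ bdd] by auto
        show "\<forall>\<^sub>F k in sequentially. a < cdf (\<mu> (f k)) (real_of_rat q)"
        proof (cases "a < 0")
          case True
          then show ?thesis using f.cdf_nonneg[of _ "of_rat q"]
            by (intro always_eventually allI) (meson less_le_trans)
        next
          case False
          with i have *: "fst (e i) = q" "s i A" "a < of_rat (snd (e i))"
            by (auto split: if_splits simp: max_def)
          from bit[OF *(1)] show ?thesis by eventually_elim (use * in auto)
        qed
      next
        fix a assume a: "G A q < a"
        show "\<forall>\<^sub>F k in sequentially. cdf (\<mu> (f k)) (real_of_rat q) < a"
        proof (cases "a \<le> 1")
          case False
          then show ?thesis using f.cdf_bounded_prob[of _ "of_rat q"]
            by (intro always_eventually allI) (meson le_less_trans not_le)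
        next
          case True
          obtain p where p: "G A q < of_rat p" "of_rat p < a" using of_rat_dense[OF a] by blast
          obtain i where i: "e i = (q, p)" using e_surj by blast
          have "\<not> s i A"
          proof
            assume "s i A"
            have "of_rat p < (1::real)" using p True by linarith
            then have "p \<le> 1" by (metis less_imp_le of_rat_1 of_rat_less)
            then have "of_rat p \<le> G A q"
              unfolding G_def using i \<open>s i A\<close> by (intro cSUP_upper2[OF bdd, of i]) auto
            with p show False by simp
          qed
          with bit[of i] i have "\<forall>\<^sub>F k in sequentially. \<not> (cdf (\<mu> (f k)) (of_rat q) > of_rat p)"
            by auto
          then show ?thesis by eventually_elim (use p in auto)
        qed
      qed
    qed
    have G01: "0 \<le> G A q" "G A q \<le> 1" for q
    proof -
      show "0 \<le> G A q" by (rule LIMSEQ_le_const[OF Glim]) (auto simp: f.cdf_nonneg)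
      show "G A q \<le> 1" by (rule LIMSEQ_le_const2[OF Glim]) (auto simp: f.cdf_bounded_prob)
    qed
    \<comment> \<open>Weak convergence speaks of continuity points of \<open>N\<close>, and
      rationals may be atoms. Atoms are countable, so every interval holds a continuity point
      against which the rational values can be compared.\<close>
    have cont_pt: "\<exists>y. x < y \<and> y < z \<and> isCont (cdf N) y" if "x < z" for x z
    proof -
      have "uncountable {x<..<z}" using that by (rule uncountable_open_interval[THEN iffD2])
      then have "uncountable ({x<..<z} - {y. measure N {y} > 0})"
        using N.countable_atoms uncountable_minus_countable by blast
      then obtain y where "y \<in> {x<..<z} - {y. measure N {y} > 0}"
        by (metis countable_empty ex_in_conv)
      then have "x < y" "y < z" "measure N {y} = 0"
        using measure_nonneg[of N "{y}"] by (auto simp: not_less intro: antisym)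
      then show ?thesis using N.isCont_cdf by blast
    qed
    have wcy: "(\<lambda>k. cdf (\<mu> (f (r k))) y) \<longlonglongrightarrow> cdf N y" if "isCont (cdf N) y" for y
      using wc that by (simp add: weak_conv_m_def weak_conv_def)
    have Gr: "(\<lambda>k. cdf (\<mu> (f (r k))) (of_rat q)) \<longlonglongrightarrow> G A q" for q
      using LIMSEQ_subseq_LIMSEQ[OF Glim r] by (simp add: comp_def)
    have bddF: "bdd_below (range (\<lambda>q. if x < of_rat q then G A q else 1 :: real))" for x
      using G01 by (intro bdd_belowI[of _ 0]) auto
    have "cdf N x = F A x" for x
    proof (rule antisym)
      show "cdf N x \<le> F A x"
        unfolding F_def
      proof (rule cINF_greatest)
        fix q show "cdf N x \<le> (if x < of_rat q then G A q else 1)"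
        proof (cases "x < of_rat q")
          case True
          from cont_pt[OF this] obtain y where y: "x < y" "y < of_rat q" "isCont (cdf N) y" by blast
          have "cdf N x \<le> cdf N y" using y by (intro N.cdf_nondecreasing) auto
          also have "\<dots> \<le> G A q"
            by (rule LIMSEQ_le[OF wcy[OF y(3)] Gr]) (use y f.cdf_nondecreasing in auto)
          finally show ?thesis using True by simp
        qed (simp add: N.cdf_bounded_prob)
      qed simp
    next
      show "F A x \<le> cdf N x"
      proof (rule field_le_epsilon)
        fix \<epsilon> :: real assume "\<epsilon> > 0"
        have "(cdf N \<longlongrightarrow> cdf N x) (at_right x)"
          using N.cdf_is_right_cont[of x] by (simp add: continuous_within)
        then have "\<forall>\<^sub>F y in at_right x. cdf N y < cdf N x + \<epsilon>"
          using \<open>\<epsilon> > 0\<close> by (intro order_tendstoD(2)[where y="cdf N x"]) auto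
        then obtain z where z: "x < z" "\<And>y. x < y \<Longrightarrow> y < z \<Longrightarrow> cdf N y < cdf N x + \<epsilon>"
          by (auto simp: eventually_at_right[OF less_add_one])
        from cont_pt[OF z(1)] obtain y where y: "x < y" "y < z" "isCont (cdf N) y" by blast
        obtain q where q: "x < of_rat q" "of_rat q < y" using of_rat_dense[OF y(1)] by blast
        have "F A x \<le> G A q"
          unfolding F_def using q by (intro cINF_lower2[OF bddF, of q]) auto
        also have "\<dots> \<le> cdf N y"
          by (rule LIMSEQ_le[OF Gr wcy[OF y(3)]]) (use q f.cdf_nondecreasing in auto)
        also have "\<dots> \<le> cdf N x + \<epsilon>" using z(2) y by (simp add: less_imp_le)
        finally show "F A x \<le> cdf N x + \<epsilon>" .
      qed
    qed
    then show ?thesis using r N wc by blast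
  qed

  \<comment> \<open>\<open>P k x\<close> says that some point realises the prefix \<open>x\<close>.
    It is a property of the string alone, hence measurable after composition with the
    selection.\<close>
  define P where "P k x = (\<exists>A'\<in>space M. map (c A') [0..<k] = x)" for k x
  have str_meas[measurable]: "(\<lambda>A. map (\<lambda>j. s j A) [0..<k]) \<in> M \<rightarrow>\<^sub>M count_space UNIV" for k
  proof (induction k)
    case (Suc k)
    have "(\<lambda>(b, x). x @ [b]) \<circ> (\<lambda>A. (s k A, map (\<lambda>j. s j A) [0..<k])) \<in> M \<rightarrow>\<^sub>M count_space UNIV"
      by (rule measurable_comp[where N="count_space UNIV \<Otimes>\<^sub>M count_space UNIV"])
        (use Suc in \<open>auto intro!: measurable_Pair simp: pair_measure_countable\<close>)
    then show ?case by (simp add: comp_def)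
  qed simp
  have P_meas[measurable]: "Measurable.pred M (\<lambda>A. P k (map (\<lambda>j. s j A) [0..<k]))" for k
    using measurable_compose[OF str_meas, of "P k" "count_space UNIV" k] by simp
  have AE_P: "AE A in M. \<forall>k. P k (map (\<lambda>j. s j A) [0..<k])"
  proof (rule AE_all_countable[THEN iffD2], rule allI)
    fix k
    have "AE A in M. A \<in> (if P k (map (\<lambda>j. s j A) [0..<k]) then space M else {})"
      by (rule sel[of "\<lambda>x. if P k x then space M else {}"]) (auto simp: P_def)
    then show "AE A in M. P k (map (\<lambda>j. s j A) [0..<k])"
      by eventually_elim (auto split: if_splits)
  qed
  define good where "good A = (\<forall>k. P k (map (\<lambda>j. s j A) [0..<k]))" for A
  have good_meas[measurable]: "Measurable.pred M good" unfolding good_def[abs_def] by measurable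
  \<comment> \<open>On the null set where some prefix is not realised, \<open>F A\<close> may fail
    to be a distribution function; a point mass takes over to keep \<open>\<nu>\<close> a kernel
    everywhere.\<close>
  define \<nu> where "\<nu> A = (if good A then interval_measure (F A) else return borel 0)" for A
  have good_dist: "real_distribution (interval_measure (F A)) \<and> cdf (interval_measure (F A)) = F A"
    if "good A" for A
  proof -
    have "\<forall>k. \<exists>A'. A' \<in> space M \<and> map (c A') [0..<k] = map (\<lambda>j. s j A) [0..<k]"
      using that by (auto simp: good_def P_def)
    then obtain f where "\<And>k. f k \<in> space M" "\<And>k. map (c (f k)) [0..<k] = map (\<lambda>j. s j A) [0..<k]"
      by metis
    then have "\<And>k. f k \<in> space M" "\<And>k j. j < k \<Longrightarrow> c (f k) j = s j A" by auto
    from lim[of f A, OF this] obtain N where N: "real_distribution N" "cdf N = F A" by blast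
    interpret N: real_distribution N by fact
    note * = N.cdf_nondecreasing[unfolded N(2)] N.cdf_is_right_cont[unfolded N(2)]
      N.cdf_lim_at_bot[unfolded N(2)] N.cdf_lim_at_top_prob[unfolded N(2)]
    show ?thesis
      using real_distribution_interval_measure[of "F A"] cdf_interval_measure[of "F A"] * by auto
  qed
  have G_meas[measurable]: "(\<lambda>A. G A q) \<in> borel_measurable M" for q
    unfolding G_def
    by (rule borel_measurable_cSUP) (auto intro!: bdd_aboveI[of _ 1])
  have F_meas[measurable]: "(\<lambda>A. F A x) \<in> borel_measurable M" for x
  proof -
    have "0 \<le> G A q" for A q
      unfolding G_def by (rule cSUP_upper2[where x=0]) (auto intro!: bdd_aboveI[of _ 1])
    then show ?thesis
      unfolding F_def by (intro borel_measurable_cINF) (auto intro!: bdd_belowI[of _ 0])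
  qed
  have \<nu>_prob: "real_distribution (\<nu> A)" for A
    using good_dist[of A] prob_space_return[of "0::real" borel]
    by (auto simp: \<nu>_def real_distribution_def real_distribution_axioms_def)
  have \<nu>_meas: "\<nu> \<in> M \<rightarrow>\<^sub>M prob_algebra borel"
  proof (rule measurable_prob_algebra_generated[where \<Omega>=UNIV and G="range atMost"])
    show "sets borel = sigma_sets (UNIV::real set) (range atMost)"
      by (subst borel_eq_atMost) simp
    show "Int_stable (range (atMost :: real \<Rightarrow> _))" by (auto simp: Int_stable_def)
    show "prob_space (\<nu> A)" "sets (\<nu> A) = sets borel" for A
      using \<nu>_prob[of A] by (auto simp: real_distribution_def real_distribution_axioms_def)
    fix S :: "real set" assume "S \<in> range atMost"
    then obtain x where S: "S = {..x}" by auto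
    have "emeasure (\<nu> A) S = (if good A then ennreal (F A x) else indicator {..x} 0)" for A
    proof (cases "good A")
      case True
      then interpret N: real_distribution "interval_measure (F A)" using good_dist by blast
      have "emeasure (interval_measure (F A)) {..x} = ennreal (cdf (interval_measure (F A)) x)"
        by (simp add: cdf_def N.emeasure_eq_measure)
      then show ?thesis using True good_dist[OF True] by (simp add: \<nu>_def S)
    qed (simp add: \<nu>_def S)
    then show "(\<lambda>A. emeasure (\<nu> A) S) \<in> borel_measurable M" by simp
  qed auto
  have main: "AE A in M. v A \<le> (\<integral>x. \<psi> x \<partial>\<nu> A)"
    if \<psi>: "continuous_on UNIV \<psi>" and \<psi>b: "\<And>x. \<bar>\<psi> x\<bar> \<le> b" and v[measurable]: "v \<in> borel_measurable M"
      and le: "\<And>A. A \<in> space M \<Longrightarrow> v A \<le> (\<integral>x. \<psi> x \<partial>\<mu> A)" for \<psi> :: "real \<Rightarrow> real" and v b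
  proof -
    have b\<mu>: "(\<integral>x. \<psi> x \<partial>\<mu> A) \<le> b" if "A \<in> space M" for A
    proof -
      interpret \<mu>A: real_distribution "\<mu> A" using \<mu>[OF that] .
      have "integrable (\<mu> A) \<psi>"
        using \<psi>b borel_measurable_continuous_onI[OF \<psi>]
        by (intro \<mu>A.integrable_const_bound[where B=b]) (auto cong: measurable_cong_sets)
      then have "(\<integral>x. \<psi> x \<partial>\<mu> A) \<le> (\<integral>x. b \<partial>\<mu> A)"
        using \<psi>b by (intro integral_mono) (auto intro: order_trans[OF abs_ge_self])
      then show ?thesis using \<mu>A.prob_space by simp
    qed
    define C where "C k x = {A' \<in> space M. map (c A') [0..<k] = x}" for k x
    \<comment> \<open>The possibly non-measurable integral under \<open>\<mu> A\<close> is replaced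
      by its supremum over all points that share the first \<open>k\<close> bits. That supremum is
      one constant per string, so \<open>T k x\<close> is measurable, and \<open>A\<close> itself
      witnesses membership for its own bits.\<close>
    define T where "T k x = {A \<in> space M. C k x \<noteq> {} \<and> v A \<le> (SUP A'\<in>C k x. \<integral>y. \<psi> y \<partial>\<mu> A')}" for k x
    have "AE A in M. \<forall>k. A \<in> T k (map (\<lambda>j. s j A) [0..<k])"
    proof (rule AE_all_countable[THEN iffD2], rule allI, rule sel)
      show "T k x \<in> sets M" for k x unfolding T_def by measurable
      fix A k assume A: "A \<in> space M"
      then have "A \<in> C k (map (c A) [0..<k])" by (auto simp: C_def)
      then show "A \<in> T k (map (c A) [0..<k])"
        using A le[OF A] b\<mu> unfolding T_def
        by (auto intro!: cSUP_upper2[where x=A] bdd_aboveI[of _ b] simp: C_def)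
    qed
    then show ?thesis
    proof eventually_elim
      case (elim A)
      then have good: "good A" unfolding good_def P_def T_def C_def by blast
      \<comment> \<open>For every \<open>k\<close> there is a point with the selected prefix whose
        integral is above \<open>v A\<close> up to an error that tends to 0. The weak limit of these
        points is \<open>\<nu> A\<close>, and continuity of \<open>\<psi>\<close> carries the
        inequality there.\<close>
      have "\<exists>A'. A' \<in> space M \<and> map (c A') [0..<k] = map (\<lambda>j. s j A) [0..<k] \<and>
          v A - inverse (real (Suc k)) < (\<integral>y. \<psi> y \<partial>\<mu> A')" for k
      proof -
        let ?C = "C k (map (\<lambda>j. s j A) [0..<k])"
        have "?C \<noteq> {}" "v A - inverse (real (Suc k)) < (SUP A'\<in>?C. \<integral>y. \<psi> y \<partial>\<mu> A')"
          using elim unfolding T_def by (auto intro: less_le_trans[of _ "v A"])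
        from less_cSupD[OF _ this(2)] this(1) show ?thesis by (auto simp: C_def)
      qed
      then obtain f where f: "\<And>k. f k \<in> space M" "\<And>k. map (c (f k)) [0..<k] = map (\<lambda>j. s j A) [0..<k]"
        "\<And>k. v A - inverse (real (Suc k)) < (\<integral>y. \<psi> y \<partial>\<mu> (f k))" by metis
      then have "\<And>k. f k \<in> space M" "\<And>k j. j < k \<Longrightarrow> c (f k) j = s j A" by auto
      from lim[of f A, OF this] obtain r N where r: "strict_mono r" and N: "real_distribution N"
        and wc: "weak_conv_m (\<lambda>k. \<mu> (f (r k))) N" and cdfN: "cdf N = F A" by blast
      have "N = \<nu> A" using cdf_unique[OF N, of "\<nu> A"] good_dist[OF good] cdfN good by (simp add: \<nu>_def)
      have "(\<lambda>k. \<integral>y. \<psi> y \<partial>\<mu> (f (r k))) \<longlonglongrightarrow> (\<integral>y. \<psi> y \<partial>N)"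
        using \<psi> \<psi>b wc N \<mu> f(1)
        by (intro weak_conv_imp_integral_bdd_continuous_conv[where B=b])
          (auto simp: continuous_on_eq_continuous_at)
      note lim\<psi> = this
      have "(\<lambda>k. v A - inverse (real (Suc (r k)))) \<longlonglongrightarrow> v A - 0"
        using LIMSEQ_subseq_LIMSEQ[OF LIMSEQ_inverse_real_of_nat r]
        by (intro tendsto_diff) (auto simp: comp_def)
      then have "v A - 0 \<le> (\<integral>y. \<psi> y \<partial>N)"
        by (rule LIMSEQ_le[OF _ lim\<psi>]) (use f(3) in \<open>auto intro!: exI[of _ 0] less_imp_le\<close>)
      then show ?case by (simp add: \<open>N = \<nu> A\<close>)
    qed
  qed
  from \<nu>_meas main show thesis by (rule that)
qed

section \<open>Coding by the unit interval\<close>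

abbreviation bit_space :: "(nat \<Rightarrow> bool) measure" where
  "bit_space \<equiv> \<Pi>\<^sub>M j\<in>UNIV. count_space UNIV"

text \<open>The pairing of natural numbers interleaves countably many bit sequences into one, and
  \<open>p k\<close> reads the \<open>k\<close>-th back. This gives codes that are closed under
  countable operations.\<close>

lemma bit_space_merge:
  fixes \<kappa> :: "nat \<Rightarrow> 'x \<Rightarrow> nat \<Rightarrow> bool"
  assumes "\<And>k. \<kappa> k \<in> X \<rightarrow>\<^sub>M bit_space"
  shows "\<exists>\<kappa>' p. \<kappa>' \<in> X \<rightarrow>\<^sub>M bit_space \<and> (\<forall>k. p k \<in> bit_space \<rightarrow>\<^sub>M bit_space) \<and>
    (\<forall>k x. p k (\<kappa>' x) = \<kappa> k x)"
proof (intro exI conjI allI)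
  define \<kappa>' where "\<kappa>' x m = \<kappa> (fst (prod_decode m)) x (snd (prod_decode m))" for x m
  define p :: "nat \<Rightarrow> (nat \<Rightarrow> bool) \<Rightarrow> nat \<Rightarrow> bool" where "p k y j = y (prod_encode (k, j))" for k y j
  have "(\<lambda>x. \<kappa> k x j) \<in> X \<rightarrow>\<^sub>M count_space UNIV" for k j
    using measurable_compose[OF assms measurable_component_singleton[of j UNIV "\<lambda>_. count_space UNIV"]]
    by simp
  then show "\<kappa>' \<in> X \<rightarrow>\<^sub>M bit_space"
    by (intro measurable_PiM_single') (auto simp: \<kappa>'_def)
  show "p k \<in> bit_space \<rightarrow>\<^sub>M bit_space" for k
    by (intro measurable_PiM_single') (auto simp: p_def intro!: measurable_component_singleton)
  show "p k (\<kappa>' x) = \<kappa> k x" for k x by (auto simp: p_def \<kappa>'_def)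
qed

text \<open>A set of the product sigma-algebra arises from rectangles by countably many operations,
  and each rectangle sees the first coordinate through a single event. The code collects these
  events.\<close>

lemma pair_set_factors_through_bits:
  assumes "S \<in> sets (X \<Otimes>\<^sub>M Z)"
  shows "\<exists>\<kappa> S'. \<kappa> \<in> X \<rightarrow>\<^sub>M bit_space \<and> S' \<in> sets (bit_space \<Otimes>\<^sub>M Z) \<and>
    (\<forall>x\<in>space X. \<forall>z\<in>space Z. (x, z) \<in> S \<longleftrightarrow> (\<kappa> x, z) \<in> S')"
  using assms[unfolded sets_pair_measure]
proof (induction rule: sigma_sets.induct)
  case (Basic S)
  then obtain a b where S: "S = a \<times> b" and [measurable]: "a \<in> sets X" "b \<in> sets Z" by auto
  have "(\<lambda>x j. x \<in> a) \<in> X \<rightarrow>\<^sub>M bit_space"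
    by (intro measurable_PiM_single') auto
  moreover have "{y \<in> space (bit_space \<Otimes>\<^sub>M Z). fst y 0 \<and> snd y \<in> b} \<in> sets (bit_space \<Otimes>\<^sub>M Z)"
    by measurable
  ultimately show ?case
    by (intro exI[of _ "\<lambda>x j. x \<in> a"] exI[of _ "{y \<in> space (bit_space \<Otimes>\<^sub>M Z). fst y 0 \<and> snd y \<in> b}"])
      (auto simp: S space_pair_measure space_PiM)
next
  case Empty
  show ?case
    by (intro exI[of _ "\<lambda>x j. True"] exI[of _ "{}"]) (auto intro!: measurable_PiM_single')
next
  case (Compl S)
  then obtain \<kappa> S' where "\<kappa> \<in> X \<rightarrow>\<^sub>M bit_space" "S' \<in> sets (bit_space \<Otimes>\<^sub>M Z)"
    "\<forall>x\<in>space X. \<forall>z\<in>space Z. (x, z) \<in> S \<longleftrightarrow> (\<kappa> x, z) \<in> S'" by blast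
  then show ?case
    by (intro exI[of _ \<kappa>] exI[of _ "space (bit_space \<Otimes>\<^sub>M Z) - S'"] conjI sets.compl_sets)
      (auto simp: space_pair_measure space_PiM)
next
  case (Union S)
  then have "\<forall>k. \<exists>\<kappa> S'. \<kappa> \<in> X \<rightarrow>\<^sub>M bit_space \<and> S' \<in> sets (bit_space \<Otimes>\<^sub>M Z) \<and>
    (\<forall>x\<in>space X. \<forall>z\<in>space Z. (x, z) \<in> S k \<longleftrightarrow> (\<kappa> x, z) \<in> S')" by blast
  then obtain \<kappa> S' where \<kappa>: "\<And>k. \<kappa> k \<in> X \<rightarrow>\<^sub>M bit_space"
    and S'[measurable]: "\<And>k. S' k \<in> sets (bit_space \<Otimes>\<^sub>M Z)"
    and eq: "\<And>k x z. x \<in> space X \<Longrightarrow> z \<in> space Z \<Longrightarrow> (x, z) \<in> S k \<longleftrightarrow> (\<kappa> k x, z) \<in> S' k"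
    by metis
  obtain \<kappa>' p where \<kappa>': "\<kappa>' \<in> X \<rightarrow>\<^sub>M bit_space" and p[measurable]: "\<And>k. p k \<in> bit_space \<rightarrow>\<^sub>M bit_space"
    and pk: "\<And>k x. p k (\<kappa>' x) = \<kappa> k x"
    using bit_space_merge[of \<kappa>, OF \<kappa>] by blast
  have "{y \<in> space (bit_space \<Otimes>\<^sub>M Z). \<exists>k. (p k (fst y), snd y) \<in> S' k} \<in> sets (bit_space \<Otimes>\<^sub>M Z)"
    by measurable
  with \<kappa>' show ?case
    by (intro exI[of _ \<kappa>'] exI[of _ "{y \<in> space (bit_space \<Otimes>\<^sub>M Z). \<exists>k. (p k (fst y), snd y) \<in> S' k}"])
      (auto simp: space_pair_measure space_PiM eq pk)
qed

lemma pair_function_factors_through_bits: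
  fixes h :: "'x \<times> 'z \<Rightarrow> ennreal"
  assumes "h \<in> borel_measurable (X \<Otimes>\<^sub>M Z)"
  shows "\<exists>\<kappa> h'. \<kappa> \<in> X \<rightarrow>\<^sub>M bit_space \<and> h' \<in> borel_measurable (bit_space \<Otimes>\<^sub>M Z) \<and>
    (\<forall>x\<in>space X. \<forall>z\<in>space Z. h (x, z) = h' (\<kappa> x, z))"
  using assms
proof (induction rule: borel_measurable_induct)
  case (cong f g)
  then show ?case by (auto simp: space_pair_measure)
next
  case (set A)
  then obtain \<kappa> S' where "\<kappa> \<in> X \<rightarrow>\<^sub>M bit_space" "S' \<in> sets (bit_space \<Otimes>\<^sub>M Z)"
    "\<forall>x\<in>space X. \<forall>z\<in>space Z. (x, z) \<in> A \<longleftrightarrow> (\<kappa> x, z) \<in> S'"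
    using pair_set_factors_through_bits[OF set(1)] by blast
  then show ?case
    by (intro exI[of _ \<kappa>] exI[of _ "indicator S'"]) (auto simp: indicator_def)
next
  case (mult u c)
  then obtain \<kappa> h' where "\<kappa> \<in> X \<rightarrow>\<^sub>M bit_space" "h' \<in> borel_measurable (bit_space \<Otimes>\<^sub>M Z)"
    "\<forall>x\<in>space X. \<forall>z\<in>space Z. u (x, z) = h' (\<kappa> x, z)" by blast
  then show ?case by (intro exI[of _ \<kappa>] exI[of _ "\<lambda>y. c * h' y"]) auto
next
  case (add u v)
  then obtain \<kappa>1 h1 \<kappa>2 h2 where \<kappa>: "\<kappa>1 \<in> X \<rightarrow>\<^sub>M bit_space" "\<kappa>2 \<in> X \<rightarrow>\<^sub>M bit_space"
    and h[measurable]: "h1 \<in> borel_measurable (bit_space \<Otimes>\<^sub>M Z)" "h2 \<in> borel_measurable (bit_space \<Otimes>\<^sub>M Z)"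
    and eq: "\<And>x z. x \<in> space X \<Longrightarrow> z \<in> space Z \<Longrightarrow> u (x, z) = h1 (\<kappa>1 x, z)"
      "\<And>x z. x \<in> space X \<Longrightarrow> z \<in> space Z \<Longrightarrow> v (x, z) = h2 (\<kappa>2 x, z)" by metis
  obtain \<kappa>' p where \<kappa>': "\<kappa>' \<in> X \<rightarrow>\<^sub>M bit_space" and p[measurable]: "\<And>k::nat. p k \<in> bit_space \<rightarrow>\<^sub>M bit_space"
    and pk: "\<And>k x. p k (\<kappa>' x) = (if k = 0 then \<kappa>1 else \<kappa>2) x"
  proof -
    have "(if k = 0 then \<kappa>1 else \<kappa>2) \<in> X \<rightarrow>\<^sub>M bit_space" for k :: nat using \<kappa> by simp
    from bit_space_merge[of "\<lambda>k. if k = 0 then \<kappa>1 else \<kappa>2", OF this] that show thesis by blast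
  qed
  have "(\<lambda>y. h1 (p 0 (fst y), snd y) + h2 (p 1 (fst y), snd y)) \<in> borel_measurable (bit_space \<Otimes>\<^sub>M Z)"
    by measurable
  with \<kappa>' show ?case
    by (intro exI[of _ \<kappa>'] exI[of _ "\<lambda>y. h1 (p 0 (fst y), snd y) + h2 (p 1 (fst y), snd y)"])
      (auto simp: eq pk add.commute)
next
  case (seq U)
  then obtain \<kappa> h' where \<kappa>: "\<And>k. \<kappa> k \<in> X \<rightarrow>\<^sub>M bit_space"
    and h'[measurable]: "\<And>k. h' k \<in> borel_measurable (bit_space \<Otimes>\<^sub>M Z)"
    and eq: "\<And>k x z. x \<in> space X \<Longrightarrow> z \<in> space Z \<Longrightarrow> U k (x, z) = h' k (\<kappa> k x, z)" by metis
  obtain \<kappa>' p where \<kappa>': "\<kappa>' \<in> X \<rightarrow>\<^sub>M bit_space" and p[measurable]: "\<And>k. p k \<in> bit_space \<rightarrow>\<^sub>M bit_space"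
    and pk: "\<And>k x. p k (\<kappa>' x) = \<kappa> k x"
    using bit_space_merge[of \<kappa>, OF \<kappa>] by blast
  have "(\<lambda>y. SUP k. h' k (p k (fst y), snd y)) \<in> borel_measurable (bit_space \<Otimes>\<^sub>M Z)"
    by measurable
  with \<kappa>' show ?case
    by (intro exI[of _ \<kappa>'] exI[of _ "\<lambda>y. SUP k. h' k (p k (fst y), snd y)"])
      (auto simp: eq pk image_image SUP_apply)
qed

text \<open>The point of the Cantor set whose ternary digits are twice the bits. Without the digit 1
  the expansion is unique, whereas binary expansions would identify some sequences.\<close>

definition cantor_enc :: "(nat \<Rightarrow> bool) \<Rightarrow> real" where
  "cantor_enc y = (\<Sum>j. 2 * of_bool (y j) * (1/3) ^ Suc j)"

text \<open>Cantor points with first digit 0 lie below 1/2, those with first digit 2 above. The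
  iterated map drops the leading digit, so its \<open>j\<close>-th iterate exposes digit
  \<open>j\<close>.\<close>

definition cantor_dec :: "real \<Rightarrow> nat \<Rightarrow> bool" where
  "cantor_dec x j = (((\<lambda>x. 3 * x - (if x > 1/2 then 2 else 0)) ^^ j) x > 1/2)"

lemma summable_cantor: "summable (\<lambda>j. 2 * of_bool (y j) * (1/3 :: real) ^ Suc j)"
proof (rule summable_comparison_test'[where N=0])
  show "summable (\<lambda>j. 2/3 * (1/3 :: real) ^ j)" by (intro summable_mult summable_geometric) auto
qed auto

lemma cantor_enc_range: "0 \<le> cantor_enc y" "cantor_enc y \<le> 1"
proof -
  show "0 \<le> cantor_enc y" unfolding cantor_enc_def by (intro suminf_nonneg summable_cantor) auto
  have "cantor_enc y \<le> (\<Sum>j. 2/3 * (1/3 :: real) ^ j)"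
    unfolding cantor_enc_def
    by (intro suminf_le summable_cantor summable_mult summable_geometric) auto
  also have "\<dots> = 1" by (subst suminf_mult) (auto simp: suminf_geometric)
  finally show "cantor_enc y \<le> 1" .
qed

lemma cantor_enc_shift: "cantor_enc y = (2 * of_bool (y 0) + cantor_enc (\<lambda>j. y (Suc j))) / 3"
proof -
  have "(\<Sum>j. 2 * of_bool (y (Suc j)) * (1/3 :: real) ^ Suc (Suc j)) = cantor_enc (\<lambda>j. y (Suc j)) / 3"
    unfolding cantor_enc_def using suminf_mult[OF summable_cantor[of "\<lambda>j. y (Suc j)"], of "1/3"]
    by (simp add: mult_ac)
  then show ?thesis
    using suminf_split_head[OF summable_cantor[of y]] by (simp add: cantor_enc_def)
qed

lemma cantor_dec_enc: "cantor_dec (cantor_enc y) = y"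
proof
  fix j
  let ?T = "\<lambda>x::real. 3 * x - (if x > 1/2 then 2 else 0)"
  have half: "cantor_enc y > 1/2 \<longleftrightarrow> y 0" for y
    using cantor_enc_shift[of y] cantor_enc_range[of "\<lambda>j. y (Suc j)"] by (cases "y 0") auto
  have T: "?T (cantor_enc y) = cantor_enc (\<lambda>j. y (Suc j))" for y
    using cantor_enc_shift[of y] half[of y] by (cases "y 0") auto
  have "(?T ^^ j) (cantor_enc y) = cantor_enc (\<lambda>i. y (i + j))"
  proof (induction j)
    case (Suc j)
    then show ?case using T[of "\<lambda>i. y (i + j)"] by simp
  qed simp
  then show "cantor_dec (cantor_enc y) j = y j" using half[of "\<lambda>i. y (i + j)"] by (simp add: cantor_dec_def)
qed

lemma measurable_cantor_enc: "cantor_enc \<in> borel_measurable bit_space"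
proof -
  have "(\<lambda>y. of_bool (y j) :: real) \<in> borel_measurable bit_space" for j
    using measurable_compose[OF measurable_component_singleton[of j UNIV "\<lambda>_. count_space UNIV"],
        of "of_bool :: bool \<Rightarrow> real" borel] by simp
  then show ?thesis
    unfolding cantor_enc_def[abs_def]
    by (intro borel_measurable_suminf borel_measurable_times borel_measurable_const) auto
qed

lemma measurable_cantor_dec: "cantor_dec \<in> borel \<rightarrow>\<^sub>M bit_space"
proof (rule measurable_PiM_single')
  fix j :: nat
  have [measurable]: "((\<lambda>x::real. 3 * x - (if x > 1/2 then 2 else 0)) ^^ j) \<in> borel_measurable borel"
    by (induction j) (auto simp: comp_def)
  show "(\<lambda>x. cantor_dec x j) \<in> borel \<rightarrow>\<^sub>M count_space UNIV" unfolding cantor_dec_def by measurable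
qed auto

text \<open>\<open>g\<close> stays in the unit interval for every real \<open>y\<close>, including
  those that code no point: the envelope of the coded prior may charge such reals, so
  \<open>g\<close> has to be an admissible loss there too. Truncation at 1 achieves this and leaves
  the values at codes unchanged.\<close>

lemma pair_function_factors_through_real:
  fixes h :: "'x \<Rightarrow> 'z \<Rightarrow> real"
  assumes h: "(\<lambda>(x, z). h x z) \<in> borel_measurable (X \<Otimes>\<^sub>M Z)"
    and range: "\<And>x z. 0 \<le> h x z \<and> h x z \<le> 1"
  obtains \<iota> :: "'x \<Rightarrow> real" and g where "\<iota> \<in> borel_measurable X" "\<And>x. 0 \<le> \<iota> x \<and> \<iota> x \<le> 1"
    "(\<lambda>(y, z). g y z) \<in> borel_measurable (borel \<Otimes>\<^sub>M Z)" "\<And>y z. 0 \<le> g y z \<and> g y z \<le> (1::real)"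
    "\<And>x z. x \<in> space X \<Longrightarrow> z \<in> space Z \<Longrightarrow> g (\<iota> x) z = h x z"
proof -
  have "(\<lambda>p. ennreal (h (fst p) (snd p))) \<in> borel_measurable (X \<Otimes>\<^sub>M Z)"
    using h by (simp add: case_prod_beta')
  from pair_function_factors_through_bits[OF this]
  obtain \<kappa> h' where \<kappa>[measurable]: "\<kappa> \<in> X \<rightarrow>\<^sub>M bit_space"
    and h'[measurable]: "h' \<in> borel_measurable (bit_space \<Otimes>\<^sub>M Z)"
    and eq: "\<And>x z. x \<in> space X \<Longrightarrow> z \<in> space Z \<Longrightarrow> ennreal (h x z) = h' (\<kappa> x, z)"
    unfolding fst_conv snd_conv by blast
  note [measurable] = measurable_cantor_enc measurable_cantor_dec
  define g where "g y z = enn2real (min 1 (h' (cantor_dec y, z)))" for y z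
  have 1: "(\<lambda>x. cantor_enc (\<kappa> x)) \<in> borel_measurable X" by measurable
  have 2: "(\<lambda>(y, z). g y z) \<in> borel_measurable (borel \<Otimes>\<^sub>M Z)"
    unfolding g_def by measurable
  have 3: "0 \<le> g y z \<and> g y z \<le> 1" for y z
    using enn2real_mono[of "min 1 (h' (cantor_dec y, z))" 1] by (auto simp: g_def)
  have 4: "g (cantor_enc (\<kappa> x)) z = h x z" if "x \<in> space X" "z \<in> space Z" for x z
    using eq[OF that, symmetric] range[of x z] by (simp add: g_def cantor_dec_enc min_def)
  show thesis using that[of "\<lambda>x. cantor_enc (\<kappa> x)" g] 1 2 3 4 cantor_enc_range by blast
qed

section \<open>Change of measure\<close>

text \<open>With \<open>d\<close> the log-density and \<open>w = u - d - ln c\<close>, changing the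
  measure shows that \<open>exp w\<close> has \<open>\<rho>\<close>-mean at most 1, and
  \<open>w + 1 \<le> exp w\<close> makes the mean of \<open>w\<close> nonpositive. The majorant
  \<open>v\<close> stands apart from \<open>exp u\<close> because in the inner bound the moment is
  known for \<open>v\<close> under \<open>\<pi>\<close>, while \<open>exp u\<close> is dominated by
  \<open>v\<close> only \<open>\<rho>\<close>-almost everywhere.\<close>

lemma Donsker_Varadhan_KL_divergence:
  assumes \<rho>: "prob_space \<rho>" and \<pi>: "prob_space \<pi>" and sets_eq: "sets \<rho> = sets \<pi>"
    and ac: "absolutely_continuous \<pi> \<rho>" and int: "integrable \<rho> (entropy_density (exp 1) \<pi> \<rho>)"
    and u: "integrable \<rho> u" and v: "v \<in> borel_measurable \<pi>"
    and c: "0 < c" and vc: "(\<integral>\<^sup>+ x. v x \<partial>\<pi>) \<le> ennreal c"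
    and uv: "AE x in \<rho>. ennreal (exp (u x)) \<le> v x"
  shows "(\<integral>x. u x \<partial>\<rho>) \<le> KL_divergence (exp 1) \<pi> \<rho> + ln c"
proof -
  interpret \<rho>: prob_space \<rho> by fact
  interpret \<pi>: prob_space \<pi> by fact
  define R where "R = RN_deriv \<pi> \<rho>"
  have R[measurable]: "R \<in> borel_measurable \<pi>" by (simp add: R_def)
  have dens: "density \<pi> R = \<rho>" using ac sets_eq by (simp add: R_def \<pi>.density_RN_deriv)
  have fin: "AE x in \<pi>. R x \<noteq> \<infinity>"
    using ac sets_eq \<rho>.sigma_finite_measure_axioms unfolding R_def by (intro \<pi>.RN_deriv_finite) auto
  have finR: "AE x in \<rho>. R x \<noteq> \<infinity>"
    by (subst dens[symmetric]) (use fin in \<open>auto simp: AE_density\<close>)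
  have posR: "AE x in \<rho>. R x \<noteq> 0"
    by (subst dens[symmetric]) (auto simp: AE_density)
  define d where "d = entropy_density (exp 1) \<pi> \<rho>"
  have d_eq: "d x = ln (enn2real (R x))" for x
    by (simp add: d_def entropy_density_def R_def log_def)
  define w where "w x = u x - d x - ln c" for x
  have w: "integrable \<rho> w" unfolding w_def using u int by (auto simp: d_def)
  note [measurable] = v
  have "(\<integral>\<^sup>+ x. ennreal (exp (w x)) \<partial>\<rho>) \<le> (\<integral>\<^sup>+ x. v x / R x / ennreal c \<partial>\<rho>)"
  proof (rule nn_integral_mono_AE)
    show "AE x in \<rho>. ennreal (exp (w x)) \<le> v x / R x / ennreal c"
      using finR posR uv
    proof eventually_elim
      case (elim x)
      then obtain r where r: "R x = ennreal r" "r > 0" by (cases "R x") (auto simp: less_le)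
      have "exp (w x) = exp (u x) / r / c" using r c by (simp add: w_def d_eq exp_diff)
      then have "ennreal (exp (w x)) = ennreal (exp (u x)) / R x / ennreal c"
        using r c by (simp add: divide_ennreal)
      also have "\<dots> \<le> v x / R x / ennreal c"
        using elim by (intro divide_right_mono_ennreal)
      finally show ?case .
    qed
  qed
  also have "\<dots> = (\<integral>\<^sup>+ x. R x * (v x / R x / ennreal c) \<partial>\<pi>)"
    by (subst dens[symmetric], subst nn_integral_density) auto
  also have "\<dots> \<le> (\<integral>\<^sup>+ x. v x / ennreal c \<partial>\<pi>)"
  proof (intro nn_integral_mono)
    fix x
    \<comment> \<open>Only an inequality: where the density is 0 or infinite the left side vanishes,
      so part of \<open>v\<close> may be lost there.\<close>
    have "R x * (v x / R x) \<le> v x"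
    proof (cases "R x = 0 \<or> R x = \<infinity>")
      case True then show ?thesis by (auto simp: ennreal_divide_top)
    next
      case False
      then have "R x * (v x / R x) = v x"
        by (simp add: ennreal_times_divide mult.commute[of "R x"] mult_divide_eq_ennreal)
      then show ?thesis by simp
    qed
    then show "R x * (v x / R x / ennreal c) \<le> v x / ennreal c"
      using divide_right_mono_ennreal[of "R x * (v x / R x)" "v x" "ennreal c"]
      by (simp add: ennreal_times_divide)
  qed
  also have "\<dots> = (\<integral>\<^sup>+ x. v x \<partial>\<pi>) / ennreal c" by (rule nn_integral_divide) simp
  also have "\<dots> \<le> ennreal c / ennreal c" using vc by (intro divide_right_mono_ennreal)
  also have "\<dots> = 1" using c by (simp add: ennreal_divide_self)
  finally have le1: "(\<integral>\<^sup>+ x. ennreal (exp (w x)) \<partial>\<rho>) \<le> 1" .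
  have wm[measurable]: "w \<in> borel_measurable \<rho>" using w by simp
  have iexp: "integrable \<rho> (\<lambda>x. exp (w x))"
    using le1 by (intro integrableI_bounded) (auto intro: le_less_trans)
  have "(\<integral>x. w x + 1 \<partial>\<rho>) \<le> (\<integral>x. exp (w x) \<partial>\<rho>)"
    using w iexp by (intro integral_mono) (auto simp: add.commute)
  also have "\<dots> = enn2real (\<integral>\<^sup>+ x. ennreal (exp (w x)) \<partial>\<rho>)" by (rule integral_eq_nn_integral) auto
  also have "\<dots> \<le> 1" using enn2real_mono[OF le1] by simp
  finally have "(\<integral>x. w x \<partial>\<rho>) \<le> 0" using w by (simp add: \<rho>.prob_space)
  moreover have "(\<integral>x. w x \<partial>\<rho>) = (\<integral>x. u x \<partial>\<rho>) - (\<integral>x. d x \<partial>\<rho>) - ln c"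
    unfolding w_def using u int by (simp add: d_def \<rho>.prob_space)
  ultimately show ?thesis by (simp add: KL_divergence_def d_def)
qed

lemma Donsker_Varadhan:
  assumes "prob_space \<rho>" "prob_space \<pi>" "sets \<rho> = sets \<pi>"
    and "KL \<rho> \<pi> \<noteq> \<infinity>" "integrable \<rho> u" "v \<in> borel_measurable \<pi>"
    and "0 < c" "(\<integral>\<^sup>+ x. v x \<partial>\<pi>) \<le> ennreal c" "AE x in \<rho>. ennreal (exp (u x)) \<le> v x"
  shows "(\<integral>x. u x \<partial>\<rho>) \<le> enn2real (KL \<rho> \<pi>) + ln c"
proof -
  have *: "absolutely_continuous \<pi> \<rho>" "integrable \<rho> (entropy_density (exp 1) \<pi> \<rho>)"
    using assms(4) by (auto simp: KL_def split: if_splits)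
  \<comment> \<open>\<open>ennreal\<close> sends a negative number to 0, which can only raise it, so
    both signs are covered.\<close>
  then have "enn2real (KL \<rho> \<pi>) \<ge> KL_divergence (exp 1) \<pi> \<rho>"
    by (cases "KL_divergence (exp 1) \<pi> \<rho> \<ge> 0") (simp_all add: KL_def ennreal_neg)
  with Donsker_Varadhan_KL_divergence[OF assms(1-3) * assms(5-9)] show ?thesis by simp
qed

section \<open>Density of the continuous functions in L^1 of a real distribution\<close>

definition L1_continuous_limit :: "real measure \<Rightarrow> (real \<Rightarrow> real) \<Rightarrow> bool" where
  "L1_continuous_limit M h = (\<forall>\<epsilon>>0. \<exists>\<phi>. continuous_on UNIV \<phi> \<and> integrable M \<phi> \<and> (\<integral>x. \<bar>h x - \<phi> x\<bar> \<partial>M) < \<epsilon>)"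

lemma L1_continuous_limit_closed:
  assumes h: "integrable M h" and g: "\<And>k. integrable M (g k)"
    and lim: "(\<lambda>k. \<integral>x. \<bar>h x - g k x\<bar> \<partial>M) \<longlonglongrightarrow> 0" and gk: "\<And>k. L1_continuous_limit M (g k)"
  shows "L1_continuous_limit M h"
  unfolding L1_continuous_limit_def
proof (intro allI impI)
  fix \<epsilon> :: real assume "\<epsilon> > 0"
  from order_tendstoD(2)[OF lim, of "\<epsilon>/2"] this obtain k where k: "(\<integral>x. \<bar>h x - g k x\<bar> \<partial>M) < \<epsilon>/2"
    by (auto simp: eventually_sequentially)
  obtain \<phi> where \<phi>: "continuous_on UNIV \<phi>" "integrable M \<phi>" "(\<integral>x. \<bar>g k x - \<phi> x\<bar> \<partial>M) < \<epsilon>/2"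
    using gk[of k] \<open>\<epsilon> > 0\<close> unfolding L1_continuous_limit_def by (meson half_gt_zero)
  have "(\<integral>x. \<bar>h x - \<phi> x\<bar> \<partial>M) \<le> (\<integral>x. \<bar>h x - g k x\<bar> + \<bar>g k x - \<phi> x\<bar> \<partial>M)"
    using h g \<phi> by (intro integral_mono integrable_abs Bochner_Integration.integrable_diff
      Bochner_Integration.integrable_add) auto
  also have "\<dots> = (\<integral>x. \<bar>h x - g k x\<bar> \<partial>M) + (\<integral>x. \<bar>g k x - \<phi> x\<bar> \<partial>M)"
    using h g \<phi> by (intro Bochner_Integration.integral_add integrable_abs Bochner_Integration.integrable_diff) auto
  also have "\<dots> < \<epsilon>" using k \<phi> by simp
  finally show "\<exists>\<phi>. continuous_on UNIV \<phi> \<and> integrable M \<phi> \<and> (\<integral>x. \<bar>h x - \<phi> x\<bar> \<partial>M) < \<epsilon>"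
    using \<phi> by blast
qed

lemma L1_continuous_limit_add:
  assumes "integrable M f" "integrable M g" "L1_continuous_limit M f" "L1_continuous_limit M g"
  shows "L1_continuous_limit M (\<lambda>x. f x + g x)"
  unfolding L1_continuous_limit_def
proof (intro allI impI)
  fix \<epsilon> :: real assume "\<epsilon> > 0"
  then have "\<epsilon>/2 > 0" by simp
  then obtain \<phi> \<psi> where \<phi>: "continuous_on UNIV \<phi>" "integrable M \<phi>" "(\<integral>x. \<bar>f x - \<phi> x\<bar> \<partial>M) < \<epsilon>/2"
    and \<psi>: "continuous_on UNIV \<psi>" "integrable M \<psi>" "(\<integral>x. \<bar>g x - \<psi> x\<bar> \<partial>M) < \<epsilon>/2"
    using assms(3,4) unfolding L1_continuous_limit_def by blast
  have "(\<integral>x. \<bar>f x + g x - (\<phi> x + \<psi> x)\<bar> \<partial>M) \<le> (\<integral>x. \<bar>f x - \<phi> x\<bar> + \<bar>g x - \<psi> x\<bar> \<partial>M)"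
    using assms \<phi> \<psi> by (intro integral_mono integrable_abs Bochner_Integration.integrable_diff
      Bochner_Integration.integrable_add) auto
  also have "\<dots> = (\<integral>x. \<bar>f x - \<phi> x\<bar> \<partial>M) + (\<integral>x. \<bar>g x - \<psi> x\<bar> \<partial>M)"
    using assms \<phi> \<psi> by (intro Bochner_Integration.integral_add integrable_abs Bochner_Integration.integrable_diff) auto
  finally show "\<exists>\<phi>. continuous_on UNIV \<phi> \<and> integrable M \<phi> \<and> (\<integral>x. \<bar>f x + g x - \<phi> x\<bar> \<partial>M) < \<epsilon>"
    using \<phi> \<psi> by (intro exI[of _ "\<lambda>x. \<phi> x + \<psi> x"]) (auto intro: continuous_intros)
qed

lemma L1_continuous_limit_scale:
  assumes "L1_continuous_limit M f"
  shows "L1_continuous_limit M (\<lambda>x. f x * c)"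
  unfolding L1_continuous_limit_def
proof (intro allI impI)
  fix \<epsilon> :: real assume "\<epsilon> > 0"
  then have "\<epsilon> / (\<bar>c\<bar> + 1) > 0" by simp
  then obtain \<phi> where \<phi>: "continuous_on UNIV \<phi>" "integrable M \<phi>" "(\<integral>x. \<bar>f x - \<phi> x\<bar> \<partial>M) < \<epsilon> / (\<bar>c\<bar> + 1)"
    using assms unfolding L1_continuous_limit_def by blast
  have "(\<integral>x. \<bar>f x * c - \<phi> x * c\<bar> \<partial>M) = (\<integral>x. \<bar>f x - \<phi> x\<bar> * \<bar>c\<bar> \<partial>M)"
    by (intro Bochner_Integration.integral_cong) (auto simp: abs_mult[symmetric] left_diff_distrib)
  also have "\<dots> = (\<integral>x. \<bar>f x - \<phi> x\<bar> \<partial>M) * \<bar>c\<bar>" by simp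
  also have "\<dots> \<le> (\<integral>x. \<bar>f x - \<phi> x\<bar> \<partial>M) * (\<bar>c\<bar> + 1)" by (intro mult_left_mono) auto
  also have "\<dots> < \<epsilon>" using \<phi>(3) by (simp add: pos_less_divide_eq)
  finally show "\<exists>\<phi>. continuous_on UNIV \<phi> \<and> integrable M \<phi> \<and> (\<integral>x. \<bar>f x * c - \<phi> x\<bar> \<partial>M) < \<epsilon>"
    using \<phi> by (intro exI[of _ "\<lambda>x. \<phi> x * c"]) (auto intro!: continuous_intros)
qed

lemma L1_continuous_limit_continuous:
  "continuous_on UNIV \<phi> \<Longrightarrow> integrable M \<phi> \<Longrightarrow> L1_continuous_limit M \<phi>"
  unfolding L1_continuous_limit_def by (auto intro!: exI[of _ \<phi>])

context real_distribution
begin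

lemma L1_continuous_limit_dominated:
  assumes [measurable]: "h \<in> borel_measurable M" "\<And>k. g k \<in> borel_measurable M"
    and gk: "\<And>k. L1_continuous_limit M (g k)"
    and b: "integrable M b" "\<And>k x. \<bar>g k x\<bar> \<le> b x" and lim: "\<And>x. (\<lambda>k. g k x) \<longlonglongrightarrow> h x"
  shows "L1_continuous_limit M h"
proof -
  have hb: "\<bar>h x\<bar> \<le> b x" for x
    by (rule LIMSEQ_le_const2[OF tendsto_rabs[OF lim]]) (use b(2) in auto)
  have h: "integrable M h" by (rule Bochner_Integration.integrable_bound[OF b(1)]) (auto intro!: AE_I2 order_trans[OF hb])
  have g: "integrable M (g k)" for k
    by (rule Bochner_Integration.integrable_bound[OF b(1)]) (auto intro!: AE_I2 order_trans[OF b(2)])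
  have "(\<lambda>k. \<integral>x. \<bar>h x - g k x\<bar> \<partial>M) \<longlonglongrightarrow> (\<integral>x. 0 \<partial>M)"
  proof (rule integral_dominated_convergence[where w="\<lambda>x. 2 * b x"])
    show "AE x in M. (\<lambda>k. \<bar>h x - g k x\<bar>) \<longlonglongrightarrow> 0"
    proof (rule AE_I2)
      fix x show "(\<lambda>k. \<bar>h x - g k x\<bar>) \<longlonglongrightarrow> 0"
        using tendsto_rabs[OF tendsto_diff[OF tendsto_const lim[of x], of "h x"]] by simp
    qed
    show "AE x in M. norm \<bar>h x - g k x\<bar> \<le> 2 * b x" for k
      using hb b(2)[of k] by (intro AE_I2) (smt (verit) real_norm_def)
  qed (use b in auto)
  then show ?thesis by (intro L1_continuous_limit_closed[OF h g _ gk]) simp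
qed

text \<open>Induction from the intersection-stable family of half-lines: the indicator of the
  half-line up to \<open>a\<close> is a pointwise limit of continuous ramps, and complements and
  disjoint unions follow from closure under sums, multiples and dominated limits.\<close>

lemma L1_continuous_limit_indicator:
  assumes "A \<in> sets borel"
  shows "L1_continuous_limit M (indicator A)"
proof -
  have "Int_stable (range (atMost :: real \<Rightarrow> _))" "range (atMost :: real \<Rightarrow> _) \<subseteq> Pow UNIV"
    "A \<in> sigma_sets UNIV (range atMost)"
    using assms by (auto simp: Int_stable_def) (subst (asm) borel_eq_atMost, simp)
  then show ?thesis
  proof (induction rule: sigma_sets_induct_disjoint)
    case (basic A)
    then obtain a where A: "A = {..a}" by auto
    show ?case
    proof (rule L1_continuous_limit_dominated[where b="\<lambda>_. 1" and g="\<lambda>k. cts_step a (a + inverse (real (Suc k)))"])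
      show "L1_continuous_limit M (cts_step a (a + inverse (real (Suc k))))" for k
        by (intro L1_continuous_limit_continuous integrable_cts_step uniformly_continuous_imp_continuous
          cts_step_uniformly_continuous) auto
      show "(\<lambda>k. cts_step a (a + inverse (real (Suc k))) x) \<longlonglongrightarrow> indicator A x" for x
      proof (cases "x \<le> a")
        case True then show ?thesis by (simp add: cts_step_def A)
      next
        case False
        have "(\<lambda>k. a + inverse (real (Suc k))) \<longlonglongrightarrow> a + 0"
          by (intro tendsto_intros LIMSEQ_inverse_real_of_nat)
        then have "\<forall>\<^sub>F k in sequentially. a + inverse (real (Suc k)) < x"
          using False by (intro order_tendstoD) auto
        then have "\<forall>\<^sub>F k in sequentially. cts_step a (a + inverse (real (Suc k))) x = 0"
          by eventually_elim (use False in \<open>auto simp: cts_step_def\<close>)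
        then show ?thesis using False by (auto simp: A intro: tendsto_eventually)
      qed
      show "cts_step a (a + inverse (real (Suc k))) \<in> borel_measurable M" for k
        using integrable_cts_step[of a "a + inverse (real (Suc k))"] by auto
      show "\<bar>cts_step a (a + inverse (real (Suc k))) x\<bar> \<le> 1" for k x
        by (auto simp: cts_step_def divide_simps)
    qed (auto simp: A)
  next
    case empty
    then show ?case using L1_continuous_limit_continuous[of "\<lambda>_. 0" M] by (simp add: indicator_def[abs_def])
  next
    case (compl A)
    then have A[measurable]: "A \<in> sets borel" by (subst borel_eq_atMost) simp
    have "L1_continuous_limit M (\<lambda>x. 1 + indicator A x * (-1))"
    proof (rule L1_continuous_limit_add)
      show "L1_continuous_limit M (\<lambda>x. 1)" by (intro L1_continuous_limit_continuous) auto
      show "L1_continuous_limit M (\<lambda>x. indicator A x * (-1))"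
        using compl by (intro L1_continuous_limit_scale)
    qed (auto simp: emeasure_eq_measure)
    moreover have "(\<lambda>x. 1 + indicator A x * (-1)) = (indicator (UNIV - A) :: real \<Rightarrow> real)"
      by (auto simp: indicator_def)
    ultimately show ?case by simp
  next
    case (union A)
    then have A[measurable]: "A k \<in> sets borel" for k by (subst borel_eq_atMost) auto
    show ?case
    proof (rule L1_continuous_limit_dominated[where b="\<lambda>_. 1" and g="\<lambda>k x. \<Sum>i<k. indicator (A i) x"])
      show "L1_continuous_limit M (\<lambda>x. \<Sum>i<k. indicator (A i) x)" for k
      proof (induction k)
        case 0 show ?case using L1_continuous_limit_continuous[of "\<lambda>_. 0" M] by simp
      next
        case (Suc k)
        show ?case using union by (auto intro!: L1_continuous_limit_add Suc simp: emeasure_eq_measure)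
      qed
      have eq: "(\<Sum>i<k. indicator (A i) x) = (indicator (\<Union>i<k. A i) x :: real)" for k x
        using union(1) by (subst indicator_UN_disjoint) (auto intro: disjoint_family_on_mono)
      show "\<bar>\<Sum>i<k. indicator (A i) x\<bar> \<le> (1::real)" for k x
        unfolding eq by (auto simp: indicator_def)
      show "(\<lambda>k. \<Sum>i<k. indicator (A i) x) \<longlonglongrightarrow> (indicator (\<Union>i. A i) x :: real)" for x
        unfolding eq by (rule LIMSEQ_indicator_UN)
    qed auto
  qed
qed

lemma L1_continuous_limit_integrable:
  assumes "integrable M h"
  shows "L1_continuous_limit M h"
  using assms
proof (induction rule: integrable_induct)
  case (base A c)
  then have "L1_continuous_limit M (indicator A)" by (intro L1_continuous_limit_indicator) simp
  from L1_continuous_limit_scale[OF this, of c] show ?case by simp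
next
  case (add f g)
  then show ?case by (intro L1_continuous_limit_add)
next
  case (lim f s)
  show ?case
  proof (rule L1_continuous_limit_dominated[where b="\<lambda>x. 2 * \<bar>f x\<bar>" and g=s])
    show "integrable M (\<lambda>x. 2 * \<bar>f x\<bar>)"
      using lim.hyps(4) by (intro integrable_mult_right integrable_abs)
    show "f \<in> borel_measurable M" "s k \<in> borel_measurable M" for k using lim.hyps(1)[of k] lim.hyps(4) by simp_all
    show "\<bar>s k x\<bar> \<le> 2 * \<bar>f x\<bar>" for k x using lim.hyps(3)[of x k] by simp
    show "(\<lambda>k. s k x) \<longlonglongrightarrow> f x" for x using lim.hyps(2)[of x] by simp
    show "L1_continuous_limit M (s k)" for k by (rule lim.IH)
  qed
qed

end

section \<open>Domination between kernels: from continuous to bounded Borel test functions\<close>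

lemma real_distribution_prob_algebra:
  "N \<in> space (prob_algebra borel) \<Longrightarrow> real_distribution N"
  by (auto simp: space_prob_algebra real_distribution_def real_distribution_axioms_def)

text \<open>\<open>\<phi>\<close> is a limit of continuous functions with the same bound
  \<open>b\<close>, almost everywhere under both \<open>a A\<close> and \<open>\<nu> A\<close> for
  almost every \<open>A\<close>: L^1 density under a common mixture gives convergence in mean, and a
  subsequence converges almost surely. Dominated convergence then passes to the limit on both
  sides.\<close>

lemma (in prob_space) AE_kernel_exp_le_bounded_borel:
  fixes a \<nu> :: "'a \<Rightarrow> real measure" and k :: "'a \<Rightarrow> real"
  assumes a[measurable]: "a \<in> M \<rightarrow>\<^sub>M prob_algebra borel" and \<nu>[measurable]: "\<nu> \<in> M \<rightarrow>\<^sub>M prob_algebra borel"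
    and le: "\<And>\<phi> b. continuous_on UNIV \<phi> \<Longrightarrow> (\<And>x. \<bar>\<phi> x\<bar> \<le> b) \<Longrightarrow>
        AE A in M. k A * exp (\<integral>x. \<phi> x \<partial>a A) \<le> (\<integral>x. exp (\<phi> x) \<partial>\<nu> A)"
    and \<phi>[measurable]: "\<phi> \<in> borel_measurable borel" and \<phi>b: "\<And>x. \<bar>\<phi> x\<bar> \<le> b"
  shows "AE A in M. k A * exp (\<integral>x. \<phi> x \<partial>a A) \<le> (\<integral>x. exp (\<phi> x) \<partial>\<nu> A)"
proof -
  \<comment> \<open>The fair mixture of \<open>a\<close> and \<open>\<nu>\<close> controls null sets of both.\<close>
  define B where "B = measure_pmf (bernoulli_pmf (1/2))"
  define \<kappa> where "\<kappa> p = (if snd p then a (fst p) else \<nu> (fst p))" for p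
  have AE_B: "(AE c in B. P c) \<longleftrightarrow> P True \<and> P False" for P
    unfolding B_def AE_measure_pmf_iff by (auto simp: set_pmf_bernoulli UNIV_bool)
  interpret B: prob_space B unfolding B_def by (rule prob_space_measure_pmf)
  interpret MB: pair_prob_space M B by unfold_locales
  have sB[measurable_cong]: "sets B = sets (count_space UNIV)" by (simp add: B_def)
  have \<kappa>[measurable]: "\<kappa> \<in> M \<Otimes>\<^sub>M B \<rightarrow>\<^sub>M prob_algebra borel" unfolding \<kappa>_def by measurable
  note \<kappa>s = measurable_prob_algebraD[OF \<kappa>]
  define N where "N = (M \<Otimes>\<^sub>M B) \<bind> \<kappa>"
  have Nspace: "N \<in> space (prob_algebra borel)"
    unfolding N_def space_prob_algebra
    using prob_space_bind'[OF _ \<kappa>, of "M \<Otimes>\<^sub>M B"] sets_bind'[OF _ \<kappa>, of "M \<Otimes>\<^sub>M B"] MB.prob_space_axioms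
    by (auto simp: space_prob_algebra)
  interpret N: real_distribution N by (rule real_distribution_prob_algebra[OF Nspace])
  have b0: "0 \<le> b" using \<phi>b[of 0] by linarith
  have int: "integrable N \<phi>"
    by (rule N.integrable_const_bound[where B=b]) (use \<phi>b in \<open>auto cong: measurable_cong_sets\<close>)
  have "\<exists>g. continuous_on UNIV g \<and> (\<forall>x. \<bar>g x\<bar> \<le> b) \<and> (\<integral>x. \<bar>\<phi> x - g x\<bar> \<partial>N) < inverse (real (Suc i))" for i
  proof -
    obtain g where g: "continuous_on UNIV g" "integrable N g" "(\<integral>x. \<bar>\<phi> x - g x\<bar> \<partial>N) < inverse (real (Suc i))"
      using N.L1_continuous_limit_integrable[OF int] unfolding L1_continuous_limit_def
      by (meson inverse_positive_iff_positive of_nat_0_less_iff zero_less_Suc)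
    \<comment> \<open>Clipping to the interval from \<open>-b\<close> to \<open>b\<close> cannot
      increase the distance to \<open>\<phi>\<close>, whose values lie there.\<close>
    define h where "h x = max (-b) (min b (g x))" for x
    have hc: "continuous_on UNIV h" unfolding h_def by (intro continuous_intros g)
    have hb: "\<bar>h x\<bar> \<le> b" for x using b0 by (auto simp: h_def)
    have hN: "integrable N h"
      by (rule N.integrable_const_bound[where B=b])
        (use hb borel_measurable_continuous_onI[OF hc] in \<open>auto cong: measurable_cong_sets\<close>)
    have "(\<integral>x. \<bar>\<phi> x - h x\<bar> \<partial>N) \<le> (\<integral>x. \<bar>\<phi> x - g x\<bar> \<partial>N)"
    proof (intro integral_mono integrable_abs Bochner_Integration.integrable_diff int g hN)
      fix x show "\<bar>\<phi> x - h x\<bar> \<le> \<bar>\<phi> x - g x\<bar>" using \<phi>b[of x] unfolding h_def max_def min_def by auto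
    qed
    with g hc hb show ?thesis by (intro exI[of _ h]) auto
  qed
  then obtain g where gc: "\<And>i. continuous_on UNIV (g i)" and gb: "\<And>i x. \<bar>g i x\<bar> \<le> b"
    and gN: "\<And>i. (\<integral>x. \<bar>\<phi> x - g i x\<bar> \<partial>N) < inverse (real (Suc i))" by metis
  have gm[measurable]: "g i \<in> borel_measurable borel" for i using borel_measurable_continuous_onI[OF gc] .
  have gint: "integrable N (g i)" for i
    by (rule N.integrable_const_bound[where B=b]) (use gb in \<open>auto cong: measurable_cong_sets\<close>)
  have "(\<lambda>i. \<integral>x. norm (\<phi> x - g i x) \<partial>N) \<longlonglongrightarrow> 0"
  proof (rule tendsto_sandwich[OF _ _ tendsto_const LIMSEQ_inverse_real_of_nat])
    show "\<forall>\<^sub>F i in sequentially. (\<integral>x. norm (\<phi> x - g i x) \<partial>N) \<le> inverse (real (Suc i))"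
      using gN by (auto intro!: always_eventually less_imp_le)
  qed auto
  from tendsto_L1_AE_subseq[OF _ this] int gint obtain r where r: "strict_mono (r :: nat \<Rightarrow> nat)"
    and ae: "AE x in N. (\<lambda>i. \<phi> x - g (r i) x) \<longlonglongrightarrow> 0" by auto
  have "AE x in N. (\<lambda>i. g (r i) x) \<longlonglongrightarrow> \<phi> x"
    using ae
  proof eventually_elim
    case (elim x)
    from tendsto_diff[OF tendsto_const[of "\<phi> x"] elim] show ?case by simp
  qed
  then have "AE p in M \<Otimes>\<^sub>M B. AE x in \<kappa> p. (\<lambda>i. g (r i) x) \<longlonglongrightarrow> \<phi> x"
    unfolding N_def by (subst (asm) AE_bind[OF \<kappa>s]) auto
  then have "AE A in M. AE c in B. AE x in \<kappa> (A, c). (\<lambda>i. g (r i) x) \<longlonglongrightarrow> \<phi> x"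
    by (rule MB.AE_pair)
  then have ae2: "AE A in M. (AE x in a A. (\<lambda>i. g (r i) x) \<longlonglongrightarrow> \<phi> x) \<and> (AE x in \<nu> A. (\<lambda>i. g (r i) x) \<longlonglongrightarrow> \<phi> x)"
    unfolding AE_B \<kappa>_def fst_conv snd_conv if_True if_False by simp
  have "AE A in M. \<forall>i. k A * exp (\<integral>x. g i x \<partial>a A) \<le> (\<integral>x. exp (g i x) \<partial>\<nu> A)"
    unfolding AE_all_countable using le[OF gc gb] by blast
  with ae2 AE_space show ?thesis
  proof eventually_elim
    case (elim A)
    interpret a: real_distribution "a A"
      using measurable_space[OF a] elim by (intro real_distribution_prob_algebra) auto
    interpret \<nu>: real_distribution "\<nu> A"
      using measurable_space[OF \<nu>] elim by (intro real_distribution_prob_algebra) auto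
    have 1: "(\<lambda>i. \<integral>x. g (r i) x \<partial>a A) \<longlonglongrightarrow> (\<integral>x. \<phi> x \<partial>a A)"
      by (rule integral_dominated_convergence[where w="\<lambda>_. b"])
        (use elim gb in \<open>auto cong: measurable_cong_sets\<close>)
    have 2: "(\<lambda>i. \<integral>x. exp (g (r i) x) \<partial>\<nu> A) \<longlonglongrightarrow> (\<integral>x. exp (\<phi> x) \<partial>\<nu> A)"
    proof (rule integral_dominated_convergence[where w="\<lambda>_. exp b"])
      show "AE x in \<nu> A. (\<lambda>i. exp (g (r i) x)) \<longlonglongrightarrow> exp (\<phi> x)"
        using elim by (auto elim!: eventually_mono intro: tendsto_exp)
      show "AE x in \<nu> A. norm (exp (g (r i) x)) \<le> exp b" for i
        using gb by (auto intro: order_trans[OF abs_ge_self])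
    qed (auto cong: measurable_cong_sets)
    have "k A * exp (\<integral>x. g (r i) x \<partial>a A) \<le> (\<integral>x. exp (g (r i) x) \<partial>\<nu> A)" for i using elim by blast
    then show ?case
      by (intro LIMSEQ_le[OF tendsto_mult[OF tendsto_const tendsto_exp[OF 1]] 2]) auto
  qed
qed

text \<open>The premise is the exponentiated change of measure; \<open>a\<close> will be the coded
  posterior and \<open>k\<close> the factor \<open>exp (- KL)\<close>. For continuous
  \<open>\<phi>\<close> its left side is a measurable minorant of a continuous integral, which is
  what the kernel envelope preserves. One \<open>\<nu>\<close> serves all \<open>a\<close>,
  \<open>k\<close> and \<open>\<phi>\<close>, so it can be fixed before data and posteriors are
  known.\<close>

lemma (in prob_space) measurable_prior_envelope:
  fixes \<mu> :: "'a \<Rightarrow> real measure"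
  assumes \<mu>: "\<And>A. A \<in> space M \<Longrightarrow> real_distribution (\<mu> A)"
    and supp: "\<And>A. A \<in> space M \<Longrightarrow> measure (\<mu> A) {0..1} = 1"
  obtains \<nu> where "\<nu> \<in> M \<rightarrow>\<^sub>M prob_algebra borel"
    and "\<And>a (k :: 'a \<Rightarrow> real) \<phi> b. \<lbrakk>a \<in> M \<rightarrow>\<^sub>M prob_algebra borel; k \<in> borel_measurable M;
        \<forall>A\<in>space M. \<forall>\<phi> b. \<phi> \<in> borel_measurable borel \<longrightarrow> (\<forall>x. \<bar>\<phi> x\<bar> \<le> b) \<longrightarrow>
          k A * exp (\<integral>x. \<phi> x \<partial>a A) \<le> (\<integral>x. exp (\<phi> x) \<partial>\<mu> A);
        \<phi> \<in> borel_measurable borel; \<And>x. \<bar>\<phi> x\<bar> \<le> b\<rbrakk> \<Longrightarrow>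
      AE A in M. k A * exp (\<integral>x. \<phi> x \<partial>a A) \<le> (\<integral>x. exp (\<phi> x) \<partial>\<nu> A)"
proof -
  obtain \<nu> where \<nu>: "\<nu> \<in> M \<rightarrow>\<^sub>M prob_algebra borel"
    and env: "\<And>(\<psi> :: real \<Rightarrow> real) v b. \<lbrakk>continuous_on UNIV \<psi>; \<And>x. \<bar>\<psi> x\<bar> \<le> b; v \<in> borel_measurable M;
        \<And>A. A \<in> space M \<Longrightarrow> v A \<le> (\<integral>x. \<psi> x \<partial>\<mu> A)\<rbrakk> \<Longrightarrow> AE A in M. v A \<le> (\<integral>x. \<psi> x \<partial>\<nu> A)"
    by (rule measurable_kernel_envelope[of \<mu>, OF \<mu> supp]) blast+
  have ae: "AE A in M. k A * exp (\<integral>x. \<phi> x \<partial>a A) \<le> (\<integral>x. exp (\<phi> x) \<partial>\<nu> A)"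
    if a[measurable]: "a \<in> M \<rightarrow>\<^sub>M prob_algebra borel" and k[measurable]: "k \<in> borel_measurable M"
      and le: "\<forall>A\<in>space M. \<forall>\<phi> b. \<phi> \<in> borel_measurable borel \<longrightarrow> (\<forall>x. \<bar>\<phi> x\<bar> \<le> b) \<longrightarrow>
          k A * exp (\<integral>x. \<phi> x \<partial>a A) \<le> (\<integral>x. exp (\<phi> x) \<partial>\<mu> A)"
      and \<phi>: "\<phi> \<in> borel_measurable borel" "\<And>x. \<bar>\<phi> x\<bar> \<le> b" for a \<phi> b and k :: "'a \<Rightarrow> real"
  proof (rule AE_kernel_exp_le_bounded_borel[OF a \<nu> _ \<phi>])
    fix \<psi> :: "real \<Rightarrow> real" and c
    assume \<psi>: "continuous_on UNIV \<psi>" and \<psi>c: "\<And>x. \<bar>\<psi> x\<bar> \<le> c"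
    have [measurable]: "\<psi> \<in> borel_measurable borel" using borel_measurable_continuous_onI[OF \<psi>] .
    have am: "(\<lambda>A. \<integral>x. \<psi> x \<partial>a A) \<in> borel_measurable M"
      using measurable_compose[OF measurable_prob_algebraD[OF a] integral_measurable_subprob_algebra[of \<psi> borel]] by simp
    show "AE A in M. k A * exp (\<integral>x. \<psi> x \<partial>a A) \<le> (\<integral>x. exp (\<psi> x) \<partial>\<nu> A)"
    proof (rule env)
      show "continuous_on UNIV (\<lambda>x. exp (\<psi> x))" by (intro continuous_intros \<psi>)
      show "\<bar>exp (\<psi> x)\<bar> \<le> exp c" for x using \<psi>c[of x] by auto
      show "(\<lambda>A. k A * exp (\<integral>x. \<psi> x \<partial>a A)) \<in> borel_measurable M" using am by measurable
      show "k A * exp (\<integral>x. \<psi> x \<partial>a A) \<le> (\<integral>x. exp (\<psi> x) \<partial>\<mu> A)" if "A \<in> space M" for A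
        using le that \<psi>c \<open>\<psi> \<in> borel_measurable borel\<close> by blast
    qed
  qed
  show thesis by (rule that[OF \<nu> ae])
qed

section \<open>Catoni function and product kernels\<close>

text \<open>Minus \<open>N\<close> times the logarithm of the Laplace transform, at
  \<open>lam / N\<close>, of a Bernoulli variable with mean \<open>p\<close>. \<open>Phi_inv\<close>
  is its generalised inverse.\<close>

definition catoni :: "nat \<Rightarrow> real \<Rightarrow> real \<Rightarrow> real" where
  "catoni N lam p = - real N * ln (1 - p + p * exp (- lam / real N))"

text \<open>Chord of the convex exponential: it compares a variable with values in the unit interval
  to the Bernoulli variable of the same mean.\<close>

lemma exp_minus_chord:
  fixes \<theta> y :: real
  assumes "0 \<le> y" "y \<le> 1"
  shows "exp (- \<theta> * y) \<le> 1 - y + y * exp (- \<theta>)"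
proof -
  have "exp ((1 - y) *\<^sub>R 0 + y *\<^sub>R (- \<theta>)) \<le> (1 - y) * exp 0 + y * exp (- \<theta>)"
    using convex_onD[OF exp_convex, of y 0 "- \<theta>"] assms by simp
  then show ?thesis by (simp add: mult.commute)
qed

lemma bernoulli_laplace_bounds:
  fixes \<theta> p :: real
  assumes "0 \<le> p" "p \<le> 1" "0 \<le> \<theta>"
  shows "exp (- \<theta>) \<le> 1 - p + p * exp (- \<theta>)" "1 - p + p * exp (- \<theta>) \<le> 1"
proof -
  have *: "exp (- \<theta>) \<le> 1" using assms by simp
  show "1 - p + p * exp (- \<theta>) \<le> 1" using mult_left_mono[OF *, of p] assms by simp
  have "(1 - p) * exp (- \<theta>) \<le> (1 - p) * 1" using assms * by (intro mult_left_mono) auto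
  then show "exp (- \<theta>) \<le> 1 - p + p * exp (- \<theta>)" by (simp add: algebra_simps)
qed

lemma bernoulli_laplace_pos:
  fixes \<theta> p :: real
  assumes "0 \<le> p" "p \<le> 1" "0 \<le> \<theta>"
  shows "0 < 1 - p + p * exp (- \<theta>)"
  using bernoulli_laplace_bounds(1)[OF assms] exp_gt_zero[of "- \<theta>"] by linarith

lemma catoni_bounds:
  assumes "0 \<le> p" "p \<le> 1" "0 \<le> lam"
  shows "0 \<le> catoni N lam p" "catoni N lam p \<le> lam"
proof -
  define y where "y = 1 - p + p * exp (- (lam / real N))"
  have y: "exp (- (lam / real N)) \<le> y" "y \<le> 1" "0 < y"
    using bernoulli_laplace_bounds[of p "lam / real N"] bernoulli_laplace_pos[of p "lam / real N"] assms
    by (auto simp: y_def)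
  have eq: "catoni N lam p = real N * (- ln y)" by (simp add: catoni_def y_def)
  show "0 \<le> catoni N lam p" unfolding eq using y by (intro mult_nonneg_nonneg) auto
  have "- ln y \<le> lam / real N" using y by (metis ln_exp ln_le_cancel_iff minus_le_iff exp_gt_zero)
  then have "real N * (- ln y) \<le> real N * (lam / real N)" by (intro mult_left_mono) auto
  also have "\<dots> \<le> lam" using assms by (cases "N = 0") auto
  finally show "catoni N lam p \<le> lam" unfolding eq .
qed

lemma ln_le_tangent:
  fixes y c :: real
  assumes "0 < y" "0 < c"
  shows "ln y \<le> ln c + (y - c) / c"
  using ln_le_minus_one[of "y / c"] assms by (simp add: ln_div diff_divide_distrib)

text \<open>\<open>ln\<close> lies below its tangent at the value \<open>c\<close> that belongs to
  the mean of \<open>p\<close>. The argument of \<open>ln\<close> is affine in \<open>p\<close>, so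
  the linear term integrates to 0 and only \<open>ln c\<close> remains.\<close>

lemma (in prob_space) catoni_jensen:
  assumes p[measurable]: "p \<in> borel_measurable M" and range: "\<And>x. x \<in> space M \<Longrightarrow> 0 \<le> p x \<and> p x \<le> 1"
    and lam: "0 \<le> lam"
  shows "catoni N lam (\<integral>x. p x \<partial>M) \<le> (\<integral>x. catoni N lam (p x) \<partial>M)"
    and "integrable M p" and "integrable M (\<lambda>x. catoni N lam (p x))"
    and "0 \<le> (\<integral>x. p x \<partial>M)" and "(\<integral>x. p x \<partial>M) \<le> 1"
proof -
  define \<theta> where "\<theta> = lam / real N"
  have \<theta>: "0 \<le> \<theta>" using lam by (simp add: \<theta>_def)
  show int: "integrable M p" using range by (intro integrable_const_bound[where B=1]) auto
  show E0: "0 \<le> (\<integral>x. p x \<partial>M)" using range by (intro integral_nonneg_AE AE_I2) auto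
  have "(\<integral>x. p x \<partial>M) \<le> (\<integral>x. 1 \<partial>M)" using range int by (intro integral_mono) auto
  then show E1: "(\<integral>x. p x \<partial>M) \<le> 1" by (simp add: prob_space)
  show intc: "integrable M (\<lambda>x. catoni N lam (p x))"
  proof (rule integrable_const_bound[where B=lam])
    show "AE x in M. norm (catoni N lam (p x)) \<le> lam"
    proof (rule AE_I2)
      fix x assume "x \<in> space M"
      then show "norm (catoni N lam (p x)) \<le> lam" using catoni_bounds[of "p x" lam N] range[of x] lam by auto
    qed
  qed (simp add: catoni_def)
  define y where "y q = 1 - q + q * exp (- \<theta>)" for q
  have cat: "catoni N lam q = - real N * ln (y q)" for q by (simp add: catoni_def y_def \<theta>_def)
  define c where "c = y (\<integral>x. p x \<partial>M)"
  have c: "0 < c" unfolding c_def y_def using E0 E1 \<theta> by (rule bernoulli_laplace_pos)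
  have yint: "integrable M (\<lambda>x. y (p x))" unfolding y_def using int by auto
  have Ey: "(\<integral>x. y (p x) \<partial>M) = c" unfolding c_def y_def using int by (simp add: prob_space)
  have "(\<integral>x. - real N * (ln c + (y (p x) - c) / c) \<partial>M) \<le> (\<integral>x. catoni N lam (p x) \<partial>M)"
  proof (rule integral_mono[OF _ intc])
    show "integrable M (\<lambda>x. - real N * (ln c + (y (p x) - c) / c))" using yint by auto
    fix x assume x: "x \<in> space M"
    have "0 < y (p x)" unfolding y_def using range[OF x] \<theta> by (intro bernoulli_laplace_pos) auto
    from ln_le_tangent[OF this c] show "- real N * (ln c + (y (p x) - c) / c) \<le> catoni N lam (p x)"
      unfolding cat by (intro mult_left_mono_neg) auto
  qed
  also have "(\<integral>x. - real N * (ln c + (y (p x) - c) / c) \<partial>M) = - real N * ln c"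
    using yint Ey by (simp add: prob_space)
  finally show "catoni N lam (\<integral>x. p x \<partial>M) \<le> (\<integral>x. catoni N lam (p x) \<partial>M)"
    by (simp add: cat c_def)
qed

text \<open>Jensen for the weights \<open>m i / N\<close>, again by the tangent. It replaces a
  function of the pooled mean, which couples all indices, by a sum whose exponential factorises over
  the tasks.\<close>

lemma catoni_weighted_jensen:
  fixes m :: "'i \<Rightarrow> nat"
  assumes I: "finite I" and range: "\<And>i. i \<in> I \<Longrightarrow> 0 \<le> p i \<and> p i \<le> 1" and lam: "0 \<le> lam"
    and N: "N = (\<Sum>i\<in>I. m i)"
  shows "catoni N lam ((\<Sum>i\<in>I. real (m i) * p i) / real N)
    \<le> (\<Sum>i\<in>I. - real (m i) * ln (1 - p i + p i * exp (- lam / real N)))"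
proof (cases "N = 0")
  case True
  then have "\<forall>i\<in>I. m i = 0" using N I by simp
  then show ?thesis using True by (simp add: catoni_def)
next
  case False
  define \<theta> where "\<theta> = lam / real N"
  have \<theta>: "0 \<le> \<theta>" using lam by (simp add: \<theta>_def)
  define q where "q = (\<Sum>i\<in>I. real (m i) * p i) / real N"
  have NN: "real N = (\<Sum>i\<in>I. real (m i))" by (simp add: N)
  have q0: "0 \<le> q" unfolding q_def using range by (intro divide_nonneg_nonneg sum_nonneg mult_nonneg_nonneg) auto
  have "(\<Sum>i\<in>I. real (m i) * p i) \<le> real N"
    unfolding NN using range by (intro sum_mono) (auto intro: mult_left_le)
  then have q1: "q \<le> 1" using False by (simp add: q_def divide_le_eq)
  define y where "y r = 1 - r + r * exp (- \<theta>)" for r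
  have c: "0 < y q" unfolding y_def using q0 q1 \<theta> by (rule bernoulli_laplace_pos)
  have qN: "real N * q = (\<Sum>i\<in>I. real (m i) * p i)" using False by (simp add: q_def)
  have "(\<Sum>i\<in>I. real (m i) * (y (p i) - y q)) = (exp (- \<theta>) - 1) * (\<Sum>i\<in>I. real (m i) * p i - real (m i) * q)"
    unfolding sum_distrib_left by (intro sum.cong) (auto simp: y_def algebra_simps)
  also have "\<dots> = (exp (- \<theta>) - 1) * (real N * q - (\<Sum>i\<in>I. real (m i)) * q)"
    by (simp add: sum_subtractf qN sum_distrib_right)
  also have "\<dots> = 0" by (simp add: NN)
  finally have zero: "(\<Sum>i\<in>I. real (m i) * (y (p i) - y q)) = 0" .
  have "(\<Sum>i\<in>I. real (m i) * ln (y (p i))) \<le> (\<Sum>i\<in>I. real (m i) * (ln (y q) + (y (p i) - y q) / y q))"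
  proof (intro sum_mono mult_left_mono)
    fix i assume "i \<in> I"
    then have "0 < y (p i)" unfolding y_def using range \<theta> by (intro bernoulli_laplace_pos) auto
    from ln_le_tangent[OF this c] show "ln (y (p i)) \<le> ln (y q) + (y (p i) - y q) / y q" .
  qed auto
  also have "\<dots> = real N * ln (y q) + (\<Sum>i\<in>I. real (m i) * (y (p i) - y q)) / y q"
    by (simp add: NN algebra_simps sum.distrib sum_distrib_left sum_divide_distrib)
  also have "\<dots> = real N * ln (y q)" by (simp add: zero)
  finally show ?thesis
    by (simp add: catoni_def q_def[symmetric] y_def \<theta>_def sum_negf)
qed

lemma (in prob_space) nn_integral_exp_minus_le:
  assumes X[measurable]: "X \<in> borel_measurable M" and range: "AE x in M. 0 \<le> X x \<and> X x \<le> 1"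
  shows "(\<integral>\<^sup>+ x. ennreal (exp (- \<theta> * X x)) \<partial>M)
    \<le> ennreal (1 - (\<integral>x. X x \<partial>M) + (\<integral>x. X x \<partial>M) * exp (- \<theta>))"
proof -
  have int: "integrable M X" using range by (intro integrable_const_bound[where B=1]) auto
  have "(\<integral>\<^sup>+ x. ennreal (exp (- \<theta> * X x)) \<partial>M) \<le> (\<integral>\<^sup>+ x. ennreal (1 - X x + X x * exp (- \<theta>)) \<partial>M)"
    using range by (intro nn_integral_mono_AE, eventually_elim) (intro ennreal_leI exp_minus_chord, auto)
  also have "\<dots> = ennreal (\<integral>x. 1 - X x + X x * exp (- \<theta>) \<partial>M)"
  proof (rule nn_integral_eq_integral)
    show "AE x in M. 0 \<le> 1 - X x + X x * exp (- \<theta>)" using range by eventually_elim auto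
  qed (use int in auto)
  also have "(\<integral>x. 1 - X x + X x * exp (- \<theta>) \<partial>M) = 1 - (\<integral>x. X x \<partial>M) + (\<integral>x. X x \<partial>M) * exp (- \<theta>)"
    using int by (simp add: prob_space)
  finally show ?thesis .
qed

text \<open>The supremum in \<open>Phi_inv\<close> is taken over a set bounded by 1, so membership
  in that set suffices; both levels of the final bound are read off in this way.\<close>

lemma le_Phi_inv:
  assumes "0 \<le> p" "p \<le> 1" "ereal (catoni N lam p) \<le> ereal (lam * q) + b"
  shows "p \<le> Phi_inv N q b lam"
  unfolding Phi_inv_def using assms
  by (intro cSup_upper) (auto simp: catoni_def intro!: bdd_aboveI[of _ 1])

text \<open>Measurability is tested on cylinders, an intersection-stable generator, where the
  product measure is a finite product of measurable functions. The index set may be infinite, as it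
  is for sample sequences.\<close>

lemma measurable_PiM_kernel:
  assumes K: "\<And>i. i \<in> I \<Longrightarrow> K i \<in> M \<rightarrow>\<^sub>M prob_algebra (N i)"
  shows "(\<lambda>x. \<Pi>\<^sub>M i\<in>I. K i x) \<in> M \<rightarrow>\<^sub>M prob_algebra (\<Pi>\<^sub>M i\<in>I. N i)"
proof (rule measurable_prob_algebra_generated[OF sets_PiM Int_stable_prod_algebra prod_algebra_sets_into_space])
  fix x assume x: "x \<in> space M"
  have Kx: "prob_space (K i x)" "sets (K i x) = sets (N i)" if "i \<in> I" for i
    using measurable_space[OF K[OF that] x] by (auto simp: space_prob_algebra)
  show "prob_space (\<Pi>\<^sub>M i\<in>I. K i x)" using Kx by (intro prob_space_PiM)
  show "sets (\<Pi>\<^sub>M i\<in>I. K i x) = sets (\<Pi>\<^sub>M i\<in>I. N i)" using Kx by (intro sets_PiM_cong) auto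
next
  fix X assume "X \<in> prod_algebra I N"
  then obtain J E where X: "X = prod_emb I N J (Pi\<^sub>E J E)" and J: "finite J" "J \<subseteq> I"
    and E: "\<And>i. i \<in> J \<Longrightarrow> E i \<in> sets (N i)"
    by (auto elim!: prod_algebraE)
  have "emeasure (\<Pi>\<^sub>M i\<in>I. K i x) X = (\<Prod>i\<in>J. emeasure (K i x) (E i))" if x: "x \<in> space M" for x
  proof -
    have Kx: "prob_space (K i x)" "sets (K i x) = sets (N i)" if "i \<in> I" for i
      using measurable_space[OF K[OF that] x] by (auto simp: space_prob_algebra)
    have "X = prod_emb I (\<lambda>i. K i x) J (Pi\<^sub>E J E)"
      unfolding X prod_emb_def using sets_eq_imp_space_eq[OF Kx(2)] by (auto simp: PiE_iff)
    then show ?thesis using Kx J E by (simp add: emeasure_PiM_emb subset_eq)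
  qed
  then show "(\<lambda>x. emeasure (\<Pi>\<^sub>M i\<in>I. K i x) X) \<in> borel_measurable M"
    using J E
    by (subst measurable_cong) (auto intro!: borel_measurable_prod_ennreal
      measurable_compose[OF measurable_prob_algebraD[OF K] measurable_emeasure_subprob_algebra])
qed

section \<open>Exponential moments over the tasks\<close>

lemma measurable_env_kernel:
  assumes tau0_sets: "sets tau0 = sets (prob_algebra MZ \<Otimes>\<^sub>M count_space S)"
  shows "(\<lambda>(D, m). distr (\<Pi>\<^sub>M j\<in>UNIV. D) (task_space MZ) (\<lambda>s. (D, m, s)))
    \<in> tau0 \<rightarrow>\<^sub>M prob_algebra (task_space MZ)"
proof -
  let ?L = "prob_algebra MZ \<Otimes>\<^sub>M count_space S"
  have "(\<lambda>p. distr (\<Pi>\<^sub>M j\<in>UNIV. fst p) (task_space MZ) (\<lambda>s. (fst p, snd p, s)))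
    \<in> ?L \<rightarrow>\<^sub>M prob_algebra (task_space MZ)"
  proof (rule measurable_distr_prob_space2)
    show "(\<lambda>p. \<Pi>\<^sub>M j\<in>UNIV. fst p) \<in> ?L \<rightarrow>\<^sub>M prob_algebra (\<Pi>\<^sub>M j\<in>(UNIV :: nat set). MZ)"
      by (intro measurable_PiM_kernel) measurable
    have [measurable]: "(\<lambda>p. snd (fst p)) \<in> ?L \<Otimes>\<^sub>M (\<Pi>\<^sub>M j\<in>(UNIV :: nat set). MZ) \<rightarrow>\<^sub>M count_space UNIV"
      by (rule measurable_compose[OF measurable_fst measurable_compose[OF measurable_snd]]) simp
    have "(\<lambda>p. (fst (fst p), snd (fst p), snd p))
      \<in> ?L \<Otimes>\<^sub>M (\<Pi>\<^sub>M j\<in>(UNIV :: nat set). MZ) \<rightarrow>\<^sub>M task_space MZ"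
      unfolding task_space_def by measurable
    then show "(\<lambda>(p, s). (fst p, snd p, s)) \<in> ?L \<Otimes>\<^sub>M (\<Pi>\<^sub>M j\<in>(UNIV :: nat set). MZ) \<rightarrow>\<^sub>M task_space MZ"
      by (simp add: case_prod_beta')
  qed
  then show ?thesis unfolding measurable_cong_sets[OF tau0_sets refl] case_prod_beta' .
qed

context
  fixes MZ :: "'z measure" and tau0 :: "('z measure \<times> nat) measure" and S :: "nat set"
  assumes tau0_prob: "prob_space tau0"
    and tau0_sets: "sets tau0 = sets (prob_algebra MZ \<Otimes>\<^sub>M count_space S)"
begin

lemma env_in_prob_algebra: "env MZ tau0 \<in> space (prob_algebra (task_space MZ))"
proof -
  have "tau0 \<in> space (prob_algebra tau0)" using tau0_prob by (simp add: space_prob_algebra)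
  from prob_space_bind'[OF this measurable_env_kernel[OF tau0_sets]]
    sets_bind'[OF this measurable_env_kernel[OF tau0_sets]]
  show ?thesis by (simp add: space_prob_algebra env_def)
qed

lemma prob_space_env: "prob_space (env MZ tau0)"
  using env_in_prob_algebra by (simp add: space_prob_algebra)

lemma sets_env: "sets (env MZ tau0) = sets (task_space MZ)"
  using env_in_prob_algebra by (simp add: space_prob_algebra)

lemma space_tau0D:
  assumes "p \<in> space tau0"
  shows "prob_space (fst p)" "sets (fst p) = sets MZ" "snd p \<in> S"
  using assms sets_eq_imp_space_eq[OF tau0_sets]
  by (auto simp: space_pair_measure space_prob_algebra)

lemma nn_integral_env:
  assumes f[measurable]: "f \<in> borel_measurable (task_space MZ)"
  shows "(\<integral>\<^sup>+ t. f t \<partial>env MZ tau0) = (\<integral>\<^sup>+ p. (\<integral>\<^sup>+ s. f (fst p, snd p, s) \<partial>(\<Pi>\<^sub>M j\<in>UNIV. fst p)) \<partial>tau0)"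
proof -
  have "(\<integral>\<^sup>+ t. f t \<partial>env MZ tau0) = (\<integral>\<^sup>+ p. (\<integral>\<^sup>+ t. f t \<partial>(case p of (D, m) \<Rightarrow>
      distr (\<Pi>\<^sub>M j\<in>UNIV. D) (task_space MZ) (\<lambda>s. (D, m, s)))) \<partial>tau0)"
    unfolding env_def
    by (rule nn_integral_bind[OF f measurable_prob_algebraD[OF measurable_env_kernel[OF tau0_sets]]])
  also have "\<dots> = (\<integral>\<^sup>+ p. (\<integral>\<^sup>+ s. f (fst p, snd p, s) \<partial>(\<Pi>\<^sub>M j\<in>UNIV. fst p)) \<partial>tau0)"
  proof (rule nn_integral_cong)
    fix p assume "p \<in> space tau0"
    note p = space_tau0D[OF this]
    have "sets (\<Pi>\<^sub>M j\<in>(UNIV :: nat set). fst p) = sets (\<Pi>\<^sub>M j\<in>(UNIV :: nat set). MZ)"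
      using p by (intro sets_PiM_cong) auto
    moreover have "(\<lambda>s. (fst p, snd p, s)) \<in> (\<Pi>\<^sub>M j\<in>(UNIV :: nat set). MZ) \<rightarrow>\<^sub>M task_space MZ"
      unfolding task_space_def using p by (intro measurable_Pair measurable_const) (auto simp: space_prob_algebra)
    ultimately have "(\<lambda>s. (fst p, snd p, s)) \<in> (\<Pi>\<^sub>M j\<in>UNIV. fst p) \<rightarrow>\<^sub>M task_space MZ"
      using measurable_cong_sets by blast
    then show "(\<integral>\<^sup>+ t. f t \<partial>(case p of (D, m) \<Rightarrow> distr (\<Pi>\<^sub>M j\<in>UNIV. D) (task_space MZ) (\<lambda>s. (D, m, s))))
      = (\<integral>\<^sup>+ s. f (fst p, snd p, s) \<partial>(\<Pi>\<^sub>M j\<in>UNIV. fst p))"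
      by (simp add: case_prod_beta' nn_integral_distr)
  qed
  finally show ?thesis .
qed

end

lemma measurable_tsize[measurable]: "tsize \<in> task_space MZ \<rightarrow>\<^sub>M count_space UNIV"
  unfolding tsize_def[abs_def] task_space_def by measurable

lemma measurable_task_distribution: "fst \<in> task_space MZ \<rightarrow>\<^sub>M prob_algebra MZ"
  unfolding task_space_def by (rule measurable_fst)

lemma measurable_task_sample: "(\<lambda>t. snd (snd t)) \<in> task_space MZ \<rightarrow>\<^sub>M (\<Pi>\<^sub>M j\<in>UNIV. MZ)"
  unfolding task_space_def by (rule measurable_compose[OF measurable_snd measurable_snd])

lemma measurable_task_sample_component: "(\<lambda>t. snd (snd t) j) \<in> task_space MZ \<rightarrow>\<^sub>M MZ"
  using measurable_compose[OF measurable_task_sample measurable_component_singleton[of j UNIV "\<lambda>_. MZ"]]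
  by simp

lemma dataset_eq: "dataset t = map (snd (snd t)) [0..<tsize t]"
  by (cases t) (simp add: dataset_def tsize_def)

lemma sum_list_dataset: "(\<Sum>z\<leftarrow>dataset t. h z) = (\<Sum>j<tsize t. h (snd (snd t) j))"
  unfolding dataset_eq map_map comp_def interv_sum_list_conv_sum_set_nat by (simp add: atLeast0LessThan)

text \<open>Dataset lengths vary with the task; as the size takes countably many values,
  measurability for each fixed length is enough.\<close>

lemma measurable_size_cases:
  assumes t: "t \<in> X \<rightarrow>\<^sub>M task_space MZ" and F: "\<And>m. (\<lambda>x. F m x) \<in> X \<rightarrow>\<^sub>M N"
  shows "(\<lambda>x. F (tsize (t x)) x) \<in> X \<rightarrow>\<^sub>M N"
  by (rule measurable_compose_countable'[OF F measurable_compose[OF t measurable_tsize] countableI_type])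

text \<open>Pushing \<open>L x\<close> forward along \<open>y \<mapsto> (x, y)\<close> turns the
  integrand, which varies with \<open>x\<close>, into a fixed one, whose integral is measurable in
  the measure.\<close>

lemma measurable_integral_kernel:
  fixes f :: "'x \<Rightarrow> 'y \<Rightarrow> real"
  assumes f[measurable]: "(\<lambda>(x, y). f x y) \<in> borel_measurable (M \<Otimes>\<^sub>M N)"
    and L: "L \<in> M \<rightarrow>\<^sub>M subprob_algebra N"
  shows "(\<lambda>x. \<integral>y. f x y \<partial>L x) \<in> borel_measurable M"
proof -
  have "(\<lambda>x. distr (L x) (M \<Otimes>\<^sub>M N) (\<lambda>y. (x, y))) \<in> M \<rightarrow>\<^sub>M subprob_algebra (M \<Otimes>\<^sub>M N)"
    by (rule measurable_distr2[OF _ L]) simp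
  from measurable_compose[OF this integral_measurable_subprob_algebra[OF f]]
  have "(\<lambda>x. \<integral>p. (case p of (x, y) \<Rightarrow> f x y) \<partial>distr (L x) (M \<Otimes>\<^sub>M N) (\<lambda>y. (x, y))) \<in> borel_measurable M" .
  then show ?thesis
  proof (rule measurable_cong[THEN iffD1, rotated])
    fix x assume x: "x \<in> space M"
    have "(\<lambda>y. (x, y)) \<in> L x \<rightarrow>\<^sub>M M \<Otimes>\<^sub>M N"
      using measurable_Pair1'[OF x] unfolding measurable_cong_sets[OF sets_kernel[OF L x] refl] .
    then show "(\<integral>p. (case p of (x, y) \<Rightarrow> f x y) \<partial>distr (L x) (M \<Otimes>\<^sub>M N) (\<lambda>y. (x, y))) = (\<integral>y. f x y \<partial>L x)"
      by (subst integral_distr[OF _ f]) simp_all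
  qed
qed

definition task_sum :: "('z \<Rightarrow> real) \<Rightarrow> 'z task \<Rightarrow> real" where
  "task_sum h t = (\<Sum>z\<leftarrow>dataset t. h z)"

definition task_mean :: "('z \<Rightarrow> real) \<Rightarrow> 'z task \<Rightarrow> real" where
  "task_mean h t = (\<integral>z. h z \<partial>fst t)"

lemma measurable_task_sum:
  assumes t[measurable]: "t \<in> X \<rightarrow>\<^sub>M task_space MZ"
    and H[measurable]: "(\<lambda>(x, z). H x z) \<in> borel_measurable (X \<Otimes>\<^sub>M MZ)"
  shows "(\<lambda>x. task_sum (H x) (t x)) \<in> borel_measurable X"
  unfolding task_sum_def sum_list_dataset
proof (rule measurable_size_cases[OF t, of "\<lambda>m x. \<Sum>j<m. H x (snd (snd (t x)) j)"])
  fix m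
  have "(\<lambda>x. (x, snd (snd (t x)) j)) \<in> X \<rightarrow>\<^sub>M X \<Otimes>\<^sub>M MZ" for j
    by (intro measurable_Pair measurable_ident_sets refl measurable_compose[OF t measurable_task_sample_component])
  from measurable_compose[OF this H] show "(\<lambda>x. \<Sum>j<m. H x (snd (snd (t x)) j)) \<in> borel_measurable X"
    by (intro borel_measurable_sum) simp
qed

lemma measurable_task_mean:
  assumes t[measurable]: "t \<in> X \<rightarrow>\<^sub>M task_space MZ"
    and H[measurable]: "(\<lambda>(x, z). H x z) \<in> borel_measurable (X \<Otimes>\<^sub>M MZ)"
  shows "(\<lambda>x. task_mean (H x) (t x)) \<in> borel_measurable X"
  unfolding task_mean_def
  by (rule measurable_integral_kernel[OF H
    measurable_prob_algebraD[OF measurable_compose[OF t measurable_task_distribution]]])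

lemma task_mean_range:
  assumes "t \<in> space (task_space MZ)" "h \<in> borel_measurable MZ" "\<And>z. 0 \<le> h z \<and> h z \<le> 1"
  shows "0 \<le> task_mean h t" "task_mean h t \<le> 1"
proof -
  have "prob_space (fst t)" and s: "sets (fst t) = sets MZ"
    using measurable_space[OF measurable_task_distribution assms(1)] unfolding space_prob_algebra by simp_all
  interpret prob_space "fst t" by fact
  have "h \<in> borel_measurable (fst t)" using assms(2) unfolding measurable_cong_sets[OF s refl] .
  from catoni_jensen(4,5)[OF this assms(3) order_refl]
  show "0 \<le> task_mean h t" "task_mean h t \<le> 1" unfolding task_mean_def .
qed

text \<open>Only the first \<open>m\<close> samples matter, so the infinite product restricts to a
  finite one, over which the integral factorises; each factor obeys the Bernoulli
  comparison.\<close>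

lemma nn_integral_iid_exp_sum_le:
  assumes D: "prob_space D" and h: "h \<in> borel_measurable D" and range: "\<And>z. 0 \<le> h z \<and> h z \<le> 1"
  shows "(\<integral>\<^sup>+ s. ennreal (exp (- \<theta> * (\<Sum>j<m. h (s j)))) \<partial>(\<Pi>\<^sub>M j\<in>(UNIV :: nat set). D))
    \<le> ennreal ((1 - (\<integral>z. h z \<partial>D) + (\<integral>z. h z \<partial>D) * exp (- \<theta>)) ^ m)"
proof -
  interpret D: prob_space D by fact
  interpret P: product_prob_space "\<lambda>_. D" "UNIV :: nat set" by unfold_locales
  let ?e = "\<lambda>z. ennreal (exp (- \<theta> * h z))"
  have "(\<integral>\<^sup>+ s. ennreal (exp (- \<theta> * (\<Sum>j<m. h (s j)))) \<partial>(\<Pi>\<^sub>M j\<in>(UNIV :: nat set). D))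
    = (\<integral>\<^sup>+ s. (\<Prod>j<m. ?e (restrict s {..<m} j)) \<partial>(\<Pi>\<^sub>M j\<in>(UNIV :: nat set). D))"
    by (intro nn_integral_cong) (simp add: sum_distrib_left exp_sum prod_ennreal)
  also have "\<dots> = (\<integral>\<^sup>+ s. (\<Prod>j<m. ?e (s j)) \<partial>distr (\<Pi>\<^sub>M j\<in>(UNIV :: nat set). D) (\<Pi>\<^sub>M j\<in>{..<m}. D) (\<lambda>s. restrict s {..<m}))"
    using h by (subst nn_integral_distr) (auto intro!: measurable_restrict_subset borel_measurable_prod_ennreal)
  also have "\<dots> = (\<integral>\<^sup>+ s. (\<Prod>j<m. ?e (s j)) \<partial>(\<Pi>\<^sub>M j\<in>{..<m}. D))"
    by (subst P.distr_PiM_restrict_finite) auto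
  also have "\<dots> = (\<Prod>j<m. (\<integral>\<^sup>+ z. ?e z \<partial>D))"
    using h by (intro P.product_nn_integral_prod) auto
  also have "\<dots> = (\<integral>\<^sup>+ z. ?e z \<partial>D) ^ m" by simp
  also have "\<dots> \<le> ennreal (1 - (\<integral>z. h z \<partial>D) + (\<integral>z. h z \<partial>D) * exp (- \<theta>)) ^ m"
    using range by (intro power_mono_ennreal D.nn_integral_exp_minus_le h) auto
  also have "\<dots> = ennreal ((1 - (\<integral>z. h z \<partial>D) + (\<integral>z. h z \<partial>D) * exp (- \<theta>)) ^ m)"
  proof (rule ennreal_power)
    have "0 \<le> (\<integral>z. h z \<partial>D)" "(\<integral>z. h z \<partial>D) \<le> 1"
      using D.catoni_jensen(4,5)[OF h range order_refl] .
    then show "0 \<le> 1 - (\<integral>z. h z \<partial>D) + (\<integral>z. h z \<partial>D) * exp (- \<theta>)" by simp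
  qed
  finally show ?thesis .
qed

text \<open>Exponent of the inner moment: Catoni's function at the size-weighted mean of the true
  losses against \<open>lam\<close> times the pooled empirical loss. Its rate
  \<open>lam / totalM n w\<close> depends on all sample sizes at once.\<close>

definition task_gap :: "real \<Rightarrow> nat \<Rightarrow> (nat \<Rightarrow> 'z \<Rightarrow> real) \<Rightarrow> (nat \<Rightarrow> 'z task) \<Rightarrow> real" where
  "task_gap lam n H w =
     catoni (totalM n w) lam ((\<Sum>i<n. real (tsize (w i)) * task_mean (H i) (w i)) / real (totalM n w))
     - lam * ((\<Sum>i<n. task_sum (H i) (w i)) / real (totalM n w))"

lemma measurable_PiM_component_compose:
  assumes "i \<in> I" "g \<in> N \<rightarrow>\<^sub>M L"
  shows "(\<lambda>w. g (w i)) \<in> (\<Pi>\<^sub>M i\<in>I. N) \<rightarrow>\<^sub>M L"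
  by (rule measurable_compose[OF measurable_component_singleton[of i I "\<lambda>_. N"] assms(2)]) (rule assms)

lemma measurable_totalM: "(\<lambda>w. real (totalM n w)) \<in> borel_measurable (\<Pi>\<^sub>M i\<in>{..<n}. task_space MZ)"
proof -
  have "(\<lambda>w. real (tsize (w i))) \<in> borel_measurable (\<Pi>\<^sub>M i\<in>{..<n}. task_space MZ)" if "i < n" for i
    using that by (intro measurable_PiM_component_compose[where g="\<lambda>t. real (tsize t)"]
        measurable_compose[OF measurable_tsize]) auto
  then show ?thesis unfolding totalM_def of_nat_sum by (intro borel_measurable_sum) simp
qed

lemma measurable_task_gap:
  assumes H: "\<And>i. i < n \<Longrightarrow> (\<lambda>(x, z). H i x z) \<in> borel_measurable (X \<Otimes>\<^sub>M MZ)"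
  shows "(\<lambda>(x, w). task_gap lam n (\<lambda>i. H i x) w) \<in> borel_measurable (X \<Otimes>\<^sub>M (\<Pi>\<^sub>M i\<in>{..<n}. task_space MZ))"
proof -
  let ?W = "X \<Otimes>\<^sub>M (\<Pi>\<^sub>M i\<in>{..<n}. task_space MZ)"
  have M[measurable]: "(\<lambda>p. real (totalM n (snd p))) \<in> borel_measurable ?W"
    by (rule measurable_compose[OF measurable_snd measurable_totalM])
  have t: "(\<lambda>p. snd p i) \<in> ?W \<rightarrow>\<^sub>M task_space MZ" if "i < n" for i
    using that measurable_PiM_component_compose[of i "{..<n}" "\<lambda>t. t" "task_space MZ" "task_space MZ"]
    by (intro measurable_compose[OF measurable_snd]) auto
  have Hp: "(\<lambda>(p, z). H i (fst p) z) \<in> borel_measurable (?W \<Otimes>\<^sub>M MZ)" if "i < n" for i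
  proof -
    have "(\<lambda>q. (fst (fst q), snd q)) \<in> ?W \<Otimes>\<^sub>M MZ \<rightarrow>\<^sub>M X \<Otimes>\<^sub>M MZ"
      by (intro measurable_Pair measurable_compose[OF measurable_fst measurable_fst] measurable_snd)
    from measurable_compose[OF this H[OF that]] show ?thesis by (simp add: case_prod_beta')
  qed
  have [measurable]: "(\<lambda>p. \<Sum>i<n. task_sum (H i (fst p)) (snd p i)) \<in> borel_measurable ?W"
    by (intro borel_measurable_sum measurable_task_sum[where MZ=MZ] t Hp) auto
  have [measurable]: "(\<lambda>p. \<Sum>i<n. real (tsize (snd p i)) * task_mean (H i (fst p)) (snd p i)) \<in> borel_measurable ?W"
  proof (intro borel_measurable_sum borel_measurable_times measurable_task_mean[where MZ=MZ] t Hp)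
    fix i assume "i \<in> {..<n}"
    then show "(\<lambda>p. real (tsize (snd p i))) \<in> borel_measurable ?W"
      using measurable_compose[OF measurable_compose[OF t measurable_tsize], of i real borel] by simp
  qed auto
  show ?thesis unfolding task_gap_def catoni_def case_prod_beta' by measurable
qed

lemma task_mean_pair: "task_mean h (D, m, s) = (\<integral>z. h z \<partial>D)"
  by (simp add: task_mean_def)

lemma task_sum_pair: "task_sum h (D, m, s) = (\<Sum>j<m. h (s j))"
  unfolding task_sum_def sum_list_dataset by (simp add: tsize_def)

context
  fixes MZ :: "'z measure" and tau0 :: "('z measure \<times> nat) measure" and S :: "nat set" and n :: nat
  assumes tau0_prob: "prob_space tau0"
    and tau0_sets: "sets tau0 = sets (prob_algebra MZ \<Otimes>\<^sub>M count_space S)"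
begin

text \<open>\<open>task_space\<close> admits every size; the restriction to \<open>S\<close> sits in
  the space of \<open>tau0\<close>, and after the sampling it persists only as an almost sure
  statement.\<close>

lemma AE_env_tsize: "AE t in env MZ tau0. tsize t \<in> S"
proof -
  have "(\<lambda>t. indicator (- S) (tsize t) :: ennreal) \<in> borel_measurable (task_space MZ)"
    using measurable_compose[OF measurable_tsize, of "indicator (- S)" borel] by simp
  note m = this
  have "(\<integral>\<^sup>+ t. indicator (- S) (tsize t) \<partial>env MZ tau0) =
    (\<integral>\<^sup>+ p. (\<integral>\<^sup>+ s. indicator (- S) (snd p) \<partial>(\<Pi>\<^sub>M j\<in>(UNIV :: nat set). fst p)) \<partial>tau0)"
    by (subst nn_integral_env[OF tau0_prob tau0_sets m]) (simp add: tsize_def)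
  also have "\<dots> = (\<integral>\<^sup>+ p. 0 \<partial>tau0)"
    using space_tau0D(3)[OF tau0_prob tau0_sets] by (intro nn_integral_cong) simp
  finally have "(\<integral>\<^sup>+ t. indicator (- S) (tsize t) \<partial>env MZ tau0) = 0" by simp
  then have "AE t in env MZ tau0. indicator (- S) (tsize t) = (0::ennreal)"
    using m unfolding measurable_cong_sets[OF sets_env[OF tau0_prob tau0_sets, symmetric] refl]
    by (subst (asm) nn_integral_0_iff_AE) auto
  then show ?thesis by eventually_elim (auto split: split_indicator_asm)
qed

text \<open>With rate \<open>\<theta>\<close> and size \<open>v\<close> frozen, the Laplace
  transform given the task distribution is at most the \<open>v\<close>-th power of the Bernoulli
  transform, which the logarithmic term cancels. What remains is the probability of size
  \<open>v\<close>.\<close>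

lemma single_task_moment:
  assumes h: "h \<in> borel_measurable MZ" and range: "\<And>z. 0 \<le> h z \<and> h z \<le> 1" and \<theta>: "0 \<le> \<theta>"
  shows "(\<integral>\<^sup>+ t. indicator {v} (tsize t) * ennreal (exp (- \<theta> * task_sum h t
      - real v * ln (1 - task_mean h t + task_mean h t * exp (- \<theta>)))) \<partial>env MZ tau0)
    \<le> emeasure (env MZ tau0) {t \<in> space (env MZ tau0). tsize t = v}"
proof -
  note env = sets_env[OF tau0_prob tau0_sets]
  have hx: "(\<lambda>(x, z). h z) \<in> borel_measurable (task_space MZ \<Otimes>\<^sub>M MZ)"
    using measurable_compose[OF measurable_snd h] by (simp add: case_prod_beta')
  have [measurable]: "task_sum h \<in> borel_measurable (task_space MZ)" "task_mean h \<in> borel_measurable (task_space MZ)"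
    using measurable_task_sum[OF measurable_ident_sets[OF refl] hx] measurable_task_mean[OF measurable_ident_sets[OF refl] hx]
    by simp_all
  have ind[measurable]: "(\<lambda>t. indicator {v} (tsize t) :: ennreal) \<in> borel_measurable (task_space MZ)"
    using measurable_compose[OF measurable_tsize, of "indicator {v}" borel] by simp
  let ?f = "\<lambda>t. indicator {v} (tsize t) * ennreal (exp (- \<theta> * task_sum h t
      - real v * ln (1 - task_mean h t + task_mean h t * exp (- \<theta>))))"
  have "(\<integral>\<^sup>+ t. ?f t \<partial>env MZ tau0) = (\<integral>\<^sup>+ p. (\<integral>\<^sup>+ s. ?f (fst p, snd p, s) \<partial>(\<Pi>\<^sub>M j\<in>UNIV. fst p)) \<partial>tau0)"
    by (rule nn_integral_env[OF tau0_prob tau0_sets]) measurable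
  also have "\<dots> \<le> (\<integral>\<^sup>+ p. (\<integral>\<^sup>+ s. indicator {v} (tsize (fst p, snd p, s)) \<partial>(\<Pi>\<^sub>M j\<in>(UNIV :: nat set). fst p)) \<partial>tau0)"
  proof (rule nn_integral_mono)
    fix p assume "p \<in> space tau0"
    note p = space_tau0D[OF tau0_prob tau0_sets this]
    interpret D: prob_space "fst p" by (rule p)
    interpret P: prob_space "\<Pi>\<^sub>M j\<in>(UNIV :: nat set). fst p" by (intro prob_space_PiM p)
    have hD[measurable]: "h \<in> borel_measurable (fst p)" using h unfolding measurable_cong_sets[OF p(2) refl] .
    define q where "q = (\<integral>z. h z \<partial>fst p)"
    define y where "y = 1 - q + q * exp (- \<theta>)"
    have "0 \<le> q" "q \<le> 1" using D.catoni_jensen(4,5)[OF hD range order_refl] by (auto simp: q_def)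
    then have y: "0 < y" unfolding y_def using \<theta> by (rule bernoulli_laplace_pos)
    show "(\<integral>\<^sup>+ s. ?f (fst p, snd p, s) \<partial>(\<Pi>\<^sub>M j\<in>UNIV. fst p))
      \<le> (\<integral>\<^sup>+ s. indicator {v} (tsize (fst p, snd p, s)) \<partial>(\<Pi>\<^sub>M j\<in>(UNIV :: nat set). fst p))"
    proof (cases "snd p = v")
      case False
      then show ?thesis by (simp add: tsize_def)
    next
      case True
      have yv: "exp (- (real v * ln y)) * y ^ v = 1"
        using y by (simp add: exp_minus exp_of_nat_mult)
      have "(\<integral>\<^sup>+ s. ?f (fst p, snd p, s) \<partial>(\<Pi>\<^sub>M j\<in>UNIV. fst p))
        = (\<integral>\<^sup>+ s. ennreal (exp (- (real v * ln y))) * ennreal (exp (- \<theta> * (\<Sum>j<v. h (s j)))) \<partial>(\<Pi>\<^sub>M j\<in>UNIV. fst p))"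
      proof (rule nn_integral_cong)
        fix s
        have "exp (- \<theta> * task_sum h (fst p, snd p, s) - real v * ln (1 - task_mean h (fst p, snd p, s) + task_mean h (fst p, snd p, s) * exp (- \<theta>)))
          = exp (- (real v * ln y)) * exp (- \<theta> * (\<Sum>j<v. h (s j)))"
          unfolding task_sum_pair task_mean_pair q_def[symmetric] y_def[symmetric] True
          by (simp add: exp_add[symmetric])
        then show "?f (fst p, snd p, s) = ennreal (exp (- (real v * ln y))) * ennreal (exp (- \<theta> * (\<Sum>j<v. h (s j))))"
          by (simp add: ennreal_mult tsize_def True)
      qed
      also have "\<dots> = ennreal (exp (- (real v * ln y))) * (\<integral>\<^sup>+ s. ennreal (exp (- \<theta> * (\<Sum>j<v. h (s j)))) \<partial>(\<Pi>\<^sub>M j\<in>UNIV. fst p))"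
      proof (rule nn_integral_cmult)
        have "(\<lambda>s. h (s j)) \<in> borel_measurable (\<Pi>\<^sub>M j\<in>UNIV. fst p)" for j
          by (rule measurable_PiM_component_compose[OF _ hD]) simp
        then show "(\<lambda>s. ennreal (exp (- \<theta> * (\<Sum>j<v. h (s j))))) \<in> borel_measurable (\<Pi>\<^sub>M j\<in>UNIV. fst p)"
          by measurable
      qed
      also have "\<dots> \<le> ennreal (exp (- (real v * ln y))) * ennreal (y ^ v)"
        unfolding y_def q_def by (intro mult_left_mono nn_integral_iid_exp_sum_le p hD range) auto
      also have "\<dots> = 1" using yv y by (simp add: ennreal_mult[symmetric])
      also have "\<dots> = (\<integral>\<^sup>+ s. indicator {v} (tsize (fst p, snd p, s)) \<partial>(\<Pi>\<^sub>M j\<in>(UNIV :: nat set). fst p))"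
        using True P.emeasure_space_1 by (simp add: tsize_def)
      finally show ?thesis .
    qed
  qed
  also have "\<dots> = (\<integral>\<^sup>+ t. indicator {v} (tsize t) \<partial>env MZ tau0)"
    by (rule nn_integral_env[OF tau0_prob tau0_sets ind, symmetric])
  also have "\<dots> = (\<integral>\<^sup>+ t. indicator {t \<in> space (env MZ tau0). tsize t = v} t \<partial>env MZ tau0)"
    by (intro nn_integral_cong) (auto simp: indicator_def)
  also have "\<dots> = emeasure (env MZ tau0) {t \<in> space (env MZ tau0). tsize t = v}"
  proof (rule nn_integral_indicator)
    have "tsize -` {v} \<inter> space (env MZ tau0) \<in> sets (env MZ tau0)"
      using measurable_sets[of tsize "env MZ tau0" "count_space UNIV" "{v}"] measurable_tsize[of MZ]
      unfolding measurable_cong_sets[OF env refl] by simp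
    then show "{t \<in> space (env MZ tau0). tsize t = v} \<in> sets (env MZ tau0)"
      by (simp add: vimage_def Int_def conj_commute)
  qed
  finally show ?thesis .
qed

lemma prob_space_train: "prob_space (train_space n (env MZ tau0))"
  unfolding train_space_def using prob_space_env[OF tau0_prob tau0_sets] by (intro prob_space_PiM)

lemma sets_train: "sets (train_space n (env MZ tau0)) = sets (\<Pi>\<^sub>M i\<in>{..<n}. task_space MZ)"
  unfolding train_space_def using sets_env[OF tau0_prob tau0_sets] by (intro sets_PiM_cong) auto

lemma AE_train_tsize: "AE w in train_space n (env MZ tau0). \<forall>i<n. tsize (w i) \<in> S"
proof -
  interpret E: prob_space "env MZ tau0" by (rule prob_space_env[OF tau0_prob tau0_sets])
  interpret P: product_prob_space "\<lambda>_. env MZ tau0" "{..<n}" by unfold_locales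
  have "AE w in train_space n (env MZ tau0). \<forall>i\<in>{..<n}. tsize (w i) \<in> S"
    unfolding train_space_def by (intro AE_finite_allI) (auto intro: P.AE_component AE_env_tsize)
  then show ?thesis by eventually_elim auto
qed

text \<open>The total sample size couples the tasks, so the expectation is split according to the
  vector \<open>v\<close> of sample sizes; given \<open>v\<close>, the integrand is a product over the tasks.\<close>

lemma train_task_gap_moment:
  assumes S: "finite S" and H: "\<And>i. i < n \<Longrightarrow> H i \<in> borel_measurable MZ"
    and range: "\<And>i z. 0 \<le> H i z \<and> H i z \<le> 1" and lam: "0 \<le> lam"
  shows "(\<integral>\<^sup>+ w. ennreal (exp (task_gap lam n H w)) \<partial>train_space n (env MZ tau0)) \<le> 1"
proof -
  let ?W = "train_space n (env MZ tau0)" and ?E = "env MZ tau0"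
  note env = sets_env[OF tau0_prob tau0_sets]
  interpret E: prob_space "env MZ tau0" by (rule prob_space_env[OF tau0_prob tau0_sets])
  interpret P: product_prob_space "\<lambda>_. env MZ tau0" "{..<n}" by unfold_locales
  define \<theta> where "\<theta> v = lam / real (\<Sum>i<n. v i)" for v :: "nat \<Rightarrow> nat"
  define Y where "Y v i t = indicator {v i} (tsize t) * ennreal (exp (- \<theta> v * task_sum (H i) t
      - real (v i) * ln (1 - task_mean (H i) t + task_mean (H i) t * exp (- \<theta> v))))" for v i t
  define V where "V = (\<Pi>\<^sub>E i\<in>{..<n}. S)"
  have V: "finite V" unfolding V_def using S by (intro finite_PiE) auto
  have \<theta>0: "0 \<le> \<theta> v" for v unfolding \<theta>_def using lam by (intro divide_nonneg_nonneg of_nat_0_le_iff)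
  have Ym: "Y v i \<in> borel_measurable (env MZ tau0)" if i: "i < n" for v i
  proof -
    have hx: "(\<lambda>(x, z). H i z) \<in> borel_measurable (task_space MZ \<Otimes>\<^sub>M MZ)"
      using measurable_compose[OF measurable_snd H[OF i]] by (simp add: case_prod_beta')
    have [measurable]: "task_sum (H i) \<in> borel_measurable (task_space MZ)" "task_mean (H i) \<in> borel_measurable (task_space MZ)"
      using measurable_task_sum[OF measurable_ident_sets[OF refl] hx] measurable_task_mean[OF measurable_ident_sets[OF refl] hx]
      by simp_all
    have [measurable]: "(\<lambda>t. indicator {v i} (tsize t) :: ennreal) \<in> borel_measurable (task_space MZ)"
      using measurable_compose[OF measurable_tsize, of "indicator {v i}" borel] by simp
    show ?thesis unfolding measurable_cong_sets[OF env refl] Y_def by measurable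
  qed
  have "(\<integral>\<^sup>+ w. ennreal (exp (task_gap lam n H w)) \<partial>?W)
    \<le> (\<integral>\<^sup>+ w. (\<Sum>v\<in>V. \<Prod>i<n. Y v i (w i)) \<partial>?W)"
  proof (rule nn_integral_mono_AE)
    show "AE w in ?W. ennreal (exp (task_gap lam n H w)) \<le> (\<Sum>v\<in>V. \<Prod>i<n. Y v i (w i))"
      using AE_train_tsize AE_space
    proof eventually_elim
      case (elim w)
      define v where "v = restrict (\<lambda>i. tsize (w i)) {..<n}"
      have vV: "v \<in> V" using elim by (auto simp: v_def V_def)
      have vi: "v i = tsize (w i)" if "i < n" for i using that by (simp add: v_def)
      have N: "(\<Sum>i<n. v i) = totalM n w" by (simp add: totalM_def vi)
      have \<theta>v: "\<theta> v = lam / real (totalM n w)" by (simp add: \<theta>_def N)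
      have wi: "w i \<in> space (task_space MZ)" if "i < n" for i
        using elim(2) that sets_eq_imp_space_eq[OF env] by (auto simp: train_space_def space_PiM)
      have "catoni (totalM n w) lam ((\<Sum>i<n. real (tsize (w i)) * task_mean (H i) (w i)) / real (totalM n w))
        \<le> (\<Sum>i<n. - real (tsize (w i)) * ln (1 - task_mean (H i) (w i) + task_mean (H i) (w i) * exp (- lam / real (totalM n w))))"
        by (rule catoni_weighted_jensen) (use task_mean_range[OF wi H range] lam in \<open>auto simp: totalM_def\<close>)
      then have "task_gap lam n H w \<le> (\<Sum>i<n. - \<theta> v * task_sum (H i) (w i)
          - real (v i) * ln (1 - task_mean (H i) (w i) + task_mean (H i) (w i) * exp (- \<theta> v)))"
        unfolding task_gap_def \<theta>v by (simp add: vi sum_subtractf sum_negf sum_distrib_left sum_divide_distrib)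
      then have "ennreal (exp (task_gap lam n H w)) \<le> ennreal (exp (\<Sum>i<n. - \<theta> v * task_sum (H i) (w i)
          - real (v i) * ln (1 - task_mean (H i) (w i) + task_mean (H i) (w i) * exp (- \<theta> v))))"
        by (intro ennreal_leI) simp
      also have "\<dots> = (\<Prod>i<n. Y v i (w i))"
        by (simp add: exp_sum Y_def vi prod_ennreal[symmetric])
      \<comment> \<open>The left side is the summand of the actual size vector. Summing over the
        finitely many possible vectors gives a majorant in which each rate \<open>\<theta> v\<close>
        is a constant.\<close>
      also have "\<dots> \<le> (\<Sum>v\<in>V. \<Prod>i<n. Y v i (w i))"
        using vV V by (intro member_le_sum) auto
      finally show ?case .
    qed
  qed
  also have "\<dots> = (\<Sum>v\<in>V. \<integral>\<^sup>+ w. (\<Prod>i<n. Y v i (w i)) \<partial>?W)"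
  proof (rule nn_integral_sum)
    fix v
    have "(\<lambda>w. Y v i (w i)) \<in> borel_measurable (?W)" if "i < n" for i
      unfolding train_space_def using that
      by (intro measurable_PiM_component_compose Ym) auto
    then show "(\<lambda>w. \<Prod>i<n. Y v i (w i)) \<in> borel_measurable (?W)"
      by (intro borel_measurable_prod_ennreal) simp
  qed
  also have "\<dots> = (\<Sum>v\<in>V. \<Prod>i<n. \<integral>\<^sup>+ t. Y v i t \<partial>?E)"
    unfolding train_space_def using Ym by (intro sum.cong refl P.product_nn_integral_prod) auto
  also have "\<dots> \<le> (\<Sum>v\<in>V. \<Prod>i<n. emeasure ?E {t \<in> space ?E. tsize t = v i})"
    unfolding Y_def by (intro sum_mono prod_mono_ennreal single_task_moment H range \<theta>0) auto
  \<comment> \<open>Distributivity: the sum over all size vectors of products is the product over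
    the tasks of their total size probabilities, each at most 1.\<close>
  also have "\<dots> = (\<Prod>i<n. \<Sum>m\<in>S. emeasure ?E {t \<in> space ?E. tsize t = m})"
    unfolding V_def using S by (subst prod_sum_PiE) auto
  also have "\<dots> \<le> (\<Prod>i<n. 1)"
  proof (rule prod_mono_ennreal)
    fix i
    have "{t \<in> space ?E. tsize t = m} \<in> sets ?E" for m
    proof -
      have "tsize -` {m} \<inter> space ?E \<in> sets ?E"
        using measurable_sets[of tsize "env MZ tau0" "count_space UNIV" "{m}"] measurable_tsize[of MZ]
        unfolding measurable_cong_sets[OF env refl] by simp
      then show ?thesis by (simp add: vimage_def Int_def conj_commute)
    qed
    then have "(\<Sum>m\<in>S. emeasure ?E {t \<in> space ?E. tsize t = m})
      = emeasure ?E (\<Union>m\<in>S. {t \<in> space ?E. tsize t = m})"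
      using S by (intro sum_emeasure) (auto simp: disjoint_family_on_def)
    also have "\<dots> \<le> 1" by (rule E.emeasure_le_1)
    finally show "(\<Sum>m\<in>S. emeasure ?E {t \<in> space ?E. tsize t = m}) \<le> 1" .
  qed
  finally show ?thesis by simp
qed

text \<open>The number of summands is the fixed \<open>n\<close>, so independence of the tasks
  applies directly: the \<open>n\<close>-th power of the Bernoulli transform cancels the exponential
  of \<open>catoni\<close>.\<close>

lemma train_iid_moment:
  assumes Y: "Y \<in> borel_measurable (env MZ tau0)"
    and range: "AE t in env MZ tau0. 0 \<le> Y t \<and> Y t \<le> 1" and lam: "0 \<le> lam"
  shows "(\<integral>\<^sup>+ w. ennreal (exp (catoni n lam (\<integral>t. Y t \<partial>env MZ tau0) - lam / real n * (\<Sum>i<n. Y (w i))))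
    \<partial>train_space n (env MZ tau0)) \<le> 1"
proof -
  let ?W = "train_space n (env MZ tau0)"
  interpret E: prob_space "env MZ tau0" by (rule prob_space_env[OF tau0_prob tau0_sets])
  interpret P: product_prob_space "\<lambda>_. env MZ tau0" "{..<n}" by unfold_locales
  define \<theta> where "\<theta> = lam / real n"
  define R where "R = (\<integral>t. Y t \<partial>env MZ tau0)"
  have int: "integrable (env MZ tau0) Y" using range Y by (intro E.integrable_const_bound[where B=1]) auto
  have R0: "0 \<le> R" unfolding R_def using range by (intro integral_nonneg_AE) auto
  have "R \<le> (\<integral>t. 1 \<partial>env MZ tau0)"
    unfolding R_def using range int by (intro integral_mono_AE) auto
  then have R1: "R \<le> 1" by (simp add: E.prob_space)
  define y where "y = 1 - R + R * exp (- \<theta>)"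
  have y: "0 < y" unfolding y_def using R0 R1 lam by (intro bernoulli_laplace_pos) (auto simp: \<theta>_def)
  have cat: "exp (catoni n lam R) * y ^ n = 1"
  proof -
    have "catoni n lam R = - (real n * ln y)" by (simp add: catoni_def y_def \<theta>_def)
    then show ?thesis using y by (simp add: exp_minus exp_of_nat_mult)
  qed
  have Yi: "(\<lambda>w. Y (w i)) \<in> borel_measurable (?W)" if "i < n" for i
    unfolding train_space_def using that by (intro measurable_PiM_component_compose Y) auto
  have "(\<integral>\<^sup>+ w. ennreal (exp (catoni n lam R - \<theta> * (\<Sum>i<n. Y (w i)))) \<partial>?W)
    = (\<integral>\<^sup>+ w. ennreal (exp (catoni n lam R)) * (\<Prod>i<n. ennreal (exp (- \<theta> * Y (w i)))) \<partial>?W)"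
  proof (rule nn_integral_cong)
    fix w
    have "exp (catoni n lam R - \<theta> * (\<Sum>i<n. Y (w i))) = exp (catoni n lam R) * (\<Prod>i<n. exp (- \<theta> * Y (w i)))"
      by (simp add: exp_sum[symmetric] exp_add[symmetric] sum_distrib_left sum_negf)
    then show "ennreal (exp (catoni n lam R - \<theta> * (\<Sum>i<n. Y (w i))))
      = ennreal (exp (catoni n lam R)) * (\<Prod>i<n. ennreal (exp (- \<theta> * Y (w i))))"
      by (simp add: ennreal_mult prod_nonneg prod_ennreal)
  qed
  also have "\<dots> = ennreal (exp (catoni n lam R)) * (\<integral>\<^sup>+ w. (\<Prod>i<n. ennreal (exp (- \<theta> * Y (w i)))) \<partial>?W)"
    by (intro nn_integral_cmult borel_measurable_prod_ennreal measurable_compose[OF _ measurable_ennreal]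
      measurable_compose[OF _ borel_measurable_exp] borel_measurable_times Yi) auto
  also have "(\<integral>\<^sup>+ w. (\<Prod>i<n. ennreal (exp (- \<theta> * Y (w i)))) \<partial>?W)
    = (\<Prod>i<n. \<integral>\<^sup>+ t. ennreal (exp (- \<theta> * Y t)) \<partial>env MZ tau0)"
    unfolding train_space_def using Y by (intro P.product_nn_integral_prod) auto
  also have "\<dots> \<le> (\<Prod>i<n. ennreal y)"
    unfolding y_def R_def using E.nn_integral_exp_minus_le[OF Y range] by (intro prod_mono_ennreal) auto
  also have "\<dots> = ennreal (y ^ n)" using y by (simp add: ennreal_power)
  finally have "(\<integral>\<^sup>+ w. ennreal (exp (catoni n lam R - \<theta> * (\<Sum>i<n. Y (w i)))) \<partial>?W)
    \<le> ennreal (exp (catoni n lam R)) * ennreal (y ^ n)" by (simp add: mult_left_mono)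
  also have "\<dots> = 1" using cat y by (simp add: ennreal_mult[symmetric])
  finally show ?thesis by (simp add: R_def \<theta>_def)
qed

end

section \<open>Risks and posteriors\<close>

lemma integral_PiM_component:
  fixes f :: "'a \<Rightarrow> real"
  assumes K: "\<And>i. i \<in> I \<Longrightarrow> prob_space (K i)" and i: "i \<in> I" and f: "f \<in> borel_measurable (K i)"
  shows "(\<integral>fs. f (fs i) \<partial>(\<Pi>\<^sub>M i\<in>I. K i)) = (\<integral>x. f x \<partial>K i)"
proof -
  define K' where "K' j = (if j \<in> I then K j else K i)" for j
  have PK: "(\<Pi>\<^sub>M i\<in>I. K i) = (\<Pi>\<^sub>M i\<in>I. K' i)" by (intro PiM_cong) (auto simp: K'_def)
  interpret K': prob_space "K' j" for j using K i by (simp add: K'_def)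
  interpret P: product_prob_space K' I by unfold_locales
  have Ki: "K' i = K i" using i by (simp add: K'_def)
  have "(\<integral>x. f x \<partial>K i) = (\<integral>x. f x \<partial>distr (\<Pi>\<^sub>M i\<in>I. K' i) (K' i) (\<lambda>\<omega>. \<omega> i))"
    using P.PiM_component[OF i] Ki by simp
  also have "\<dots> = (\<integral>fs. f (fs i) \<partial>(\<Pi>\<^sub>M i\<in>I. K' i))"
    using i f Ki by (intro integral_distr measurable_component_singleton) auto
  finally show ?thesis by (simp add: PK)
qed

lemma lossQ_range:
  assumes "prob_space Q" and "\<And>f z. 0 \<le> l f z \<and> l f z \<le> 1"
  shows "0 \<le> lossQ l z Q \<and> lossQ l z Q \<le> 1"
proof -
  interpret prob_space Q by fact
  \<comment> \<open>A section that is not integrable has integral 0 by convention, so the bound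
    holds for every \<open>z\<close>, also outside the sample space.\<close>
  have "(\<integral>f. l f z \<partial>Q) \<le> 1"
  proof (cases "integrable Q (\<lambda>f. l f z)")
    case True
    then have "(\<integral>f. l f z \<partial>Q) \<le> (\<integral>f. 1 \<partial>Q)" using assms(2) by (intro integral_mono) auto
    then show ?thesis by (simp add: prob_space)
  qed (simp add: not_integrable_integral_eq)
  then show ?thesis using assms(2) by (auto simp: lossQ_def)
qed

lemma task_sum_range:
  assumes "\<And>z. 0 \<le> h z \<and> h z \<le> 1"
  shows "0 \<le> task_sum h t" "task_sum h t \<le> real (tsize t)"
proof -
  show "0 \<le> task_sum h t" unfolding task_sum_def sum_list_dataset using assms by (intro sum_nonneg) auto
  have "task_sum h t \<le> (\<Sum>j<tsize t. 1)"
    unfolding task_sum_def sum_list_dataset using assms by (intro sum_mono) auto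
  then show "task_sum h t \<le> real (tsize t)" by simp
qed

lemma weighted_mean_range:
  assumes "\<And>i. i < n \<Longrightarrow> 0 \<le> q i" "\<And>i. i < n \<Longrightarrow> q i \<le> real (tsize (w i))"
  shows "0 \<le> (\<Sum>i<n. q i) / real (totalM n w)" "(\<Sum>i<n. q i) / real (totalM n w) \<le> 1"
proof -
  show "0 \<le> (\<Sum>i<n. q i) / real (totalM n w)" using assms(1) by (intro divide_nonneg_nonneg sum_nonneg) auto
  have "(\<Sum>i<n. q i) \<le> real (totalM n w)" unfolding totalM_def of_nat_sum using assms(2) by (intro sum_mono) auto
  then show "(\<Sum>i<n. q i) / real (totalM n w) \<le> 1" by (simp add: divide_le_eq)
qed

text \<open>Markov at the threshold \<open>2 / \<delta>\<close>: two such events share the failure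
  probability \<open>\<delta>\<close>, and the logarithm of the threshold is the constant in both
  levels of the bound.\<close>

lemma (in prob_space) markov_half:
  assumes u: "u \<in> borel_measurable M" and le: "(\<integral>\<^sup>+ x. u x \<partial>M) \<le> 1" and \<delta>: "0 < \<delta>"
  shows "prob {x \<in> space M. \<not> u x \<le> ennreal (2 / \<delta>)} \<le> \<delta> / 2"
proof -
  have "emeasure M {x \<in> space M. \<not> u x \<le> ennreal (2 / \<delta>)} \<le> emeasure M ({x \<in> space M. 1 \<le> ennreal (\<delta> / 2) * u x})"
  proof (rule emeasure_mono)
    show "{x \<in> space M. \<not> u x \<le> ennreal (2 / \<delta>)} \<subseteq> {x \<in> space M. 1 \<le> ennreal (\<delta> / 2) * u x}"
    proof safe
      fix x assume "\<not> u x \<le> ennreal (2 / \<delta>)"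
      then have "ennreal (\<delta> / 2) * ennreal (2 / \<delta>) \<le> ennreal (\<delta> / 2) * u x"
        by (intro mult_left_mono) auto
      then show "1 \<le> ennreal (\<delta> / 2) * u x" using \<delta> by (simp add: ennreal_mult[symmetric])
    qed
  qed (use u in measurable)
  also have "\<dots> \<le> ennreal (\<delta> / 2) * (\<integral>\<^sup>+ x. u x * indicator (space M) x \<partial>M)"
    using nn_integral_Markov_inequality[of u "space M" M "ennreal (\<delta> / 2)"] u by simp
  also have "\<dots> = ennreal (\<delta> / 2) * (\<integral>\<^sup>+ x. u x \<partial>M)"
    by (intro arg_cong2[where f="(*)"] refl nn_integral_cong) simp
  also have "\<dots> \<le> ennreal (\<delta> / 2) * 1" using le by (intro mult_left_mono) auto
  finally show ?thesis using \<delta> by (simp add: emeasure_eq_measure)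
qed

locale meta_learning =
  fixes MZ :: "'z measure" and MF :: "'f measure" and MA :: "'a measure"
    and l :: "'f \<Rightarrow> 'z \<Rightarrow> real"
    and alg :: "'a \<Rightarrow> 'z list \<Rightarrow> 'f measure"
    and tau0 :: "('z measure \<times> nat) measure"
    and mmax n :: nat
    and piM :: "'a measure"
    and PP :: "'a \<Rightarrow> 'f measure measure"
  assumes l_meas: "(\<lambda>(f, z). l f z) \<in> borel_measurable (MF \<Otimes>\<^sub>M MZ)"
    and l_range: "\<And>f z. 0 \<le> l f z \<and> l f z \<le> 1"
    and alg_meas: "\<And>m. (\<lambda>(A, s). alg A (map s [0..<m]))
                        \<in> MA \<Otimes>\<^sub>M (\<Pi>\<^sub>M j\<in>UNIV. MZ) \<rightarrow>\<^sub>M prob_algebra MF"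
    and tau0_prob: "prob_space tau0"
    and tau0_sets: "sets tau0 = sets (prob_algebra MZ \<Otimes>\<^sub>M count_space {1..mmax})"
    and pi_prob: "prob_space piM" and pi_sets: "sets piM = sets MA"
    and PP_prob: "\<And>A. A \<in> space MA \<Longrightarrow> prob_space (PP A)"
    and PP_sets: "\<And>A. A \<in> space MA \<Longrightarrow> sets (PP A) = sets (prob_algebra MF)"
begin

abbreviation "FS \<equiv> \<Pi>\<^sub>M i\<in>{..<n}. MF"
abbreviation "TS \<equiv> task_space MZ"
abbreviation "WS \<equiv> \<Pi>\<^sub>M i\<in>{..<n}. task_space MZ"

definition "task_risk A t = task_mean (\<lambda>z. lossQ l z (alg A (dataset t))) t"
definition "task_emp A t = task_sum (\<lambda>z. lossQ l z (alg A (dataset t))) t"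

lemma alg_dataset_meas: "(\<lambda>p. alg (fst p) (dataset (snd p))) \<in> MA \<Otimes>\<^sub>M TS \<rightarrow>\<^sub>M prob_algebra MF"
  unfolding dataset_eq
proof (rule measurable_size_cases[OF measurable_snd,
    of "\<lambda>m p. alg (fst p) (map (snd (snd (snd p))) [0..<m])"])
  fix m
  have "(\<lambda>p. (fst p, snd (snd (snd p)))) \<in> MA \<Otimes>\<^sub>M TS \<rightarrow>\<^sub>M MA \<Otimes>\<^sub>M (\<Pi>\<^sub>M j\<in>UNIV. MZ)"
    by (intro measurable_Pair measurable_fst measurable_compose[OF measurable_snd measurable_task_sample])
  from measurable_compose[OF this alg_meas[of m]]
  show "(\<lambda>p. alg (fst p) (map (snd (snd (snd p))) [0..<m])) \<in> MA \<Otimes>\<^sub>M TS \<rightarrow>\<^sub>M prob_algebra MF"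
    by simp
qed

lemma alg_dataset:
  assumes "A \<in> space MA" "t \<in> space TS"
  shows "prob_space (alg A (dataset t))" "sets (alg A (dataset t)) = sets MF"
  using measurable_space[OF alg_dataset_meas, of "(A, t)"] assms
  by (auto simp: space_pair_measure space_prob_algebra)

lemma lossQ_meas:
  "(\<lambda>(p, z). lossQ l z (alg (fst p) (dataset (snd p)))) \<in> borel_measurable ((MA \<Otimes>\<^sub>M TS) \<Otimes>\<^sub>M MZ)"
proof -
  have "(\<lambda>q. (snd q, snd (fst q))) \<in> ((MA \<Otimes>\<^sub>M TS) \<Otimes>\<^sub>M MZ) \<Otimes>\<^sub>M MF \<rightarrow>\<^sub>M MF \<Otimes>\<^sub>M MZ"
    by (intro measurable_Pair measurable_snd measurable_compose[OF measurable_fst measurable_snd])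
  from measurable_compose[OF this l_meas]
  have l': "(\<lambda>(q, f). l f (snd q)) \<in> borel_measurable (((MA \<Otimes>\<^sub>M TS) \<Otimes>\<^sub>M MZ) \<Otimes>\<^sub>M MF)"
    by (simp add: case_prod_beta')
  have "(\<lambda>q. \<integral>f. l f (snd q) \<partial>alg (fst (fst q)) (dataset (snd (fst q)))) \<in> borel_measurable ((MA \<Otimes>\<^sub>M TS) \<Otimes>\<^sub>M MZ)"
    by (rule measurable_integral_kernel[OF l'
      measurable_prob_algebraD[OF measurable_compose[OF measurable_fst alg_dataset_meas]]])
  then show ?thesis by (simp add: lossQ_def case_prod_beta')
qed

lemma lossQ_section_meas:
  assumes "A \<in> space MA" "t \<in> space TS"
  shows "(\<lambda>z. lossQ l z (alg A (dataset t))) \<in> borel_measurable MZ"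
  using measurable_compose[OF measurable_Pair1'[of "(A, t)" "MA \<Otimes>\<^sub>M TS" MZ] lossQ_meas] assms
  by (simp add: space_pair_measure)

lemma task_risk_meas: "(\<lambda>p. task_risk (fst p) (snd p)) \<in> borel_measurable (MA \<Otimes>\<^sub>M TS)"
  unfolding task_risk_def using measurable_task_mean[OF measurable_snd lossQ_meas] .

lemma task_emp_meas: "(\<lambda>p. task_emp (fst p) (snd p)) \<in> borel_measurable (MA \<Otimes>\<^sub>M TS)"
  unfolding task_emp_def using measurable_task_sum[OF measurable_snd lossQ_meas] .

lemma section_meas:
  assumes f: "(\<lambda>p. f (fst p) (snd p)) \<in> borel_measurable (MA \<Otimes>\<^sub>M TS)" and t: "t \<in> space TS"
  shows "(\<lambda>A. f A t) \<in> borel_measurable MA"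
  using measurable_compose[OF measurable_Pair2'[OF t] f] by simp

lemma task_risk_range:
  assumes "A \<in> space MA" "t \<in> space TS"
  shows "0 \<le> task_risk A t" "task_risk A t \<le> 1"
  unfolding task_risk_def
  using task_mean_range[OF assms(2) lossQ_section_meas[OF assms] lossQ_range[OF alg_dataset(1)[OF assms] l_range]]
  by auto

lemma task_emp_range:
  assumes "A \<in> space MA" "t \<in> space TS"
  shows "0 \<le> task_emp A t" "task_emp A t \<le> real (tsize t)"
proof -
  have "0 \<le> lossQ l z (alg A (dataset t)) \<and> lossQ l z (alg A (dataset t)) \<le> 1" for z
    by (rule lossQ_range[OF alg_dataset(1)[OF assms] l_range])
  from task_sum_range[of "\<lambda>z. lossQ l z (alg A (dataset t))" t, OF this]
  show "0 \<le> task_emp A t" "task_emp A t \<le> real (tsize t)"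
    unfolding task_emp_def .
qed

lemma task_component:
  "w \<in> space WS \<Longrightarrow> i < n \<Longrightarrow> w i \<in> space TS"
  by (auto simp: space_PiM)

lemma sample_component: "t \<in> space TS \<Longrightarrow> snd (snd t) j \<in> space MZ"
  by (rule measurable_space[OF measurable_task_sample_component])

lemma task_distribution: "t \<in> space TS \<Longrightarrow> prob_space (fst t)" "t \<in> space TS \<Longrightarrow> sets (fst t) = sets MZ"
  using measurable_space[OF measurable_task_distribution, of t MZ] unfolding space_prob_algebra by blast+

lemma l_section_meas: "f \<in> space MF \<Longrightarrow> (\<lambda>z. l f z) \<in> borel_measurable MZ"
  using measurable_compose[OF measurable_Pair1' l_meas] by simp

lemma l_section_meas': "z \<in> space MZ \<Longrightarrow> (\<lambda>f. l f z) \<in> borel_measurable MF"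
  using measurable_compose[OF measurable_Pair2' l_meas] by simp

text \<open>The hypothesis factor of \<open>frakQ\<close>, with the hyper-posterior left out: the
  losses read only the hypotheses.\<close>

definition "post A w = (\<Pi>\<^sub>M i\<in>{..<n}. alg A (dataset (w i)))"

context
  fixes w assumes w: "w \<in> space WS"
begin

lemma post_meas: "(\<lambda>A. post A w) \<in> MA \<rightarrow>\<^sub>M prob_algebra FS"
  unfolding post_def
proof (rule measurable_PiM_kernel)
  fix i assume "i \<in> {..<n}"
  then have "w i \<in> space TS" using w by (auto intro: task_component)
  from measurable_compose[OF measurable_Pair2'[OF this] alg_dataset_meas]
  show "(\<lambda>A. alg A (dataset (w i))) \<in> MA \<rightarrow>\<^sub>M prob_algebra MF" by simp
qed

lemma post_prob: "A \<in> space MA \<Longrightarrow> prob_space (post A w)" "A \<in> space MA \<Longrightarrow> sets (post A w) = sets FS"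
  using measurable_space[OF post_meas] by (auto simp: space_prob_algebra)

lemma post_task_sum:
  assumes A: "A \<in> space MA" and i: "i < n"
  shows "(\<integral>fs. task_sum (l (fs i)) (w i) \<partial>post A w) = task_emp A (w i)"
    and "(\<lambda>fs. task_sum (l (fs i)) (w i)) \<in> borel_measurable FS"
proof -
  have t: "w i \<in> space TS" using w i by (rule task_component)
  interpret P: prob_space "post A w" using post_prob(1)[OF A] .
  have K: "prob_space (alg A (dataset (w i)))" if "i \<in> {..<n}" for i
    using alg_dataset(1)[OF A task_component[OF w]] that by simp
  have lm: "(\<lambda>f. l f (snd (snd (w i)) j)) \<in> borel_measurable MF" for j
    by (rule l_section_meas'[OF sample_component[OF t]])
  have lm': "(\<lambda>fs. l (fs i) (snd (snd (w i)) j)) \<in> borel_measurable FS" for j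
    using i by (intro measurable_PiM_component_compose lm) auto
  then show "(\<lambda>fs. task_sum (l (fs i)) (w i)) \<in> borel_measurable FS"
    unfolding task_sum_def sum_list_dataset by (intro borel_measurable_sum)
  have int: "integrable (post A w) (\<lambda>fs. l (fs i) (snd (snd (w i)) j))" for j
    using lm'[of j] l_range unfolding measurable_cong_sets[OF post_prob(2)[OF A, symmetric] refl]
    by (intro P.integrable_const_bound[where B=1]) auto
  have "(\<integral>fs. task_sum (l (fs i)) (w i) \<partial>post A w)
    = (\<Sum>j<tsize (w i). \<integral>fs. l (fs i) (snd (snd (w i)) j) \<partial>post A w)"
    unfolding task_sum_def sum_list_dataset using int by (rule Bochner_Integration.integral_sum)
  also have "\<dots> = (\<Sum>j<tsize (w i). \<integral>f. l f (snd (snd (w i)) j) \<partial>alg A (dataset (w i)))"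
    unfolding post_def using K i lm unfolding measurable_cong_sets[OF alg_dataset(2)[OF A t, symmetric] refl]
    by (intro sum.cong refl integral_PiM_component) auto
  finally show "(\<integral>fs. task_sum (l (fs i)) (w i) \<partial>post A w) = task_emp A (w i)"
    by (simp add: task_emp_def task_sum_def sum_list_dataset lossQ_def)
qed

text \<open>Fubini exchanges the draw of the hypothesis with that of the fresh sample, so averaging
  the risks of single hypotheses gives the risk of the posterior.\<close>

lemma post_task_mean:
  assumes A: "A \<in> space MA" and i: "i < n"
  shows "(\<integral>fs. task_mean (l (fs i)) (w i) \<partial>post A w) = task_risk A (w i)"
    and "(\<lambda>fs. task_mean (l (fs i)) (w i)) \<in> borel_measurable FS"
proof -
  have t: "w i \<in> space TS" using w i by (rule task_component)
  have K: "prob_space (alg A (dataset (w i)))" if "i \<in> {..<n}" for i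
    using alg_dataset(1)[OF A task_component[OF w]] that by simp
  interpret K: prob_space "alg A (dataset (w i))" using K i by simp
  interpret D: prob_space "fst (w i)" using task_distribution(1)[OF t] .
  interpret KD: pair_prob_space "alg A (dataset (w i))" "fst (w i)" by unfold_locales
  have m: "(\<lambda>f. task_mean (l f) (w i)) \<in> borel_measurable MF"
    by (rule measurable_task_mean[OF measurable_const[OF t] l_meas])
  then show "(\<lambda>fs. task_mean (l (fs i)) (w i)) \<in> borel_measurable FS"
    using i by (intro measurable_PiM_component_compose) auto
  have "sets (alg A (dataset (w i)) \<Otimes>\<^sub>M fst (w i)) = sets (MF \<Otimes>\<^sub>M MZ)"
    by (intro sets_pair_measure_cong alg_dataset(2) A t task_distribution(2))
  then have "(\<lambda>(f, z). l f z) \<in> borel_measurable (alg A (dataset (w i)) \<Otimes>\<^sub>M fst (w i))"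
    using l_meas measurable_cong_sets by blast
  then have int: "integrable (alg A (dataset (w i)) \<Otimes>\<^sub>M fst (w i)) (\<lambda>(f, z). l f z)"
    using l_range by (intro KD.integrable_const_bound[where B=1]) auto
  have "(\<integral>fs. task_mean (l (fs i)) (w i) \<partial>post A w) = (\<integral>f. task_mean (l f) (w i) \<partial>alg A (dataset (w i)))"
    unfolding post_def using K i m unfolding measurable_cong_sets[OF alg_dataset(2)[OF A t, symmetric] refl]
    by (intro integral_PiM_component[where f="\<lambda>f. task_mean (l f) (w i)"]) auto
  also have "\<dots> = (\<integral>z. (\<integral>f. l f z \<partial>alg A (dataset (w i))) \<partial>fst (w i))"
    unfolding task_mean_def by (rule KD.Fubini_integral[OF int, symmetric])
  finally show "(\<integral>fs. task_mean (l (fs i)) (w i) \<partial>post A w) = task_risk A (w i)"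
    by (simp add: task_risk_def task_mean_def lossQ_def)
qed

text \<open>The empirical part is linear and averages exactly; the Catoni part is lowered by Jensen
  when the mean moves inside.\<close>

lemma post_task_gap:
  assumes A: "A \<in> space MA" and lam: "0 \<le> lam"
  shows "catoni (totalM n w) lam ((\<Sum>i<n. real (tsize (w i)) * task_risk A (w i)) / real (totalM n w))
      - lam * ((\<Sum>i<n. task_emp A (w i)) / real (totalM n w))
    \<le> (\<integral>fs. task_gap lam n (\<lambda>i. l (fs i)) w \<partial>post A w)"
proof -
  interpret P: prob_space "post A w" using post_prob(1)[OF A] .
  let ?p = "\<lambda>fs. (\<Sum>i<n. real (tsize (w i)) * task_mean (l (fs i)) (w i)) / real (totalM n w)"
  let ?s = "\<lambda>fs. (\<Sum>i<n. task_sum (l (fs i)) (w i)) / real (totalM n w)"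
  have mm: "(\<lambda>fs. task_mean (l (fs i)) (w i)) \<in> borel_measurable (post A w)" if "i < n" for i
    using post_task_mean(2)[OF A that] unfolding measurable_cong_sets[OF post_prob(2)[OF A] refl] .
  have sm: "(\<lambda>fs. task_sum (l (fs i)) (w i)) \<in> borel_measurable (post A w)" if "i < n" for i
    using post_task_sum(2)[OF A that] unfolding measurable_cong_sets[OF post_prob(2)[OF A] refl] .
  have fsi: "fs i \<in> space MF" if "fs \<in> space (post A w)" "i < n" for fs i
    using that sets_eq_imp_space_eq[OF post_prob(2)[OF A]] by (auto simp: space_PiM)
  have mr: "0 \<le> task_mean (l (fs i)) (w i) \<and> task_mean (l (fs i)) (w i) \<le> 1" if "fs \<in> space (post A w)" "i < n" for fs i
    using task_mean_range[OF task_component[OF w that(2)] l_section_meas[OF fsi[OF that]] l_range] by simp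
  have pm: "?p \<in> borel_measurable (post A w)"
    using mm by (intro borel_measurable_divide borel_measurable_sum borel_measurable_times) auto
  have pr: "0 \<le> ?p fs \<and> ?p fs \<le> 1" if "fs \<in> space (post A w)" for fs
    using mr[OF that] by (intro conjI weighted_mean_range mult_nonneg_nonneg) (auto intro: mult_left_le)
  have J1: "catoni (totalM n w) lam (\<integral>fs. ?p fs \<partial>post A w) \<le> (\<integral>fs. catoni (totalM n w) lam (?p fs) \<partial>post A w)"
    by (rule P.catoni_jensen(1)[OF pm _ lam]) (rule pr)
  have J3: "integrable (post A w) (\<lambda>fs. catoni (totalM n w) lam (?p fs))"
    by (rule P.catoni_jensen(3)[OF pm _ lam]) (rule pr)
  have intm: "integrable (post A w) (\<lambda>fs. task_mean (l (fs i)) (w i))" if "i < n" for i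
    using mr that by (intro P.integrable_const_bound[where B=1] mm AE_I2) auto
  have ints: "integrable (post A w) (\<lambda>fs. task_sum (l (fs i)) (w i))" if "i < n" for i
  proof (rule P.integrable_const_bound[where B="real (tsize (w i))"])
    show "AE fs in post A w. norm (task_sum (l (fs i)) (w i)) \<le> real (tsize (w i))"
      using task_sum_range[of "l (fs i)" "w i" for fs] l_range by (intro AE_I2) auto
  qed (rule sm[OF that])
  have Ep: "(\<integral>fs. ?p fs \<partial>post A w) = (\<Sum>i<n. real (tsize (w i)) * task_risk A (w i)) / real (totalM n w)"
  proof -
    have "(\<integral>fs. ?p fs \<partial>post A w) = (\<integral>fs. (\<Sum>i<n. real (tsize (w i)) * task_mean (l (fs i)) (w i)) \<partial>post A w) / real (totalM n w)"
      by simp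
    also have "(\<integral>fs. (\<Sum>i<n. real (tsize (w i)) * task_mean (l (fs i)) (w i)) \<partial>post A w)
      = (\<Sum>i<n. \<integral>fs. real (tsize (w i)) * task_mean (l (fs i)) (w i) \<partial>post A w)"
      using intm by (intro Bochner_Integration.integral_sum integrable_mult_right) auto
    also have "\<dots> = (\<Sum>i<n. real (tsize (w i)) * task_risk A (w i))"
      using post_task_mean(1)[OF A] by (intro sum.cong) auto
    finally show ?thesis .
  qed
  have Es: "(\<integral>fs. ?s fs \<partial>post A w) = (\<Sum>i<n. task_emp A (w i)) / real (totalM n w)"
  proof -
    have "(\<integral>fs. ?s fs \<partial>post A w) = (\<integral>fs. (\<Sum>i<n. task_sum (l (fs i)) (w i)) \<partial>post A w) / real (totalM n w)"
      by simp
    also have "(\<integral>fs. (\<Sum>i<n. task_sum (l (fs i)) (w i)) \<partial>post A w) = (\<Sum>i<n. \<integral>fs. task_sum (l (fs i)) (w i) \<partial>post A w)"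
      using ints by (intro Bochner_Integration.integral_sum) auto
    also have "\<dots> = (\<Sum>i<n. task_emp A (w i))"
      using post_task_sum(1)[OF A] by (intro sum.cong) auto
    finally show ?thesis .
  qed
  have is_int: "integrable (post A w) ?s"
    using ints by (intro integrable_divide Bochner_Integration.integrable_sum) auto
  have "(\<integral>fs. task_gap lam n (\<lambda>i. l (fs i)) w \<partial>post A w)
    = (\<integral>fs. catoni (totalM n w) lam (?p fs) \<partial>post A w) - lam * (\<integral>fs. ?s fs \<partial>post A w)"
    unfolding task_gap_def
    by (subst Bochner_Integration.integral_diff[OF J3 integrable_mult_right[OF is_int]]) simp
  with J1 show ?thesis unfolding Ep Es by linarith
qed

end

end

section \<open>Coded hyper-priors and change of measure for the hypotheses\<close>

context meta_learning
begin

text \<open>The task index joins the sample in the second argument of a single function, so that one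
  code of the whole tuple of hypotheses serves all \<open>n\<close> tasks.\<close>

lemma loss_coding:
  obtains \<iota> :: "(nat \<Rightarrow> 'f) \<Rightarrow> real" and L where "\<iota> \<in> borel_measurable FS" "\<And>fs. 0 \<le> \<iota> fs \<and> \<iota> fs \<le> 1"
    "\<And>i. i < n \<Longrightarrow> (\<lambda>(x, z). L i x z) \<in> borel_measurable (borel \<Otimes>\<^sub>M MZ)"
    "\<And>i x z. 0 \<le> L i x z \<and> L i x z \<le> (1::real)"
    "\<And>fs i z. fs \<in> space FS \<Longrightarrow> i < n \<Longrightarrow> z \<in> space MZ \<Longrightarrow> L i (\<iota> fs) z = l (fs i) z"
proof -
  let ?Z = "count_space {..<n} \<Otimes>\<^sub>M MZ"
  have idx: "(\<lambda>q. fst (snd q)) \<in> FS \<Otimes>\<^sub>M ?Z \<rightarrow>\<^sub>M count_space {..<n}"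
    by (rule measurable_compose[OF measurable_snd measurable_fst])
  have comp: "(\<lambda>q. l (fst q i) (snd (snd q))) \<in> borel_measurable (FS \<Otimes>\<^sub>M ?Z)" if "i \<in> {..<n}" for i
  proof -
    have "(\<lambda>q. fst q i) \<in> FS \<Otimes>\<^sub>M ?Z \<rightarrow>\<^sub>M MF"
      using that measurable_PiM_component_compose[of i "{..<n}" "\<lambda>t. t" MF MF]
      by (intro measurable_compose[OF measurable_fst]) auto
    then have "(\<lambda>q. (fst q i, snd (snd q))) \<in> FS \<Otimes>\<^sub>M ?Z \<rightarrow>\<^sub>M MF \<Otimes>\<^sub>M MZ"
      by (intro measurable_Pair measurable_compose[OF measurable_snd measurable_snd])
    from measurable_compose[OF this l_meas] show ?thesis by simp
  qed
  have "(\<lambda>q. l (fst q (fst (snd q))) (snd (snd q))) \<in> borel_measurable (FS \<Otimes>\<^sub>M ?Z)"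
    by (rule measurable_compose_countable'[of "{..<n}" "\<lambda>i q. l (fst q i) (snd (snd q))", OF comp idx]) auto
  then have "(\<lambda>(fs, iz). l (fs (fst iz)) (snd iz)) \<in> borel_measurable (FS \<Otimes>\<^sub>M ?Z)"
    by (simp add: case_prod_beta')
  from pair_function_factors_through_real[OF this l_range]
  obtain \<iota> :: "(nat \<Rightarrow> 'f) \<Rightarrow> real" and g where \<iota>: "\<iota> \<in> borel_measurable FS" "\<And>fs. 0 \<le> \<iota> fs \<and> \<iota> fs \<le> 1"
    and g: "(\<lambda>(y, z). g y z) \<in> borel_measurable (borel \<Otimes>\<^sub>M ?Z)" "\<And>y z. 0 \<le> g y z \<and> g y z \<le> (1::real)"
    and eq: "\<And>fs z. fs \<in> space FS \<Longrightarrow> z \<in> space ?Z \<Longrightarrow> g (\<iota> fs) z = l (fs (fst z)) (snd z)"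
    by metis
  have "(\<lambda>(x, z). g x (i, z)) \<in> borel_measurable (borel \<Otimes>\<^sub>M MZ)" if "i < n" for i
  proof -
    have "(\<lambda>p. (fst p, (i, snd p))) \<in> borel \<Otimes>\<^sub>M MZ \<rightarrow>\<^sub>M borel \<Otimes>\<^sub>M ?Z"
      using that by (intro measurable_Pair measurable_fst measurable_snd measurable_const) auto
    from measurable_compose[OF this g(1)] show ?thesis by (simp add: case_prod_beta')
  qed
  then show thesis
    using \<iota> g(2) eq by (intro that[of \<iota> "\<lambda>i x z. g x (i, z)"]) (auto simp: space_pair_measure)
qed

lemma frakP_in:
  assumes A: "A \<in> space MA"
  shows "prob_space (frakP MF n PP A)" "sets (frakP MF n PP A) = sets (hyp_space n MF)"
proof -
  have K: "(\<lambda>P. distr (\<Pi>\<^sub>M i\<in>{..<n}. P) (hyp_space n MF) (\<lambda>fs. (P, fs)))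
    \<in> prob_algebra MF \<rightarrow>\<^sub>M prob_algebra (hyp_space n MF)"
  proof (rule measurable_distr_prob_space2)
    show "(\<lambda>P. \<Pi>\<^sub>M i\<in>{..<n}. P) \<in> prob_algebra MF \<rightarrow>\<^sub>M prob_algebra FS"
      by (intro measurable_PiM_kernel measurable_ident_sets refl)
    show "(\<lambda>(x, y). (x, y)) \<in> prob_algebra MF \<Otimes>\<^sub>M FS \<rightarrow>\<^sub>M hyp_space n MF"
      unfolding hyp_space_def by simp
  qed
  have P: "PP A \<in> space (prob_algebra (prob_algebra MF))"
    using PP_prob[OF A] PP_sets[OF A] by (simp add: space_prob_algebra)
  show "prob_space (frakP MF n PP A)" "sets (frakP MF n PP A) = sets (hyp_space n MF)"
    unfolding frakP_def using prob_space_bind'[OF P K] sets_bind'[OF P K] .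
qed

context
  fixes \<iota> :: "(nat \<Rightarrow> 'f) \<Rightarrow> real" and L :: "nat \<Rightarrow> real \<Rightarrow> 'z \<Rightarrow> real"
  assumes \<iota>: "\<iota> \<in> borel_measurable FS" and \<iota>_range: "\<And>fs. 0 \<le> \<iota> fs \<and> \<iota> fs \<le> 1"
    and L_meas: "\<And>i. i < n \<Longrightarrow> (\<lambda>(x, z). L i x z) \<in> borel_measurable (borel \<Otimes>\<^sub>M MZ)"
    and L_range: "\<And>i x z. 0 \<le> L i x z \<and> L i x z \<le> 1"
    and L_eq: "\<And>fs i z. fs \<in> space FS \<Longrightarrow> i < n \<Longrightarrow> z \<in> space MZ \<Longrightarrow> L i (\<iota> fs) z = l (fs i) z"
begin

lemma iota_snd: "(\<lambda>p. \<iota> (snd p)) \<in> borel_measurable (hyp_space n MF)"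
  unfolding hyp_space_def by (rule measurable_compose[OF measurable_snd \<iota>])

text \<open>The push-forward of \<open>frakP\<close> under the code forgets the drawn prior and
  keeps the hypotheses. It meets the compactness premise of the envelope, since codes lie in the
  unit interval.\<close>

lemma prior_code:
  assumes A: "A \<in> space MA"
  shows "real_distribution (distr (frakP MF n PP A) borel (\<lambda>p. \<iota> (snd p)))"
    and "measure (distr (frakP MF n PP A) borel (\<lambda>p. \<iota> (snd p))) {0..1} = 1"
proof -
  interpret P: prob_space "frakP MF n PP A" by (rule frakP_in[OF A])
  have m: "(\<lambda>p. \<iota> (snd p)) \<in> borel_measurable (frakP MF n PP A)"
    using iota_snd unfolding measurable_cong_sets[OF frakP_in(2)[OF A] refl] .
  show "real_distribution (distr (frakP MF n PP A) borel (\<lambda>p. \<iota> (snd p)))"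
    using m by (rule P.real_distribution_distr)
  have "(\<lambda>p. \<iota> (snd p)) -` {0..1} \<inter> space (frakP MF n PP A) = space (frakP MF n PP A)"
    using \<iota>_range by auto
  then show "measure (distr (frakP MF n PP A) borel (\<lambda>p. \<iota> (snd p))) {0..1} = 1"
    using m P.prob_space by (simp add: measure_distr)
qed

lemma L_section_meas: "i < n \<Longrightarrow> L i x \<in> borel_measurable MZ"
  using measurable_compose[OF measurable_Pair1'[of x borel MZ] L_meas[of i]] by simp

lemma task_gap_code:
  assumes w: "w \<in> space WS" and fs: "fs \<in> space FS"
  shows "task_gap lam n (\<lambda>i. L i (\<iota> fs)) w = task_gap lam n (\<lambda>i. l (fs i)) w"
proof -
  have "task_mean (L i (\<iota> fs)) (w i) = task_mean (l (fs i)) (w i)" if i: "i < n" for i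
    unfolding task_mean_def
    using L_eq[OF fs i] sets_eq_imp_space_eq[OF task_distribution(2)[OF task_component[OF w i]]]
    by (intro Bochner_Integration.integral_cong) auto
  moreover have "task_sum (L i (\<iota> fs)) (w i) = task_sum (l (fs i)) (w i)" if i: "i < n" for i
    unfolding task_sum_def sum_list_dataset
    using L_eq[OF fs i sample_component[OF task_component[OF w i]]] by simp
  ultimately show ?thesis unfolding task_gap_def by simp
qed

lemma task_gap_L_meas: "(\<lambda>(x, w). task_gap lam n (\<lambda>i. L i x) w) \<in> borel_measurable (borel \<Otimes>\<^sub>M WS)"
  using L_meas by (rule measurable_task_gap)

lemma task_gap_L_bound:
  assumes w: "w \<in> space WS" and lam: "0 \<le> lam"
  shows "\<bar>task_gap lam n (\<lambda>i. L i x) w\<bar> \<le> lam"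
proof -
  have r: "0 \<le> task_mean (L i x) (w i) \<and> task_mean (L i x) (w i) \<le> 1" if "i < n" for i
    using task_mean_range[OF task_component[OF w that] L_section_meas[OF that] L_range] by simp
  let ?p = "(\<Sum>i<n. real (tsize (w i)) * task_mean (L i x) (w i)) / real (totalM n w)"
  let ?s = "(\<Sum>i<n. task_sum (L i x) (w i)) / real (totalM n w)"
  have p: "0 \<le> ?p" "?p \<le> 1"
    using r by (intro weighted_mean_range; auto intro: mult_left_le)+
  have s: "0 \<le> ?s" "?s \<le> 1"
    using task_sum_range[of "L i x" for i, OF L_range] by (intro weighted_mean_range; auto)+
  have "0 \<le> lam * ?s" "lam * ?s \<le> lam" using s lam mult_nonneg_nonneg[of lam ?s] mult_left_le[of ?s lam] by auto
  with catoni_bounds[OF p lam, of "totalM n w"] show ?thesis unfolding task_gap_def by linarith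
qed

text \<open>Donsker-Varadhan for \<open>frakQ\<close> against \<open>frakP\<close> with a test
  function of the hypotheses alone: \<open>Q A\<close> integrates out of the posterior mean, though
  its share stays in the divergence. The constant is the exponential moment of the test function
  itself, which is positive as \<open>\<phi>\<close> is bounded.\<close>

lemma posterior_change_of_measure:
  assumes w: "w \<in> space WS" and A: "A \<in> space MA"
    and Q: "prob_space (Q A)" "sets (Q A) = sets (prob_algebra MF)"
    and fin: "KL (frakQ alg n w Q A) (frakP MF n PP A) \<noteq> \<infinity>"
    and \<phi>[measurable]: "\<phi> \<in> borel_measurable borel" and b: "\<And>x. \<bar>\<phi> x\<bar> \<le> b"
  shows "exp (- enn2real (KL (frakQ alg n w Q A) (frakP MF n PP A))) * exp (\<integral>x. \<phi> x \<partial>distr (post A w) borel \<iota>)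
    \<le> (\<integral>x. exp (\<phi> x) \<partial>distr (frakP MF n PP A) borel (\<lambda>p. \<iota> (snd p)))"
proof -
  let ?Q = "frakQ alg n w Q A" and ?P = "frakP MF n PP A"
  have Qeq: "?Q = Q A \<Otimes>\<^sub>M post A w" by (simp add: frakQ_def post_def)
  interpret QA: prob_space "Q A" by fact
  interpret po: prob_space "post A w" using post_prob(1)[OF w A] .
  interpret QP: pair_prob_space "Q A" "post A w" by unfold_locales
  interpret P: prob_space ?P by (rule frakP_in[OF A])
  have Qs: "sets ?Q = sets (hyp_space n MF)"
    unfolding Qeq hyp_space_def by (intro sets_pair_measure_cong Q post_prob(2)[OF w A])
  have u: "(\<lambda>p. \<phi> (\<iota> (snd p))) \<in> borel_measurable (hyp_space n MF)"
    by (rule measurable_compose[OF iota_snd \<phi>])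
  have uQ: "(\<lambda>p. \<phi> (\<iota> (snd p))) \<in> borel_measurable ?Q" using u unfolding measurable_cong_sets[OF Qs refl] .
  have uP[measurable]: "(\<lambda>p. \<phi> (\<iota> (snd p))) \<in> borel_measurable ?P"
    using u unfolding measurable_cong_sets[OF frakP_in(2)[OF A] refl] .
  have intQ: "integrable ?Q (\<lambda>p. \<phi> (\<iota> (snd p)))"
    using uQ b unfolding Qeq by (intro QP.integrable_const_bound[where B=b]) auto
  have eb: "\<bar>exp (\<phi> x)\<bar> \<le> exp b" for x using b[of x] by auto
  have intP: "integrable ?P (\<lambda>p. exp (\<phi> (\<iota> (snd p))))"
    using eb by (intro P.integrable_const_bound[where B="exp b"]) auto
  define c where "c = (\<integral>p. exp (\<phi> (\<iota> (snd p))) \<partial>?P)"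
  have "exp (- b) = (\<integral>p. exp (- b) \<partial>?P)" by (simp add: P.prob_space)
  also have "\<dots> \<le> c" unfolding c_def
  proof (intro integral_mono intP)
    show "exp (- b) \<le> exp (\<phi> (\<iota> (snd p)))" for p using b[of "\<iota> (snd p)"] by (simp add: abs_le_iff)
  qed auto
  finally have c: "0 < c" using exp_gt_zero[of "- b"] by linarith
  have "(\<integral>p. \<phi> (\<iota> (snd p)) \<partial>?Q) \<le> enn2real (KL ?Q ?P) + ln c"
  proof (rule Donsker_Varadhan[OF _ P.prob_space_axioms _ fin intQ _ c])
    show "prob_space ?Q" unfolding Qeq by unfold_locales
    show "sets ?Q = sets ?P" using Qs frakP_in(2)[OF A] by simp
    show "(\<lambda>p. ennreal (exp (\<phi> (\<iota> (snd p))))) \<in> borel_measurable ?P" by measurable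
    show "(\<integral>\<^sup>+ p. ennreal (exp (\<phi> (\<iota> (snd p)))) \<partial>?P) \<le> ennreal c"
      unfolding c_def by (subst nn_integral_eq_integral[OF intP]) auto
  qed auto
  moreover have "(\<integral>p. \<phi> (\<iota> (snd p)) \<partial>?Q) = (\<integral>x. \<phi> x \<partial>distr (post A w) borel \<iota>)"
  proof -
    have \<iota>p: "\<iota> \<in> borel_measurable (post A w)" using \<iota> unfolding measurable_cong_sets[OF post_prob(2)[OF w A] refl] .
    have "(\<integral>p. \<phi> (\<iota> (snd p)) \<partial>?Q) = (\<integral>x. (\<integral>y. \<phi> (\<iota> y) \<partial>post A w) \<partial>Q A)"
      using QP.integral_fst'[OF intQ[unfolded Qeq]] by (simp add: Qeq)
    also have "\<dots> = (\<integral>y. \<phi> (\<iota> y) \<partial>post A w)" by (simp add: QA.prob_space)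
    also have "\<dots> = (\<integral>x. \<phi> x \<partial>distr (post A w) borel \<iota>)" using \<iota>p by (simp add: integral_distr)
    finally show ?thesis .
  qed
  moreover have "c = (\<integral>x. exp (\<phi> x) \<partial>distr ?P borel (\<lambda>p. \<iota> (snd p)))"
    unfolding c_def using iota_snd unfolding measurable_cong_sets[OF frakP_in(2)[OF A, symmetric] refl]
    by (simp add: integral_distr)
  ultimately have "exp (- enn2real (KL ?Q ?P) + (\<integral>x. \<phi> x \<partial>distr (post A w) borel \<iota>)) \<le> exp (ln c)"
    and "c = (\<integral>x. exp (\<phi> x) \<partial>distr ?P borel (\<lambda>p. \<iota> (snd p)))" by auto
  then show ?thesis using c by (simp only: exp_add exp_ln)
qed

lemma post_code_meas:
  assumes w: "w \<in> space WS"
  shows "(\<lambda>A. distr (post A w) borel \<iota>) \<in> MA \<rightarrow>\<^sub>M prob_algebra borel"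
  by (rule measurable_compose[OF post_meas[OF w] measurable_distr_prob_space[OF \<iota>]])

end

end

section \<open>Outer and inner bounds for a fixed outcome of the sampling\<close>

context meta_learning
begin

text \<open>The quantity at which the two levels meet: the inner bound controls its
  \<open>rho\<close>-mean from above, and \<open>totalM n w / (n * mmax)\<close> times it is the
  empirical mean of the variable whose expectation is \<open>expected_risk\<close>.\<close>

definition "mean_risk A w = (\<Sum>i<n. real (tsize (w i)) * task_risk A (w i)) / real (totalM n w)"

definition "expected_risk A = (\<integral>t. real (tsize t) / real mmax * task_risk A t \<partial>env MZ tau0)"

lemma mean_risk_meas: "w \<in> space WS \<Longrightarrow> (\<lambda>A. mean_risk A w) \<in> borel_measurable MA"
  unfolding mean_risk_def
  by (intro borel_measurable_divide borel_measurable_sum borel_measurable_times borel_measurable_const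
    section_meas[OF task_risk_meas] task_component) auto

lemma mean_risk_range:
  assumes "w \<in> space WS" "A \<in> space MA"
  shows "0 \<le> mean_risk A w \<and> mean_risk A w \<le> 1"
  unfolding mean_risk_def
  using task_risk_range[OF assms(2) task_component[OF assms(1)]]
  by (intro conjI weighted_mean_range) (auto intro: mult_left_le)

lemma emp_risk_eq:
  "emp_risk l alg n w rho = (\<integral>A. (\<Sum>i<n. task_emp A (w i)) / real (totalM n w) \<partial>rho)"
  unfolding emp_risk_def task_emp_def task_sum_def by simp

lemma scaled_task_risk_meas:
  "(\<lambda>p. real (tsize (snd p)) / real mmax * task_risk (fst p) (snd p)) \<in> borel_measurable (MA \<Otimes>\<^sub>M TS)"
proof -
  have "(\<lambda>p. real (tsize (snd p))) \<in> borel_measurable (MA \<Otimes>\<^sub>M TS)"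
    by (rule measurable_compose[OF measurable_snd measurable_compose[OF measurable_tsize]]) simp
  then show ?thesis using task_risk_meas by measurable
qed

lemma scaled_task_risk_section_meas:
  assumes "A \<in> space MA"
  shows "(\<lambda>t. real (tsize t) / real mmax * task_risk A t) \<in> borel_measurable TS"
  using measurable_compose[OF measurable_Pair1'[OF assms] scaled_task_risk_meas] by simp

lemma expected_risk_meas: "expected_risk \<in> borel_measurable MA"
proof -
  interpret E: prob_space "env MZ tau0" by (rule prob_space_env[OF tau0_prob tau0_sets])
  have "sets (MA \<Otimes>\<^sub>M env MZ tau0) = sets (MA \<Otimes>\<^sub>M TS)"
    by (intro sets_pair_measure_cong refl sets_env[OF tau0_prob tau0_sets])
  from scaled_task_risk_meas[folded measurable_cong_sets[OF this refl]]
  have "(\<lambda>(A, t). real (tsize t) / real mmax * task_risk A t) \<in> borel_measurable (MA \<Otimes>\<^sub>M env MZ tau0)"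
    by (simp add: case_prod_beta')
  then show ?thesis unfolding expected_risk_def[abs_def] by (rule E.borel_measurable_lebesgue_integral)
qed

lemma AE_scaled_task_risk_range:
  assumes "A \<in> space MA"
  shows "AE t in env MZ tau0. 0 \<le> real (tsize t) / real mmax * task_risk A t \<and> real (tsize t) / real mmax * task_risk A t \<le> 1"
  using AE_env_tsize[OF tau0_prob tau0_sets] AE_space
proof eventually_elim
  case (elim t)
  then have t: "t \<in> space TS" using sets_eq_imp_space_eq[OF sets_env[OF tau0_prob tau0_sets]] by simp
  have "0 \<le> real (tsize t) / real mmax" "real (tsize t) / real mmax \<le> 1" using elim by (auto simp: divide_le_eq)
  with task_risk_range[OF assms t] show ?case
    by (intro conjI mult_nonneg_nonneg mult_le_one)
qed

lemma expected_risk_range: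
  assumes A: "A \<in> space MA"
  shows "0 \<le> expected_risk A \<and> expected_risk A \<le> 1"
proof -
  interpret E: prob_space "env MZ tau0" by (rule prob_space_env[OF tau0_prob tau0_sets])
  define Y where "Y t = real (tsize t) / real mmax * task_risk A t" for t
  have m: "Y \<in> borel_measurable (env MZ tau0)"
    using scaled_task_risk_section_meas[OF A]
    unfolding measurable_cong_sets[OF sets_env[OF tau0_prob tau0_sets] refl] Y_def[abs_def] .
  have ae: "AE t in env MZ tau0. 0 \<le> Y t" "AE t in env MZ tau0. Y t \<le> 1"
    using AE_scaled_task_risk_range[OF A] unfolding Y_def[symmetric] by auto
  have int: "integrable (env MZ tau0) Y"
    using ae by (intro E.integrable_const_bound[where B=1] m) auto
  have "(\<integral>t. Y t \<partial>env MZ tau0) \<le> (\<integral>t. 1 \<partial>env MZ tau0)"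
    using ae by (intro integral_mono_AE int) auto
  moreover have "0 \<le> (\<integral>t. Y t \<partial>env MZ tau0)"
    using ae by (intro integral_nonneg_AE)
  ultimately show ?thesis unfolding expected_risk_def Y_def[symmetric] by (simp add: E.prob_space)
qed

lemma risk_M_eq: "risk_M l alg mmax (env MZ tau0) rho = (\<integral>A. expected_risk A \<partial>rho)"
  unfolding risk_M_def expected_risk_def task_risk_def task_mean_def by simp

text \<open>The outer variable depends on the algorithm but on no sampled hypothesis, so
  Donsker-Varadhan is applied to \<open>rho\<close> against \<open>piM\<close> and only their
  divergence enters. Jensen moves the mean over \<open>rho\<close> inside
  \<open>catoni\<close>.\<close>

lemma outer_bound:
  assumes w: "w \<in> space WS" and c: "0 < c" and lamM: "0 \<le> lamM"
    and \<Xi>: "(\<integral>\<^sup>+ A. ennreal (exp (catoni n lamM (expected_risk A)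
        - lamM / real n * (\<Sum>i<n. real (tsize (w i)) / real mmax * task_risk A (w i)))) \<partial>piM) \<le> ennreal c"
    and rho: "prob_space rho" "sets rho = sets MA" and fin: "KL rho piM \<noteq> \<infinity>"
  shows "catoni n lamM (\<integral>A. expected_risk A \<partial>rho)
    \<le> lamM * (real (totalM n w) / (real n * real mmax) * (\<integral>A. mean_risk A w \<partial>rho)) + (enn2real (KL rho piM) + ln c)"
proof -
  interpret rho: prob_space rho by fact
  have sp: "space rho = space MA" using rho(2) by (rule sets_eq_imp_space_eq)
  define f where "f = real (totalM n w) / (real n * real mmax)"
  define u where "u A = catoni n lamM (expected_risk A) - lamM * (f * mean_risk A w)" for A
  \<comment> \<open>Source of the factor \<open>totalM n w / (n * mmax)\<close>: the average of the
    scaled risks is rewritten through the size-weighted mean. If all sizes are 0, both sides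
    vanish.\<close>
  have ueq: "lamM / real n * (\<Sum>i<n. real (tsize (w i)) / real mmax * task_risk A (w i)) = lamM * (f * mean_risk A w)" for A
  proof (cases "totalM n w = 0")
    case True
    then have "\<forall>i<n. tsize (w i) = 0" by (simp add: totalM_def)
    then show ?thesis using True by (simp add: mean_risk_def)
  next
    case False
    have "(\<Sum>i<n. real (tsize (w i)) / real mmax * task_risk A (w i)) = (\<Sum>i<n. real (tsize (w i)) * task_risk A (w i)) / real mmax"
      by (simp add: sum_divide_distrib)
    then show ?thesis using False by (simp add: mean_risk_def f_def)
  qed
  have em: "expected_risk \<in> borel_measurable rho"
    using expected_risk_meas unfolding measurable_cong_sets[OF rho(2) refl] .
  have er: "0 \<le> expected_risk A \<and> expected_risk A \<le> 1" if "A \<in> space rho" for A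
    using expected_risk_range that sp by simp
  have J1: "catoni n lamM (\<integral>A. expected_risk A \<partial>rho) \<le> (\<integral>A. catoni n lamM (expected_risk A) \<partial>rho)"
    by (rule rho.catoni_jensen(1)[OF em _ lamM]) (rule er)
  have J3: "integrable rho (\<lambda>A. catoni n lamM (expected_risk A))"
    by (rule rho.catoni_jensen(3)[OF em _ lamM]) (rule er)
  have mm: "(\<lambda>A. mean_risk A w) \<in> borel_measurable rho"
    using mean_risk_meas[OF w] unfolding measurable_cong_sets[OF rho(2) refl] .
  have mi: "integrable rho (\<lambda>A. mean_risk A w)"
    using mean_risk_range[OF w] sp by (intro rho.integrable_const_bound[where B=1] mm AE_I2) auto
  have ui: "integrable rho u" unfolding u_def using J3 mi by (intro Bochner_Integration.integrable_diff integrable_mult_right)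
  have "(\<integral>A. u A \<partial>rho) \<le> enn2real (KL rho piM) + ln c"
  proof (rule Donsker_Varadhan[OF rho(1) pi_prob _ fin ui _ c])
    show "sets rho = sets piM" using rho(2) pi_sets by simp
    have "u \<in> borel_measurable MA"
      unfolding u_def catoni_def using expected_risk_meas mean_risk_meas[OF w] by measurable
    then have "u \<in> borel_measurable piM" unfolding measurable_cong_sets[OF pi_sets refl] .
    then show "(\<lambda>A. ennreal (exp (u A))) \<in> borel_measurable piM" by measurable
    show "(\<integral>\<^sup>+ A. ennreal (exp (u A)) \<partial>piM) \<le> ennreal c" using \<Xi> unfolding ueq u_def .
  qed auto
  moreover have "(\<integral>A. u A \<partial>rho) = (\<integral>A. catoni n lamM (expected_risk A) \<partial>rho) - lamM * (f * (\<integral>A. mean_risk A w \<partial>rho))"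
    unfolding u_def by (subst Bochner_Integration.integral_diff[OF J3]) (use mi in \<open>auto intro!: integrable_mult_right\<close>)
  ultimately show ?thesis using J1 unfolding f_def by linarith
qed

context
  fixes \<iota> :: "(nat \<Rightarrow> 'f) \<Rightarrow> real" and L :: "nat \<Rightarrow> real \<Rightarrow> 'z \<Rightarrow> real" and \<nu> :: "'a \<Rightarrow> real measure"
  assumes \<iota>: "\<iota> \<in> borel_measurable FS" and \<iota>_range: "\<And>fs. 0 \<le> \<iota> fs \<and> \<iota> fs \<le> 1"
    and L_meas: "\<And>i. i < n \<Longrightarrow> (\<lambda>(x, z). L i x z) \<in> borel_measurable (borel \<Otimes>\<^sub>M MZ)"
    and L_range: "\<And>i x z. 0 \<le> L i x z \<and> L i x z \<le> 1"
    and L_eq: "\<And>fs i z. fs \<in> space FS \<Longrightarrow> i < n \<Longrightarrow> z \<in> space MZ \<Longrightarrow> L i (\<iota> fs) z = l (fs i) z"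
    and \<nu>: "\<nu> \<in> piM \<rightarrow>\<^sub>M prob_algebra borel"
    and dom: "\<And>a (k :: 'a \<Rightarrow> real) \<phi> b. \<lbrakk>a \<in> piM \<rightarrow>\<^sub>M prob_algebra borel; k \<in> borel_measurable piM;
        \<forall>A\<in>space piM. \<forall>\<phi> b. \<phi> \<in> borel_measurable borel \<longrightarrow> (\<forall>x. \<bar>\<phi> x\<bar> \<le> b) \<longrightarrow>
          k A * exp (\<integral>x. \<phi> x \<partial>a A) \<le> (\<integral>x. exp (\<phi> x) \<partial>distr (frakP MF n PP A) borel (\<lambda>p. \<iota> (snd p)));
        \<phi> \<in> borel_measurable borel; \<And>x. \<bar>\<phi> x\<bar> \<le> b\<rbrakk> \<Longrightarrow>
      AE A in piM. k A * exp (\<integral>x. \<phi> x \<partial>a A) \<le> (\<integral>x. exp (\<phi> x) \<partial>\<nu> A)"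
begin

lemmas code = \<iota> \<iota>_range L_meas L_range L_eq

text \<open>Two changes of measure are chained. For fixed \<open>A\<close>, the one over the
  hypotheses costs \<open>K A\<close>; the one from \<open>piM\<close> to \<open>rho\<close>, with
  \<open>v\<close> the exponential moment under the replaced prior, costs \<open>KL rho piM\<close>.
  Jensen over the posteriors and over \<open>rho\<close> then recovers the risks.\<close>

lemma inner_bound:
  assumes w: "w \<in> space WS" and c: "0 < c" and lam: "0 \<le> lam"
    and \<Xi>: "(\<integral>\<^sup>+ A. (\<integral>\<^sup>+ x. ennreal (exp (task_gap lam n (\<lambda>i. L i x) w)) \<partial>\<nu> A) \<partial>piM) \<le> ennreal c"
    and rho: "prob_space rho" "sets rho = sets MA" and fin: "KL rho piM \<noteq> \<infinity>"
    and Q: "\<And>A. A \<in> space MA \<Longrightarrow> prob_space (Q A) \<and> sets (Q A) = sets (prob_algebra MF)"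
    and Km: "(\<lambda>A. KL (frakQ alg n w Q A) (frakP MF n PP A)) \<in> borel_measurable MA"
    and Kfin: "(\<integral>\<^sup>+ A. KL (frakQ alg n w Q A) (frakP MF n PP A) \<partial>rho) \<noteq> \<infinity>"
  shows "catoni (totalM n w) lam (\<integral>A. mean_risk A w \<partial>rho) \<le> lam * emp_risk l alg n w rho
    + (enn2real (KL rho piM) + enn2real (\<integral>\<^sup>+ A. KL (frakQ alg n w Q A) (frakP MF n PP A) \<partial>rho) + ln c)"
proof -
  interpret rho: prob_space rho by fact
  have sp: "space rho = space MA" using rho(2) by (rule sets_eq_imp_space_eq)
  have spi: "space piM = space MA" using pi_sets by (rule sets_eq_imp_space_eq)
  define K where "K A = KL (frakQ alg n w Q A) (frakP MF n PP A)" for A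
  define gp where "gp x = task_gap lam n (\<lambda>i. L i x) w" for x
  have gm[measurable]: "gp \<in> borel_measurable borel"
    using measurable_compose[OF measurable_Pair2'[OF w] task_gap_L_meas[OF code]] by (simp add: gp_def[abs_def])
  have gb: "\<bar>gp x\<bar> \<le> lam" for x unfolding gp_def by (rule task_gap_L_bound[OF code w lam])
  define a where "a A = distr (post A w) borel \<iota>" for A
  have am: "a \<in> MA \<rightarrow>\<^sub>M prob_algebra borel" using post_code_meas[OF code w] by (simp add: a_def[abs_def])
  have ap: "prob_space (a A)" "sets (a A) = sets borel" if "A \<in> space MA" for A
    using measurable_space[OF am that] by (auto simp: space_prob_algebra)
  \<comment> \<open>Zero where the divergence is infinite, which makes the pointwise inequality
    trivial there; finiteness of the mean divergence shows that \<open>rho\<close> does not charge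
    this set.\<close>
  define k where "k A = (if K A = \<infinity> then 0 else exp (- enn2real (K A)))" for A
  have KmA[measurable]: "K \<in> borel_measurable MA" using Km by (simp add: K_def[abs_def])
  have km: "k \<in> borel_measurable MA" unfolding k_def by measurable
  have ae\<pi>: "AE A in piM. k A * exp (\<integral>x. gp x \<partial>a A) \<le> (\<integral>x. exp (gp x) \<partial>\<nu> A)"
  proof (rule dom[OF _ _ _ gm gb])
    show "a \<in> piM \<rightarrow>\<^sub>M prob_algebra borel" using am unfolding measurable_cong_sets[OF pi_sets refl] .
    show "k \<in> borel_measurable piM" using km unfolding measurable_cong_sets[OF pi_sets refl] .
    show "\<forall>A\<in>space piM. \<forall>\<phi> b. \<phi> \<in> borel_measurable borel \<longrightarrow> (\<forall>x. \<bar>\<phi> x\<bar> \<le> b) \<longrightarrow>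
        k A * exp (\<integral>x. \<phi> x \<partial>a A) \<le> (\<integral>x. exp (\<phi> x) \<partial>distr (frakP MF n PP A) borel (\<lambda>p. \<iota> (snd p)))"
    proof (intro ballI allI impI)
      fix A and \<phi> :: "real \<Rightarrow> real" and b assume A: "A \<in> space piM"
        and \<phi>: "\<phi> \<in> borel_measurable borel" "\<forall>x. \<bar>\<phi> x\<bar> \<le> b"
      show "k A * exp (\<integral>x. \<phi> x \<partial>a A) \<le> (\<integral>x. exp (\<phi> x) \<partial>distr (frakP MF n PP A) borel (\<lambda>p. \<iota> (snd p)))"
      proof (cases "K A = \<infinity>")
        case True
        then show ?thesis by (simp add: k_def)
      next
        case False
        have A': "A \<in> space MA" using A spi by simp
        show ?thesis
          using posterior_change_of_measure[OF code w A' _ _ _ \<phi>(1), of Q b] Q[OF A'] \<phi>(2) False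
          by (simp add: k_def K_def a_def)
      qed
    qed
  qed
  define v where "v A = (\<integral>\<^sup>+ x. ennreal (exp (gp x)) \<partial>\<nu> A)" for A
  have vm: "v \<in> borel_measurable piM"
    unfolding v_def[abs_def]
    by (rule measurable_compose[OF measurable_prob_algebraD[OF \<nu>] nn_integral_measurable_subprob_algebra]) measurable
  have vint: "v A = ennreal (\<integral>x. exp (gp x) \<partial>\<nu> A)" if "A \<in> space MA" for A
  proof -
    have n: "prob_space (\<nu> A)" "sets (\<nu> A) = sets borel"
      using measurable_space[OF \<nu>, of A] that spi by (auto simp: space_prob_algebra)
    interpret prob_space "\<nu> A" by fact
    have "gp \<in> borel_measurable (\<nu> A)" using gm unfolding measurable_cong_sets[OF n(2) refl] .
    moreover have "\<bar>exp (gp x)\<bar> \<le> exp lam" for x using gb[of x] by auto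
    ultimately have "integrable (\<nu> A) (\<lambda>x. exp (gp x))"
      by (intro integrable_const_bound[where B="exp lam"]) auto
    then show ?thesis unfolding v_def by (rule nn_integral_eq_integral) auto
  qed
  define G where "G A = (\<integral>x. gp x \<partial>a A)" for A
  have Gm: "G \<in> borel_measurable MA"
    unfolding G_def[abs_def]
    by (rule measurable_compose[OF measurable_prob_algebraD[OF am] integral_measurable_subprob_algebra[OF gm]])
  have Gb: "\<bar>G A\<bar> \<le> lam" if "A \<in> space MA" for A
  proof -
    interpret aA: prob_space "a A" using ap[OF that] by simp
    have gma: "gp \<in> borel_measurable (a A)" using gm unfolding measurable_cong_sets[OF ap(2)[OF that] refl] .
    have i: "integrable (a A) gp" using gb by (intro aA.integrable_const_bound[where B=lam] gma) auto
    have "\<bar>G A\<bar> \<le> (\<integral>x. \<bar>gp x\<bar> \<partial>a A)" unfolding G_def by (rule integral_abs_bound)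
    also have "\<dots> \<le> (\<integral>x. lam \<partial>a A)" using gb i by (intro integral_mono) auto
    finally show ?thesis by (simp add: aA.prob_space)
  qed
  have Gr: "G \<in> borel_measurable rho" using Gm unfolding measurable_cong_sets[OF rho(2) refl] .
  have Gi: "integrable rho G" using Gb sp by (intro rho.integrable_const_bound[where B=lam] Gr AE_I2) auto
  have Kr[measurable]: "K \<in> borel_measurable rho" using KmA unfolding measurable_cong_sets[OF rho(2) refl] .
  have Kint: "(\<integral>\<^sup>+ A. K A \<partial>rho) \<noteq> \<infinity>" using Kfin by (simp add: K_def)
  have Kae: "AE A in rho. K A \<noteq> \<infinity>" by (rule nn_integral_PInf_AE[OF Kr Kint])
  have Keq: "(\<integral>\<^sup>+ A. ennreal (enn2real (K A)) \<partial>rho) = (\<integral>\<^sup>+ A. K A \<partial>rho)"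
    using Kae by (intro nn_integral_cong_AE) (auto elim!: eventually_mono simp: less_top)
  have Ki: "integrable rho (\<lambda>A. enn2real (K A))"
    using Keq Kint by (intro integrableI_nonneg) (auto simp: less_top)
  have KE: "(\<integral>A. enn2real (K A) \<partial>rho) = enn2real (\<integral>\<^sup>+ A. K A \<partial>rho)"
    using Keq by (subst integral_eq_nn_integral) auto
  \<comment> \<open>The exceptional set of \<open>ae\<pi>\<close> depends on \<open>w\<close> and
    \<open>Q\<close> and is null for \<open>piM\<close>; finiteness of \<open>KL rho piM\<close>
    makes it null for \<open>rho\<close>.\<close>
  have ac: "absolutely_continuous piM rho" using fin by (auto simp: KL_def split: if_splits)
  have "AE A in rho. k A * exp (G A) \<le> (\<integral>x. exp (gp x) \<partial>\<nu> A)"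
    using absolutely_continuous_AE[OF _ ac ae\<pi>] rho(2) pi_sets by (simp add: G_def)
  then have aeu: "AE A in rho. ennreal (exp (G A - enn2real (K A))) \<le> v A"
    using Kae AE_space
  proof eventually_elim
    case (elim A)
    then have "exp (G A - enn2real (K A)) \<le> (\<integral>x. exp (gp x) \<partial>\<nu> A)"
      by (simp add: k_def exp_diff exp_minus field_simps)
    then show ?case using vint[of A] elim sp by (simp add: ennreal_leI)
  qed
  have ui: "integrable rho (\<lambda>A. G A - enn2real (K A))" using Gi Ki by simp
  have "(\<integral>A. G A - enn2real (K A) \<partial>rho) \<le> enn2real (KL rho piM) + ln c"
    by (rule Donsker_Varadhan[OF rho(1) pi_prob _ fin ui vm c _ aeu])
      (use rho(2) pi_sets \<Xi> in \<open>auto simp: v_def gp_def\<close>)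
  then have up: "(\<integral>A. G A \<partial>rho) \<le> enn2real (KL rho piM) + enn2real (\<integral>\<^sup>+ A. K A \<partial>rho) + ln c"
    using Gi Ki KE by simp
  define e where "e A = (\<Sum>i<n. task_emp A (w i)) / real (totalM n w)" for A
  have emA: "e \<in> borel_measurable MA"
    unfolding e_def[abs_def]
    by (intro borel_measurable_divide borel_measurable_sum borel_measurable_const
      section_meas[OF task_emp_meas] task_component[OF w]) auto
  have em: "e \<in> borel_measurable rho" using emA unfolding measurable_cong_sets[OF rho(2) refl] .
  have er: "0 \<le> e A \<and> e A \<le> 1" if "A \<in> space MA" for A
    unfolding e_def using task_emp_range[OF that task_component[OF w]] by (intro conjI weighted_mean_range) auto
  have ei: "integrable rho e" using er sp by (intro rho.integrable_const_bound[where B=1] em AE_I2) auto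
  have mm: "(\<lambda>A. mean_risk A w) \<in> borel_measurable rho"
    using mean_risk_meas[OF w] unfolding measurable_cong_sets[OF rho(2) refl] .
  have mr: "0 \<le> mean_risk A w \<and> mean_risk A w \<le> 1" if "A \<in> space rho" for A
    using mean_risk_range[OF w] that sp by simp
  have J1: "catoni (totalM n w) lam (\<integral>A. mean_risk A w \<partial>rho) \<le> (\<integral>A. catoni (totalM n w) lam (mean_risk A w) \<partial>rho)"
    by (rule rho.catoni_jensen(1)[OF mm _ lam]) (rule mr)
  have J3: "integrable rho (\<lambda>A. catoni (totalM n w) lam (mean_risk A w))"
    by (rule rho.catoni_jensen(3)[OF mm _ lam]) (rule mr)
  \<comment> \<open>Back from codes to hypotheses: the code of an actual tuple reproduces its
    losses, so \<open>G A\<close> is the posterior mean of the true gap.\<close>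
  have low: "catoni (totalM n w) lam (mean_risk A w) - lam * e A \<le> G A" if A: "A \<in> space MA" for A
  proof -
    have \<iota>p: "\<iota> \<in> borel_measurable (post A w)"
      using \<iota> unfolding measurable_cong_sets[OF post_prob(2)[OF w A] refl] .
    have "G A = (\<integral>fs. gp (\<iota> fs) \<partial>post A w)" unfolding G_def a_def using \<iota>p by (simp add: integral_distr)
    also have "\<dots> = (\<integral>fs. task_gap lam n (\<lambda>i. l (fs i)) w \<partial>post A w)"
      unfolding gp_def using task_gap_code[OF code w] sets_eq_imp_space_eq[OF post_prob(2)[OF w A]]
      by (intro Bochner_Integration.integral_cong) auto
    finally show ?thesis using post_task_gap[OF w A lam] by (simp add: mean_risk_def e_def)
  qed
  have "(\<integral>A. catoni (totalM n w) lam (mean_risk A w) - lam * e A \<partial>rho) \<le> (\<integral>A. G A \<partial>rho)"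
    using low sp by (intro integral_mono Bochner_Integration.integrable_diff J3 integrable_mult_right ei Gi) auto
  moreover have "(\<integral>A. catoni (totalM n w) lam (mean_risk A w) - lam * e A \<partial>rho)
    = (\<integral>A. catoni (totalM n w) lam (mean_risk A w) \<partial>rho) - lam * (\<integral>A. e A \<partial>rho)"
    by (subst Bochner_Integration.integral_diff[OF J3 integrable_mult_right[OF ei]]) simp
  moreover have emp: "emp_risk l alg n w rho = (\<integral>A. e A \<partial>rho)" unfolding emp_risk_eq e_def ..
  ultimately show ?thesis using J1 up unfolding K_def emp by linarith
qed

end

end

section \<open>The two Markov events and the conclusion\<close>

text \<open>The mixing law \<open>P\<close> does not depend on the data, so Tonelli carries the
  moment bound at fixed \<open>x\<close> to the average over \<open>P\<close> before Markov is
  applied.\<close>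

lemma markov_half_mixture:
  assumes P: "prob_space P" and W: "prob_space W"
    and f: "(\<lambda>(x, w). f x w) \<in> borel_measurable (P \<Otimes>\<^sub>M W)"
    and le: "\<And>x. x \<in> space P \<Longrightarrow> (\<integral>\<^sup>+ w. f x w \<partial>W) \<le> (1::ennreal)" and \<delta>: "0 < \<delta>"
  shows "(\<lambda>w. \<integral>\<^sup>+ x. f x w \<partial>P) \<in> borel_measurable W"
    and "measure W {w \<in> space W. \<not> (\<integral>\<^sup>+ x. f x w \<partial>P) \<le> ennreal (2 / \<delta>)} \<le> \<delta> / 2"
proof -
  interpret P: prob_space P by fact
  interpret W: prob_space W by fact
  interpret PW: pair_sigma_finite P W by unfold_locales
  have "(\<lambda>(w, x). f x w) \<in> borel_measurable (W \<Otimes>\<^sub>M P)"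
    using measurable_pair_swap[OF f] by (simp add: case_prod_beta')
  then show m: "(\<lambda>w. \<integral>\<^sup>+ x. f x w \<partial>P) \<in> borel_measurable W"
    by (rule P.borel_measurable_nn_integral)
  have "(\<integral>\<^sup>+ w. (\<integral>\<^sup>+ x. f x w \<partial>P) \<partial>W) = (\<integral>\<^sup>+ x. (\<integral>\<^sup>+ w. f x w \<partial>W) \<partial>P)"
    by (rule PW.Fubini'[OF f])
  also have "\<dots> \<le> (\<integral>\<^sup>+ x. 1 \<partial>P)" using le by (intro nn_integral_mono)
  also have "\<dots> = 1" by (simp add: P.emeasure_space_1)
  finally show "measure W {w \<in> space W. \<not> (\<integral>\<^sup>+ x. f x w \<partial>P) \<le> ennreal (2 / \<delta>)} \<le> \<delta> / 2"
    by (rule W.markov_half[OF m _ \<delta>])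
qed

theorem mainTheorem12:
  fixes MZ :: "'z measure" and MF :: "'f measure" and MA :: "'a measure"
    and l :: "'f \<Rightarrow> 'z \<Rightarrow> real"
    and alg :: "'a \<Rightarrow> 'z list \<Rightarrow> 'f measure"
    and tau0 :: "('z measure \<times> nat) measure"
    and mmax n :: nat
    and piM :: "'a measure"
    and PP :: "'a \<Rightarrow> 'f measure measure"
    and delta lam lamM :: real
  assumes l_meas: "(\<lambda>(f, z). l f z) \<in> borel_measurable (MF \<Otimes>\<^sub>M MZ)"
    and l_range: "\<And>f z. 0 \<le> l f z \<and> l f z \<le> 1"
    and alg_meas: "\<And>m. (\<lambda>(A, s). alg A (map s [0..<m]))
                        \<in> MA \<Otimes>\<^sub>M (\<Pi>\<^sub>M j\<in>UNIV. MZ) \<rightarrow>\<^sub>M prob_algebra MF"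
    and tau0_prob: "prob_space tau0"
    and tau0_sets: "sets tau0 = sets (prob_algebra MZ \<Otimes>\<^sub>M count_space {1..mmax})"
    and n_pos: "0 < n"
    and pi_prob: "prob_space piM" and pi_sets: "sets piM = sets MA"
    and PP_prob: "\<And>A. A \<in> space MA \<Longrightarrow> prob_space (PP A)"
    and PP_sets: "\<And>A. A \<in> space MA \<Longrightarrow> sets (PP A) = sets (prob_algebra MF)"
    and delta_pos: "0 < delta" and lam_pos: "0 < lam" and lamM_pos: "0 < lamM"
  shows "\<exists>E \<in> sets (train_space n (env MZ tau0)).
           measure (train_space n (env MZ tau0)) E \<ge> 1 - delta \<and>
           (\<forall>w \<in> E. \<forall>rho Q.
              prob_space rho \<and> sets rho = sets MA \<and>
              (\<forall>A \<in> space MA. prob_space (Q A) \<and> sets (Q A) = sets (prob_algebra MF)) \<and>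
              (\<lambda>A. KL (frakQ alg n w Q A) (frakP MF n PP A)) \<in> borel_measurable MA
              \<longrightarrow>
              risk_M l alg mmax (env MZ tau0) rho
                \<le> Phi_inv n
                    (real (totalM n w) / (real n * real mmax) *
                       Phi_inv (totalM n w) (emp_risk l alg n w rho)
                         (Cterm rho piM (frakQ alg n w Q) (frakP MF n PP) delta) lam)
                    (enn2ereal (KL rho piM) + ereal (ln (2 / delta))) lamM)"
proof -
  interpret meta_learning MZ MF MA l alg tau0 mmax n piM PP
    by (rule meta_learning.intro)
      (fact l_meas l_range alg_meas tau0_prob tau0_sets pi_prob pi_sets PP_prob PP_sets)+
  define W where "W = train_space n (env MZ tau0)"
  have Ws: "sets W = sets WS" unfolding W_def by (rule sets_train[OF tau0_prob tau0_sets])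
  have Wsp: "space W = space WS" using Ws by (rule sets_eq_imp_space_eq)
  interpret W: prob_space W unfolding W_def by (rule prob_space_train[OF tau0_prob tau0_sets])
  interpret pi: prob_space piM by (rule pi_prob)
  have spi: "space piM = space MA" using pi_sets by (rule sets_eq_imp_space_eq)
  define c where "c = 2 / delta"
  have c: "0 < c" using delta_pos by (simp add: c_def)

  obtain \<iota> :: "(nat \<Rightarrow> 'f) \<Rightarrow> real" and L where code: "\<iota> \<in> borel_measurable FS" "\<And>fs. 0 \<le> \<iota> fs \<and> \<iota> fs \<le> 1"
    "\<And>i. i < n \<Longrightarrow> (\<lambda>(x, z). L i x z) \<in> borel_measurable (borel \<Otimes>\<^sub>M MZ)"
    "\<And>i x z. 0 \<le> L i x z \<and> L i x z \<le> (1::real)"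
    "\<And>fs i z. fs \<in> space FS \<Longrightarrow> i < n \<Longrightarrow> z \<in> space MZ \<Longrightarrow> L i (\<iota> fs) z = l (fs i) z"
    by (rule loss_coding) blast
  have \<mu>: "real_distribution (distr (frakP MF n PP A) borel (\<lambda>p. \<iota> (snd p)))"
    "measure (distr (frakP MF n PP A) borel (\<lambda>p. \<iota> (snd p))) {0..1} = 1" if "A \<in> space piM" for A
    using prior_code[OF code, of A] that spi by auto
  obtain \<nu> where \<nu>: "\<nu> \<in> piM \<rightarrow>\<^sub>M prob_algebra borel"
    and dom: "\<And>a (k :: 'a \<Rightarrow> real) \<phi> b. \<lbrakk>a \<in> piM \<rightarrow>\<^sub>M prob_algebra borel; k \<in> borel_measurable piM;
        \<forall>A\<in>space piM. \<forall>\<phi> b. \<phi> \<in> borel_measurable borel \<longrightarrow> (\<forall>x. \<bar>\<phi> x\<bar> \<le> b) \<longrightarrow>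
          k A * exp (\<integral>x. \<phi> x \<partial>a A) \<le> (\<integral>x. exp (\<phi> x) \<partial>distr (frakP MF n PP A) borel (\<lambda>p. \<iota> (snd p)));
        \<phi> \<in> borel_measurable borel; \<And>x. \<bar>\<phi> x\<bar> \<le> b\<rbrakk> \<Longrightarrow>
      AE A in piM. k A * exp (\<integral>x. \<phi> x \<partial>a A) \<le> (\<integral>x. exp (\<phi> x) \<partial>\<nu> A)"
    by (rule pi.measurable_prior_envelope[of "\<lambda>A. distr (frakP MF n PP A) borel (\<lambda>p. \<iota> (snd p))", OF \<mu>]) blast+

  \<comment> \<open>The coded gap reads the code and not the algorithm, so the marginal law of the
    codes carries the inner moment.\<close>
  define \<Theta> where "\<Theta> = piM \<bind> \<nu>"
  have pin: "piM \<in> space (prob_algebra piM)" using pi_prob by (simp add: space_prob_algebra)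
  have \<Theta>: "prob_space \<Theta>" "sets \<Theta> = sets borel"
    unfolding \<Theta>_def using prob_space_bind'[OF pin \<nu>] sets_bind'[OF pin \<nu>] .
  define f1 where "f1 x w = ennreal (exp (task_gap lam n (\<lambda>i. L i x) w))" for x w
  have f1m: "(\<lambda>(x, w). f1 x w) \<in> borel_measurable (\<Theta> \<Otimes>\<^sub>M W)"
  proof -
    have "(\<lambda>(x, w). f1 x w) \<in> borel_measurable (borel \<Otimes>\<^sub>M WS)"
      using task_gap_L_meas[OF code, of lam] unfolding f1_def case_prod_beta' by measurable
    then show ?thesis unfolding measurable_cong_sets[OF sets_pair_measure_cong[OF \<Theta>(2) Ws] refl] .
  qed
  \<comment> \<open>Every real \<open>x\<close> acts as a fixed, data-independent tuple of
    hypotheses with losses \<open>L i x\<close>; the moment is therefore bounded at each point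
    before it is averaged over \<open>\<Theta>\<close>.\<close>
  have f1le: "(\<integral>\<^sup>+ w. f1 x w \<partial>W) \<le> 1" for x
    unfolding f1_def W_def using L_section_meas[OF code] code(4) lam_pos
    by (intro train_task_gap_moment[OF tau0_prob tau0_sets]) auto
  note \<Xi>1 = markov_half_mixture[OF \<Theta>(1) W.prob_space_axioms f1m f1le delta_pos, folded c_def]
  define f2 where "f2 A w = ennreal (exp (catoni n lamM (expected_risk A)
        - lamM / real n * (\<Sum>i<n. real (tsize (w i)) / real mmax * task_risk A (w i))))" for A w
  have f2m: "(\<lambda>(A, w). f2 A w) \<in> borel_measurable (piM \<Otimes>\<^sub>M W)"
  proof -
    have [measurable]: "(\<lambda>p. real (tsize (snd p i)) / real mmax * task_risk (fst p) (snd p i)) \<in> borel_measurable (MA \<Otimes>\<^sub>M WS)"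
      if "i < n" for i
    proof -
      have "(\<lambda>p. (fst p, snd p i)) \<in> MA \<Otimes>\<^sub>M WS \<rightarrow>\<^sub>M MA \<Otimes>\<^sub>M TS"
        using that measurable_PiM_component_compose[of i "{..<n}" "\<lambda>t. t" TS TS]
        by (intro measurable_Pair measurable_fst measurable_compose[OF measurable_snd]) auto
      from measurable_compose[OF this scaled_task_risk_meas] show ?thesis by simp
    qed
    then have [measurable]: "(\<lambda>p. \<Sum>i<n. real (tsize (snd p i)) / real mmax * task_risk (fst p) (snd p i)) \<in> borel_measurable (MA \<Otimes>\<^sub>M WS)"
      by (intro borel_measurable_sum) auto
    have [measurable]: "(\<lambda>p. expected_risk (fst p)) \<in> borel_measurable (MA \<Otimes>\<^sub>M WS)"
      by (rule measurable_compose[OF measurable_fst expected_risk_meas])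
    have "(\<lambda>(A, w). f2 A w) \<in> borel_measurable (MA \<Otimes>\<^sub>M WS)"
      unfolding f2_def catoni_def case_prod_beta' by measurable
    then show ?thesis unfolding measurable_cong_sets[OF sets_pair_measure_cong[OF pi_sets Ws] refl] .
  qed
  have f2le: "(\<integral>\<^sup>+ w. f2 A w \<partial>W) \<le> 1" if "A \<in> space piM" for A
  proof -
    have A: "A \<in> space MA" using that spi by simp
    have "(\<lambda>t. real (tsize t) / real mmax * task_risk A t) \<in> borel_measurable (env MZ tau0)"
      using scaled_task_risk_section_meas[OF A]
      unfolding measurable_cong_sets[OF sets_env[OF tau0_prob tau0_sets] refl] .
    from train_iid_moment[OF tau0_prob tau0_sets this AE_scaled_task_risk_range[OF A] less_imp_le[OF lamM_pos]]
    show ?thesis unfolding f2_def W_def expected_risk_def .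
  qed
  note \<Xi>2 = markov_half_mixture[OF pi_prob W.prob_space_axioms f2m f2le delta_pos, folded c_def]

  \<comment> \<open>Both conditions concern priors and data only; \<open>rho\<close> and
    \<open>Q\<close> enter afterwards, which is why one event serves them all. The two failure
    probabilities add up to at most \<open>delta\<close>.\<close>
  define E where "E = {w \<in> space W. (\<integral>\<^sup>+ x. f1 x w \<partial>\<Theta>) \<le> ennreal c \<and> (\<integral>\<^sup>+ A. f2 A w \<partial>piM) \<le> ennreal c}"
  have Em: "E \<in> sets W" unfolding E_def using \<Xi>1(1) \<Xi>2(1) by measurable
  have "measure W (space W - E) \<le> delta / 2 + delta / 2"
  proof -
    let ?B1 = "{w \<in> space W. \<not> (\<integral>\<^sup>+ x. f1 x w \<partial>\<Theta>) \<le> ennreal c}"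
    let ?B2 = "{w \<in> space W. \<not> (\<integral>\<^sup>+ A. f2 A w \<partial>piM) \<le> ennreal c}"
    have [measurable]: "?B1 \<in> sets W" "?B2 \<in> sets W" using \<Xi>1(1) \<Xi>2(1) by measurable
    have "space W - E = ?B1 \<union> ?B2" by (auto simp: E_def)
    then have "measure W (space W - E) \<le> measure W ?B1 + measure W ?B2"
      by (simp add: measure_Un_le)
    with \<Xi>1(2) \<Xi>2(2) show ?thesis by linarith
  qed
  then have Emeas: "1 - delta \<le> measure W E" using W.prob_compl[OF Em] by simp

  have bound: "risk_M l alg mmax (env MZ tau0) rho
      \<le> Phi_inv n (real (totalM n w) / (real n * real mmax) *
           Phi_inv (totalM n w) (emp_risk l alg n w rho)
             (Cterm rho piM (frakQ alg n w Q) (frakP MF n PP) delta) lam)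
          (enn2ereal (KL rho piM) + ereal (ln (2 / delta))) lamM"
    if wE: "w \<in> E" and rho: "prob_space rho" "sets rho = sets MA"
      and Q: "\<And>A. A \<in> space MA \<Longrightarrow> prob_space (Q A) \<and> sets (Q A) = sets (prob_algebra MF)"
      and Km: "(\<lambda>A. KL (frakQ alg n w Q A) (frakP MF n PP A)) \<in> borel_measurable MA" for w rho Q
  proof -
    have w: "w \<in> space WS" using wE Wsp by (simp add: E_def)
    interpret rho: prob_space rho by fact
    have sp: "space rho = space MA" using rho(2) by (rule sets_eq_imp_space_eq)
    have em: "expected_risk \<in> borel_measurable rho"
      using expected_risk_meas unfolding measurable_cong_sets[OF rho(2) refl] .
    have er: "0 \<le> expected_risk A \<and> expected_risk A \<le> 1" if "A \<in> space rho" for A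
      using expected_risk_range that sp by simp
    have R: "0 \<le> (\<integral>A. expected_risk A \<partial>rho)" "(\<integral>A. expected_risk A \<partial>rho) \<le> 1"
      by (rule rho.catoni_jensen(4,5)[OF em _ order_refl], rule er, assumption)+
    have mm: "(\<lambda>A. mean_risk A w) \<in> borel_measurable rho"
      using mean_risk_meas[OF w] unfolding measurable_cong_sets[OF rho(2) refl] .
    have mr: "0 \<le> mean_risk A w \<and> mean_risk A w \<le> 1" if "A \<in> space rho" for A
      using mean_risk_range[OF w] that sp by simp
    have B: "0 \<le> (\<integral>A. mean_risk A w \<partial>rho)" "(\<integral>A. mean_risk A w \<partial>rho) \<le> 1"
      by (rule rho.catoni_jensen(4,5)[OF mm _ order_refl], rule mr, assumption)+
    let ?EK = "\<integral>\<^sup>+ A. KL (frakQ alg n w Q A) (frakP MF n PP A) \<partial>rho"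
    let ?C = "Cterm rho piM (frakQ alg n w Q) (frakP MF n PP) delta"
    let ?Phi = "Phi_inv (totalM n w) (emp_risk l alg n w rho) ?C lam"
    show ?thesis unfolding risk_M_eq
    \<comment> \<open>With infinite divergence the budget is infinite and the inequality that
      defines \<open>Phi_inv\<close> is trivial; the mean divergence is treated alike below.\<close>
    proof (rule le_Phi_inv[OF R], cases "KL rho piM = \<infinity>")
      case True
      then show "ereal (catoni n lamM (\<integral>A. expected_risk A \<partial>rho))
        \<le> ereal (lamM * (real (totalM n w) / (real n * real mmax) * ?Phi)) + (enn2ereal (KL rho piM) + ereal (ln (2 / delta)))"
        by simp
    next
      case False
      then have KLe: "enn2ereal (KL rho piM) = ereal (enn2real (KL rho piM))"
        by (cases "KL rho piM") (auto simp: enn2ereal_ennreal)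
      have "(\<integral>A. mean_risk A w \<partial>rho) \<le> ?Phi"
      proof (rule le_Phi_inv[OF B], cases "?EK = \<infinity>")
        case True
        then show "ereal (catoni (totalM n w) lam (\<integral>A. mean_risk A w \<partial>rho)) \<le> ereal (lam * emp_risk l alg n w rho) + ?C"
          by (simp add: Cterm_def KLe)
      next
        case EK: False
        have "(\<integral>\<^sup>+ A. (\<integral>\<^sup>+ x. ennreal (exp (task_gap lam n (\<lambda>i. L i x) w)) \<partial>\<nu> A) \<partial>piM) = (\<integral>\<^sup>+ x. f1 x w \<partial>\<Theta>)"
        proof -
          have "(\<lambda>x. f1 x w) \<in> borel_measurable borel"
            using measurable_compose[OF measurable_Pair2'[OF w] task_gap_L_meas[OF code, of lam]]
            unfolding f1_def by simp
          then show ?thesis unfolding \<Theta>_def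
            by (subst nn_integral_bind[OF _ measurable_prob_algebraD[OF \<nu>]]) (auto simp: f1_def)
        qed
        also have "\<dots> \<le> ennreal c" using wE by (simp add: E_def)
        finally have \<Xi>: "(\<integral>\<^sup>+ A. (\<integral>\<^sup>+ x. ennreal (exp (task_gap lam n (\<lambda>i. L i x) w)) \<partial>\<nu> A) \<partial>piM) \<le> ennreal c" .
        have "?C = ereal (enn2real (KL rho piM) + enn2real ?EK + ln c)"
        proof -
          have "enn2ereal ?EK = ereal (enn2real ?EK)" using EK by (cases ?EK) (auto simp: enn2ereal_ennreal)
          then show ?thesis by (simp add: Cterm_def KLe c_def)
        qed
        moreover have "catoni (totalM n w) lam (\<integral>A. mean_risk A w \<partial>rho) \<le> lam * emp_risk l alg n w rho
          + (enn2real (KL rho piM) + enn2real ?EK + ln c)"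
        proof (rule inner_bound[OF code \<nu> _ w c less_imp_le[OF lam_pos] \<Xi> rho False _ Km EK])
          fix a b and \<phi> :: "real \<Rightarrow> real" and k :: "'a \<Rightarrow> real"
          assume "a \<in> piM \<rightarrow>\<^sub>M prob_algebra borel" "k \<in> borel_measurable piM"
            "\<forall>A\<in>space piM. \<forall>\<phi> b. \<phi> \<in> borel_measurable borel \<longrightarrow> (\<forall>x. \<bar>\<phi> x\<bar> \<le> b) \<longrightarrow>
              k A * exp (\<integral>x. \<phi> x \<partial>a A) \<le> (\<integral>x. exp (\<phi> x) \<partial>distr (frakP MF n PP A) borel (\<lambda>p. \<iota> (snd p)))"
            "\<phi> \<in> borel_measurable borel" "\<And>x. \<bar>\<phi> x\<bar> \<le> b"
          then show "AE A in piM. k A * exp (\<integral>x. \<phi> x \<partial>a A) \<le> (\<integral>x. exp (\<phi> x) \<partial>\<nu> A)"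
            by (rule dom)
        qed (use Q in auto)
        ultimately show "ereal (catoni (totalM n w) lam (\<integral>A. mean_risk A w \<partial>rho)) \<le> ereal (lam * emp_risk l alg n w rho) + ?C"
          by simp
      qed
      \<comment> \<open>The right side of the outer inequality is increasing in the mean risk, as
        the factors are nonnegative, so the inner bound may be substituted.\<close>
      then have "lamM * (real (totalM n w) / (real n * real mmax) * (\<integral>A. mean_risk A w \<partial>rho))
        \<le> lamM * (real (totalM n w) / (real n * real mmax) * ?Phi)"
        using lamM_pos by (intro mult_left_mono) auto
      moreover have "(\<integral>\<^sup>+ A. f2 A w \<partial>piM) \<le> ennreal c" using wE by (simp add: E_def)
      note outer_bound[OF w c less_imp_le[OF lamM_pos] this[unfolded f2_def] rho False]
      ultimately have "catoni n lamM (\<integral>A. expected_risk A \<partial>rho)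
        \<le> lamM * (real (totalM n w) / (real n * real mmax) * ?Phi) + (enn2real (KL rho piM) + ln c)" by linarith
      then show "ereal (catoni n lamM (\<integral>A. expected_risk A \<partial>rho))
        \<le> ereal (lamM * (real (totalM n w) / (real n * real mmax) * ?Phi)) + (enn2ereal (KL rho piM) + ereal (ln (2 / delta)))"
        by (simp add: KLe c_def)
    qed
  qed
  show ?thesis
    using Em Emeas bound unfolding W_def by (intro bexI[of _ E]) auto
qed

end
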